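(* Assume that $M_q$ is metrically subregular at $(\bar y,0)$ and metrically regular in the vicinity of $\bar y$. Further assume that for every direction $0\neq u\in\bar K$ and every maximal index set $\mathcal J\in\bar{\mathcal J}(u)$ the mapping $y\mapsto(q_i(y))_{i\in\mathcal J}$ is 2-regular at $\bar y$ in direction $u$, and assume that $\mathcal N(\bar y)\neq\{0\}$. Then $$N_{\mathrm{gph}\,\widehat N_\Gamma}(\bar y,\bar y^* )=\widehat N_{\mathrm{gph}\,\widehat N_\Gamma}(\bar y,\bar y^* )\ \cup\bigcup_{\substack{(v,v^* )\in T_{\mathrm{gph}\,\widehat N_\Gamma}(\bar y,\bar y^* )\\ v\neq0}}\ \bigcup_{\substack{(\lambda,\mu)\in\bar{\mathcal M}(v,v^* )\\ \mathcal J\in\bar{\mathcal J}(v)}}\ \bigcup_{I^+(\lambda,\mu)\subset I^+\subset\mathcal I\subset\mathcal J}Q(v,\lambda,I^+,\mathcal I).$$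
   Context: Setting. $q=(q_1,\dots,q_l):\mathbb R^m\to\mathbb R^l$ is twice continuously differentiable, $\Gamma=\{y\in\mathbb R^m: q_i(y)\le0,\ i=1,\dots,l\}$, $\mathcal I(y)=\{i: q_i(y)=0\}$ for $y\in\Gamma$. $\nabla q(y)$ is the $l\times m$ Jacobian with rows $\nabla q_i(y)$. $K^\circ$ denotes the negative polar of a cone $K$. Variational notions. For $\Omega\subset\mathbb R^d$ and $\bar z\in\Omega$: $T_\Omega(\bar z)=\{u:\exists t_k\downarrow0,u_k\to u,\ \bar z+t_ku_k\in\Omega\ \forall k\}$ (contingent cone); $\widehat N_\Omega(\bar z)=(T_\Omega(\bar z))^\circ$ (regular normal cone); $N_\Omega(\bar z)=\{z^*:\exists z_k\to\bar z,\ z_k\in\Omega,\ z_k^*\to z^*,\ z_k^*\in\widehat N_\Omega(z_k)\ \forall k\}$ (limiting normal cone). $\widehat N_\Gamma$ is regarded as the multifunction $y\mapsto\widehat N_\Gamma(y)$ (empty for $y\notin\Gamma$) with graph in $\mathbb R^m\times\mathbb R^m$. Regularity. A multifunction $\Psi:\mathbb R^d\rightrightarrows\mathbb R^s$ is metrically regular with modulus $\kappa>0$ near $(\bar u,\bar v)\in\mathrm{gph}\,\Psi$ if there are neighborhoods $U$ of $\bar u$, $V$ of $\bar v$ with $d(u,\Psi^{-1}(v))\le\kappa\, d(v,\Psi(u))$ for all $(u,v)\in U\times V$; it is metrically subregular at $(\bar u,\bar v)$ if for some $\kappa>0$ and neighborhood $U$ of $\bar u$, $d(u,\Psi^{-1}(\bar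 v))\le\kappa\, d(\bar v,\Psi(u))$ for all $u\in U$. $M_q(y):=q(y)-\mathbb R^l_-$ (so $M_q^{-1}(0)=\Gamma$). $M_q$ is metrically regular in the vicinity of $\bar y$ if there are a neighborhood $V$ of $\bar y$ and $\kappa>0$ such that for every $y\in\Gamma\cap V$, $y\neq\bar y$, $M_q$ is metrically regular near $(y,0)$ with modulus $\kappa$. 2-regularity. A map $g:\mathbb R^m\to\mathbb R^p$, twice Fréchet differentiable at $\bar y$, is 2-regular at $\bar y$ in direction $v$ if for every $\alpha\in\mathbb R^p$ the system $\nabla g(\bar y)u+v^T\nabla^2g(\bar y)w=\alpha$, $\nabla g(\bar y)w=0$ has a solution $(u,w)\in\mathbb R^m\times\mathbb R^m$, where $v^T\nabla^2g(\bar y)w$ is the vector with components $v^T\nabla^2g_i(\bar y)w$ (an empty family is 2-regular). Objects at the reference pair. Fix $\bar y\in\Gamma$, $\bar y^*\in\widehat N_\Gamma(\bar y)$. $\bar{\mathcal I}=\mathcal I(\bar y)$; $\mathcal N(\bar y)=\{v:\nabla q_i(\bar y)v=0,\ i\in\bar{\mathcal I}\}$; $T^{\rm lin}_\Gamma(\bar y)=\{v:\nabla q_i(\bar y)v\le0,\ i\in\bar{\mathcal I}\}$; $N_{\mathbb R^l_-}(q(\bar y))=\{\lambda\in\mathbb R^l_+:\lambda_i=0,\ i\notin\bar{\mathcal I}\}$; $\bar\Lambda=\{\lambda\in N_{\mathbb R^l_-}(q(\bar y)):\nabla q(\bar y)^T\lambda=\bar y^*\}$; $\bar K=T_\Gamma(\bar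 y)\cap(\bar y^* )^\perp$. For $v\in T^{\rm lin}_\Gamma(\bar y)$: $\bar{\mathcal I}(v)=\{i\in\bar{\mathcal I}:\nabla q_i(\bar y)v=0\}$; $\bar\Lambda(v)$ is the solution set of $\max_{\lambda\in\bar\Lambda}v^T\nabla^2(\lambda^Tq)(\bar y)v$; $\bar\Xi(v)=\{z\in\mathbb R^m:\nabla q_i(\bar y)z+v^T\nabla^2q_i(\bar y)v\le0,\ i\in\bar{\mathcal I}\}$; for $z\in\bar\Xi(v)$, $\mathcal J(z)=\{i\in\bar{\mathcal I}(v):\nabla q_i(\bar y)z+v^T\nabla^2q_i(\bar y)v=0\}$; $\bar{\mathcal J}(v)=\{\mathcal J(z):z\in\bar\Xi(v)\}$; an element of $\bar{\mathcal J}(v)$ is maximal if it is maximal with respect to inclusion within $\bar{\mathcal J}(v)$. $\bar{\mathcal M}(v,v^* )=\{(\lambda,\mu):\lambda\in\bar\Lambda(v),\ \mu\in T_{N_{\mathbb R^l_-}(q(\bar y))}(\lambda),\ v^*=\nabla^2(\lambda^Tq)(\bar y)v+\nabla q(\bar y)^T\mu\}$. $I^+(\lambda)=\{i:\lambda_i>0\}$ and, for $(\lambda,\mu)\in\bar{\mathcal M}(v,v^* )$, $I^+(\lambda,\mu)=I^+(\lambda)\cup\{i:\lambda_i=0,\mu_i>0\}$. For $I^+\subset\mathcal I\subset\bar{\mathcal I}$: $\bar K_{I^+,\mathcal I}=\{w:\nabla q_i(\bar y)w=0,\ i\in I^+;\ \nabla q_i(\bar y)w\le0,\ i\in\mathcal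 I\setminus I^+\}$; $\bar K_{I^+,\mathcal I}(v)$ is the set of $w\in\bar K_{I^+,\mathcal I}$ for which there is $z\in\mathbb R^m$ with $\nabla q_i(\bar y)z+v^T\nabla^2q_i(\bar y)w=0$ for $i\in I^+$ and $\le0$ for $i\in\mathcal I\setminus I^+$; and $Q(v,\lambda,I^+,\mathcal I)=\{(w^*,w): w\in\bar K_{I^+,\mathcal I}(v),\ w^*+\nabla^2(\lambda^Tq)(\bar y)w\in(\bar K_{I^+,\mathcal I}(v))^\circ\}$. *)

theory Defs
  imports "HOL-Analysis.Analysis"
begin

definition neg_polar :: "'a::real_inner set \<Rightarrow> 'a set" where
  "neg_polar K = {z. \<forall>u\<in>K. z \<bullet> u \<le> 0}"

definition contingent_cone :: "'a::real_normed_vector set \<Rightarrow> 'a \<Rightarrow> 'a set" where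
  "contingent_cone \<Omega> z =
    {u. \<exists>t :: nat \<Rightarrow> real. \<exists>U :: nat \<Rightarrow> 'a.
          (\<forall>k. t k > 0) \<and> t \<longlonglongrightarrow> 0 \<and> U \<longlonglongrightarrow> u \<and> (\<forall>k. z + t k *\<^sub>R U k \<in> \<Omega>)}"

definition regular_normal_cone :: "'a::real_inner set \<Rightarrow> 'a \<Rightarrow> 'a set" where
  "regular_normal_cone \<Omega> z = (if z \<in> \<Omega> then neg_polar (contingent_cone \<Omega> z) else {})"

definition limiting_normal_cone :: "'a::real_inner set \<Rightarrow> 'a \<Rightarrow> 'a set" where
  "limiting_normal_cone \<Omega> z =
    {z'. \<exists>Z Z' :: nat \<Rightarrow> 'a. Z \<longlonglongrightarrow> z \<and> (\<forall>k. Z k \<in> \<Omega>) \<and> Z' \<longlonglongrightarrow> z' \<and>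
          (\<forall>k. Z' k \<in> regular_normal_cone \<Omega> (Z k))}"

definition gph :: "('a \<Rightarrow> 'b set) \<Rightarrow> ('a \<times> 'b) set" where
  "gph \<Psi> = {(x, y). y \<in> \<Psi> x}"

definition inv_mf :: "('a \<Rightarrow> 'b set) \<Rightarrow> 'b \<Rightarrow> 'a set" where
  "inv_mf \<Psi> v = {u. v \<in> \<Psi> u}"

text \<open>The distance to the empty set is infinite here, whereas \<open>infdist x {} = 0\<close>.\<close>

definition edist_set :: "'a::metric_space \<Rightarrow> 'a set \<Rightarrow> ereal" where
  "edist_set x S = (INF y\<in>S. ereal (dist x y))"

definition metrically_regular_near ::
    "('a::metric_space \<Rightarrow> 'b::metric_space set) \<Rightarrow> real \<Rightarrow> 'a \<Rightarrow> 'b \<Rightarrow> bool" where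
  "metrically_regular_near \<Psi> \<kappa> u0 v0 \<longleftrightarrow>
     (u0, v0) \<in> gph \<Psi> \<and> \<kappa> > 0 \<and>
     (\<exists>U V. open U \<and> u0 \<in> U \<and> open V \<and> v0 \<in> V \<and>
        (\<forall>u\<in>U. \<forall>v\<in>V. edist_set u (inv_mf \<Psi> v) \<le> ereal \<kappa> * edist_set v (\<Psi> u)))"

definition metrically_subregular_at ::
    "('a::metric_space \<Rightarrow> 'b::metric_space set) \<Rightarrow> 'a \<Rightarrow> 'b \<Rightarrow> bool" where
  "metrically_subregular_at \<Psi> u0 v0 \<longleftrightarrow>
     (u0, v0) \<in> gph \<Psi> \<and>
     (\<exists>\<kappa>>0. \<exists>U. open U \<and> u0 \<in> U \<and>
        (\<forall>u\<in>U. edist_set u (inv_mf \<Psi> v0) \<le> ereal \<kappa> * edist_set v0 (\<Psi> u)))"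

definition gradient :: "(real^'m \<Rightarrow> real) \<Rightarrow> real^'m \<Rightarrow> real^'m" where
  "gradient f y = (\<chi> j. frechet_derivative f (at y) (axis j 1))"

definition hessian :: "(real^'m \<Rightarrow> real) \<Rightarrow> real^'m \<Rightarrow> real^'m^'m" where
  "hessian f y = jacobian (gradient f) (at y)"

definition twice_cont_diff :: "(real^'m \<Rightarrow> real^'l) \<Rightarrow> bool" where
  "twice_cont_diff q \<longleftrightarrow>
     (\<forall>i. (\<lambda>y. q y $ i) differentiable_on UNIV \<and>
          gradient (\<lambda>y. q y $ i) differentiable_on UNIV \<and>
          continuous_on UNIV (hessian (\<lambda>y. q y $ i)))"

lemma jacobian_row:
  fixes q :: "real^'m \<Rightarrow> real^'l"
  assumes "q differentiable (at y)"
  shows "jacobian q (at y) $ i = gradient (\<lambda>x. q x $ i) y"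
proof -
  let ?D = "frechet_derivative q (at y)"
  have "(q has_derivative ?D) (at y)"
    using assms by (simp add: frechet_derivative_works)
  then have "((\<lambda>x. q x $ i) has_derivative (\<lambda>h. ?D h $ i)) (at y)"
    by (rule bounded_linear.has_derivative[OF bounded_linear_vec_nth])
  then have "frechet_derivative (\<lambda>x. q x $ i) (at y) = (\<lambda>h. ?D h $ i)"
    by (rule frechet_derivative_at[symmetric])
  then show ?thesis
    by (simp add: jacobian_def matrix_def gradient_def vec_eq_iff)
qed

abbreviation dcomp :: "(real^'m \<Rightarrow> real^'l) \<Rightarrow> real^'m \<Rightarrow> 'l \<Rightarrow> real^'m \<Rightarrow> real" where
  "dcomp q y i v \<equiv> gradient (\<lambda>x. q x $ i) y \<bullet> v"

abbreviation d2comp :: "(real^'m \<Rightarrow> real^'l) \<Rightarrow> real^'m \<Rightarrow> 'l \<Rightarrow> real^'m \<Rightarrow> real^'m \<Rightarrow> real" where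
  "d2comp q y i v w \<equiv> v \<bullet> (hessian (\<lambda>x. q x $ i) y *v w)"

text \<open>2-regularity in direction \<open>v\<close> of the subfamily of components with indices in \<open>J\<close>,
  i.e. of the map \<open>(q\<^sub>i)\<close>, \<open>i \<in> J\<close>; only the components of \<open>\<alpha>\<close> with index in \<open>J\<close> matter.
  Twice differentiability of \<open>q\<close> at \<open>y\<close> is presupposed.\<close>

definition two_regular :: "(real^'m \<Rightarrow> real^'l) \<Rightarrow> 'l set \<Rightarrow> real^'m \<Rightarrow> real^'m \<Rightarrow> bool" where
  "two_regular q J y v \<longleftrightarrow>
     (\<forall>\<alpha> :: 'l \<Rightarrow> real. \<exists>u w :: real^'m.
        (\<forall>i\<in>J. dcomp q y i u + d2comp q y i v w = \<alpha> i \<and> dcomp q y i w = 0))"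

definition nonpos_orthant :: "(real^'l) set" where
  "nonpos_orthant = {r. \<forall>i. r $ i \<le> 0}"

definition feasible :: "(real^'m \<Rightarrow> real^'l) \<Rightarrow> (real^'m) set" where
  "feasible q = {y. \<forall>i. q y $ i \<le> 0}"

definition active :: "(real^'m \<Rightarrow> real^'l) \<Rightarrow> real^'m \<Rightarrow> 'l set" where
  "active q y = {i. q y $ i = 0}"

definition constraint_mf :: "(real^'m \<Rightarrow> real^'l) \<Rightarrow> real^'m \<Rightarrow> (real^'l) set" where
  "constraint_mf q y = {q y - r | r. r \<in> nonpos_orthant}"

definition regular_in_vicinity :: "(real^'m \<Rightarrow> real^'l) \<Rightarrow> real^'m \<Rightarrow> bool" where
  "regular_in_vicinity q y0 \<longleftrightarrow>
     (\<exists>V \<kappa>. open V \<and> y0 \<in> V \<and> \<kappa> > 0 \<and>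
        (\<forall>y \<in> feasible q \<inter> V. y \<noteq> y0 \<longrightarrow> metrically_regular_near (constraint_mf q) \<kappa> y 0))"

definition null_active :: "(real^'m \<Rightarrow> real^'l) \<Rightarrow> real^'m \<Rightarrow> (real^'m) set" where
  "null_active q y = {v. \<forall>i \<in> active q y. dcomp q y i v = 0}"

text \<open>The normal cone to the nonpositive orthant at \<open>q y\<close>, for feasible \<open>y\<close>.\<close>

definition multiplier_cone :: "(real^'m \<Rightarrow> real^'l) \<Rightarrow> real^'m \<Rightarrow> (real^'l) set" where
  "multiplier_cone q y = {lam. (\<forall>i. lam $ i \<ge> 0) \<and> (\<forall>i. i \<notin> active q y \<longrightarrow> lam $ i = 0)}"

definition multipliers :: "(real^'m \<Rightarrow> real^'l) \<Rightarrow> real^'m \<Rightarrow> real^'m \<Rightarrow> (real^'l) set" where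
  "multipliers q y y' =
     {lam \<in> multiplier_cone q y. transpose (jacobian q (at y)) *v lam = y'}"

abbreviation lag_hessian :: "(real^'m \<Rightarrow> real^'l) \<Rightarrow> real^'m \<Rightarrow> real^'l \<Rightarrow> real^'m^'m" where
  "lag_hessian q y lam \<equiv> hessian (\<lambda>x. lam \<bullet> q x) y"

definition dir_multipliers ::
    "(real^'m \<Rightarrow> real^'l) \<Rightarrow> real^'m \<Rightarrow> real^'m \<Rightarrow> real^'m \<Rightarrow> (real^'l) set" where
  "dir_multipliers q y y' v =
     {lam \<in> multipliers q y y'. \<forall>lam' \<in> multipliers q y y'.
        v \<bullet> (lag_hessian q y lam' *v v) \<le> v \<bullet> (lag_hessian q y lam *v v)}"

definition critical_cone :: "(real^'m \<Rightarrow> real^'l) \<Rightarrow> real^'m \<Rightarrow> real^'m \<Rightarrow> (real^'m) set" where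
  "critical_cone q y y' = contingent_cone (feasible q) y \<inter> {v. y' \<bullet> v = 0}"

text \<open>The next four objects are meant for directions \<open>v\<close> in the linearized tangent cone,
  that is \<open>dcomp q y i v \<le> 0\<close> for all active \<open>i\<close>.  Every contingent direction of the
  feasible set at a feasible \<open>y\<close> belongs to that cone when \<open>q\<close> is differentiable at \<open>y\<close>.\<close>

definition active_dir :: "(real^'m \<Rightarrow> real^'l) \<Rightarrow> real^'m \<Rightarrow> real^'m \<Rightarrow> 'l set" where
  "active_dir q y v = {i \<in> active q y. dcomp q y i v = 0}"

definition second_order_set :: "(real^'m \<Rightarrow> real^'l) \<Rightarrow> real^'m \<Rightarrow> real^'m \<Rightarrow> (real^'m) set" where
  "second_order_set q y v = {z. \<forall>i \<in> active q y. dcomp q y i z + d2comp q y i v v \<le> 0}"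

definition second_order_active ::
    "(real^'m \<Rightarrow> real^'l) \<Rightarrow> real^'m \<Rightarrow> real^'m \<Rightarrow> real^'m \<Rightarrow> 'l set" where
  "second_order_active q y v z = {i \<in> active_dir q y v. dcomp q y i z + d2comp q y i v v = 0}"

definition index_family :: "(real^'m \<Rightarrow> real^'l) \<Rightarrow> real^'m \<Rightarrow> real^'m \<Rightarrow> 'l set set" where
  "index_family q y v = second_order_active q y v ` second_order_set q y v"

definition maximal_in :: "'a set set \<Rightarrow> 'a set \<Rightarrow> bool" where
  "maximal_in F J \<longleftrightarrow> J \<in> F \<and> (\<forall>J'\<in>F. J \<subseteq> J' \<longrightarrow> J' = J)"

definition multiplier_pairs ::
    "(real^'m \<Rightarrow> real^'l) \<Rightarrow> real^'m \<Rightarrow> real^'m \<Rightarrow> real^'m \<Rightarrow> real^'m \<Rightarrow> ((real^'l) \<times> (real^'l)) set" where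
  "multiplier_pairs q y y' v v' =
     {(lam, mu). lam \<in> dir_multipliers q y y' v \<and>
        mu \<in> contingent_cone (multiplier_cone q y) lam \<and>
        v' = lag_hessian q y lam *v v + transpose (jacobian q (at y)) *v mu}"

definition pos_index :: "real^'l \<Rightarrow> real^'l \<Rightarrow> 'l set" where
  "pos_index lam mu = {i. lam $ i > 0} \<union> {i. lam $ i = 0 \<and> mu $ i > 0}"

definition index_cone ::
    "(real^'m \<Rightarrow> real^'l) \<Rightarrow> real^'m \<Rightarrow> 'l set \<Rightarrow> 'l set \<Rightarrow> (real^'m) set" where
  "index_cone q y Ip I =
     {w. (\<forall>i\<in>Ip. dcomp q y i w = 0) \<and> (\<forall>i \<in> I - Ip. dcomp q y i w \<le> 0)}"

definition index_cone_dir ::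
    "(real^'m \<Rightarrow> real^'l) \<Rightarrow> real^'m \<Rightarrow> 'l set \<Rightarrow> 'l set \<Rightarrow> real^'m \<Rightarrow> (real^'m) set" where
  "index_cone_dir q y Ip I v =
     {w \<in> index_cone q y Ip I. \<exists>z :: real^'m.
        (\<forall>i\<in>Ip. dcomp q y i z + d2comp q y i v w = 0) \<and>
        (\<forall>i \<in> I - Ip. dcomp q y i z + d2comp q y i v w \<le> 0)}"

definition Q_set ::
    "(real^'m \<Rightarrow> real^'l) \<Rightarrow> real^'m \<Rightarrow> real^'m \<Rightarrow> real^'l \<Rightarrow> 'l set \<Rightarrow> 'l set
      \<Rightarrow> ((real^'m) \<times> (real^'m)) set" where
  "Q_set q y v lam Ip I =
     {(w', w). w \<in> index_cone_dir q y Ip I v \<and>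
        w' + lag_hessian q y lam *v w \<in> neg_polar (index_cone_dir q y Ip I v)}"

end

theory Submission
  imports Defs
begin

text \<open>Write \<open>g\<^sub>i\<close>, \<open>H\<^sub>i\<close> for the gradient and Hessian of \<open>q\<^sub>i\<close> at the reference point. Limiting normals split
  into those reached along points \<open>y\<^sub>k\<close> different from the reference point and those reached with
  \<open>y\<^sub>k\<close> equal to it.

  In the first case let \<open>v\<close> be a cluster point of the normalised displacements. Metric regularity in
  the vicinity bounds the multipliers at \<open>y\<^sub>k\<close>, and 2-regularity in direction \<open>v\<close> makes the active
  gradients at \<open>y\<^sub>k\<close> linearly independent with constant of order \<open>t\<^sub>k\<close>. Hence the regular normal
  cone to the graph at \<open>y\<^sub>k\<close> is given by the critical cone there, and these critical cones converge
  to the directional cone in \<open>Q\<close>. The component \<open>v\<^sup>*\<close> may be taken to be \<open>H\<^sub>\<lambda> v\<close>, that is \<open>\<mu> = 0\<close>.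
  Conversely, Brouwer's theorem produces curves of feasible points tangent to \<open>v\<close> with a prescribed
  active set, along which every element of \<open>Q\<close> is a limit of regular normals.

  In the second case fix a nonzero \<open>v\<close> in the null space. Since \<open>v\<close> and \<open>-v\<close> are both critical,
  testing a regular normal \<open>(w\<^sup>*, w)\<close> with \<open>v + s u\<close> for small \<open>s\<close> and applying Farkas' lemma and
  linear programming duality shows that \<open>(w\<^sup>*, w)\<close> lies in some set \<open>Q\<close> for the direction \<open>v\<close>, which
  reduces this case to the first one.\<close>

section \<open>Sequences\<close>

text \<open>The obstacle is that no constraint qualification is assumed at \<open>ybar\<close>
  itself: the active gradients may be dependent there and the multipliers unbounded. Constructions
  are therefore made at the scale of a step \<open>t\<close>, and 2-regularity supplies linear maps
  \<open>U\<close>, \<open>W\<close> for which moving by \<open>W b + t U b\<close> has a prescribed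
  effect of order \<open>t\<close> on the active gradients. It is assumed for maximal index sets
  only; maximality guarantees that a first-order correction invisible to \<open>J\<close> is
  invisible to every constraint that is active to first order along \<open>v\<close>, so corrected
  curves stay feasible. Second-order vectors \<open>z\<close> typically arise as unbounded
  sequences, so limits are taken in the right-hand sides of linear systems, where solvability is a
  closed condition. When the base point is fixed, the freedom of sign in \<open>v\<close> yields an
  equation instead of an inequality, and this equation gives the solvability condition on
  \<open>w\<close> that \<open>Q\<close> contains. All limits are recorded in the closure of one set
  of pairs (graph point, normal).\<close>

lemma sequentially_witness: "eventually P sequentially \<Longrightarrow> \<exists>k. P k"
  using eventually_happens'[OF sequentially_bot] by blast

lemma null_sequence: "\<exists>t :: nat \<Rightarrow> real. (\<forall>k. t k > 0 \<and> t k \<le> 1) \<and> t \<longlonglongrightarrow> 0"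
  using lim_inverse_n'[THEN LIMSEQ_Suc] by (intro exI[of _ "\<lambda>k. 1 / real (Suc k)"]) auto

lemma infinite_subseq:
  assumes "\<not> eventually P sequentially"
  obtains r :: "nat \<Rightarrow> nat" where "strict_mono r" "\<And>k. \<not> P (r k)"
proof -
  have "infinite {k. \<not> P k}"
    using assms by (simp add: cofinite_eq_sequentially [symmetric] eventually_cofinite)
  then show ?thesis
    using infinite_enumerate [of "{k. \<not> P k}"] that by auto
qed

lemma const_subseq:
  fixes f :: "nat \<Rightarrow> 'a::finite"
  obtains r :: "nat \<Rightarrow> nat" and a where "strict_mono r" "\<And>k. f (r k) = a"
proof -
  obtain k0 where "infinite {k \<in> UNIV. f k = f k0}"
    using pigeonhole_infinite [of "UNIV :: nat set" f] by auto
  then obtain r :: "nat \<Rightarrow> nat" where "strict_mono r" "\<forall>k. r k \<in> {k \<in> UNIV. f k = f k0}"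
    using infinite_enumerate by blast
  then show ?thesis using that by auto
qed

text \<open>Counterexamples along a subsequence would have a cluster point in \<open>C\<close>,
  contradicting \<open>ex\<close> for the composed index map. This turns limits along arbitrary
  parameter sequences into estimates that hold on a whole ball at a single \<open>k\<close>, as a
  fixed point argument or an operator bound requires.\<close>

lemma eventually_ball_compact:
  assumes C: "compact (C :: 'a::metric_space set)"
    and ex: "\<And>r b b0. strict_mono (r :: nat \<Rightarrow> nat) \<Longrightarrow> (\<And>k. b k \<in> C) \<Longrightarrow> b \<longlonglongrightarrow> b0 \<Longrightarrow> b0 \<in> C
       \<Longrightarrow> \<exists>k. P (r k) (b k)"
  shows "\<forall>\<^sub>F k in sequentially. \<forall>b\<in>C. P k b"
proof (rule ccontr)
  assume "\<not> ?thesis"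
  then obtain r :: "nat \<Rightarrow> nat" where r: "strict_mono r" "\<And>k. \<not> (\<forall>b\<in>C. P (r k) b)"
    using infinite_subseq[of "\<lambda>k. \<forall>b\<in>C. P k b"] by blast
  then have "\<forall>k. \<exists>b. b \<in> C \<and> \<not> P (r k) b" by blast
  then obtain b where b: "\<And>k. b k \<in> C" "\<And>k. \<not> P (r k) (b k)" by metis
  obtain b0 s where s: "b0 \<in> C" "strict_mono s" "(b \<circ> s) \<longlonglongrightarrow> b0"
    using C b(1) unfolding compact_def by blast
  have "\<exists>k. P ((r \<circ> s) k) ((b \<circ> s) k)"
    by (rule ex[OF strict_mono_o[OF r(1) s(2)] _ s(3) s(1)]) (simp add: b)
  then show False using b by simp
qed

lemma choice_eventually:
  assumes "\<forall>\<^sub>F k in F. \<exists>x. P k x"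
  obtains f where "\<forall>\<^sub>F k in F. P k (f k)"
proof -
  have "\<forall>\<^sub>F k in F. P k (SOME x. P k x)"
    using assms by (rule eventually_mono) (rule someI_ex)
  then show ?thesis using that[of "\<lambda>k. SOME x. P k x"] by simp
qed

section \<open>Systems of linear inequalities\<close>

text \<open>A finitely generated cone is closed, so a point outside it is strictly separated; since
  the cone contains 0 and is closed under scaling, the negated separating functional is nonpositive
  on \<open>S\<close>.\<close>

lemma farkas_hull:
  fixes S :: "'a::euclidean_space set"
  assumes S: "finite S" and x: "\<And>a. (\<And>s. s \<in> S \<Longrightarrow> a \<bullet> s \<le> 0) \<Longrightarrow> a \<bullet> x \<le> 0"
  shows "x \<in> convex_cone hull S"
proof (rule ccontr)
  assume "x \<notin> convex_cone hull S"
  then obtain a b where ab: "a \<bullet> x < b" "\<And>y. y \<in> convex_cone hull S \<Longrightarrow> a \<bullet> y > b"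
    using separating_hyperplane_closed_point[OF convex_convex_cone_hull closed_convex_cone_hull[OF S]]
    by metis
  have b: "b < 0" using ab(2)[OF convex_cone_hull_contains_0] by simp
  have "(- a) \<bullet> s \<le> 0" if s: "s \<in> S" for s
  proof (rule ccontr)
    assume "\<not> (- a) \<bullet> s \<le> 0"
    then have n: "a \<bullet> s < 0" by simp
    \<comment> \<open>The multiple is chosen so that \<open>a\<close> takes exactly the value
      \<open>b\<close> on it, which strict separation forbids.\<close>
    have "(b / (a \<bullet> s)) *\<^sub>R s \<in> convex_cone hull S"
      using b n by (intro convex_cone_hull_mul hull_inc s) (simp add: divide_nonpos_neg)
    from ab(2)[OF this] n show False by simp
  qed
  then have "(- a) \<bullet> x \<le> 0" by (rule x)
  with ab(1) b show False by simp
qed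

text \<open>Multipliers are kept as one vector indexed by all constraints, zero outside
  \<open>A\<close> and of free sign on \<open>E\<close>; the free signs come from adjoining the
  generators \<open>- g i\<close> for \<open>i \<in> E\<close>.\<close>

lemma farkas:
  fixes g :: "'l::finite \<Rightarrow> 'a::euclidean_space"
  assumes EA: "E \<subseteq> A"
    and x: "\<And>a. (\<And>i. i \<in> E \<Longrightarrow> g i \<bullet> a = 0) \<Longrightarrow> (\<And>i. i \<in> A - E \<Longrightarrow> g i \<bullet> a \<le> 0) \<Longrightarrow> x \<bullet> a \<le> 0"
  shows "\<exists>lam :: real^'l. (\<forall>i. i \<notin> A \<longrightarrow> lam $ i = 0) \<and> (\<forall>i\<in>A - E. lam $ i \<ge> 0) \<and>
    x = (\<Sum>i\<in>UNIV. lam $ i *\<^sub>R g i)"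
proof -
  define P where "P lam \<longleftrightarrow> (\<forall>i. i \<notin> A \<longrightarrow> lam $ i = 0) \<and> (\<forall>i\<in>A - E. lam $ i \<ge> 0)"
    for lam :: "real^'l"
  define C where "C = {\<Sum>i\<in>UNIV. lam $ i *\<^sub>R g i | lam. P lam}"
  have "convex_cone C"
    unfolding convex_cone_iff
  proof (intro conjI ballI allI impI)
    have "P 0" "0 = (\<Sum>i\<in>UNIV. (0::real^'l) $ i *\<^sub>R g i)" by (simp_all add: P_def)
    then show "0 \<in> C" unfolding C_def by blast
    fix u v assume "u \<in> C" "v \<in> C"
    then obtain l m where lm: "P l" "P m" "u = (\<Sum>i\<in>UNIV. l $ i *\<^sub>R g i)" "v = (\<Sum>i\<in>UNIV. m $ i *\<^sub>R g i)"
      unfolding C_def by blast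
    have "P (l + m)" "u + v = (\<Sum>i\<in>UNIV. (l + m) $ i *\<^sub>R g i)"
      using lm by (auto simp: P_def scaleR_left_distrib sum.distrib)
    then show "u + v \<in> C" unfolding C_def by blast
  next
    fix u and c :: real assume "u \<in> C" "0 \<le> c"
    then obtain l where l: "P l" "u = (\<Sum>i\<in>UNIV. l $ i *\<^sub>R g i)" unfolding C_def by blast
    have "P (c *\<^sub>R l)" "c *\<^sub>R u = (\<Sum>i\<in>UNIV. (c *\<^sub>R l) $ i *\<^sub>R g i)"
      using l \<open>0 \<le> c\<close> by (auto simp: P_def scaleR_sum_right)
    then show "c *\<^sub>R u \<in> C" unfolding C_def by blast
  qed
  have unit: "(\<Sum>i\<in>UNIV. (c *\<^sub>R axis j 1 :: real^'l) $ i *\<^sub>R g i) = c *\<^sub>R g j" for j c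
  proof -
    have "(\<Sum>i\<in>UNIV. (c *\<^sub>R axis j 1 :: real^'l) $ i *\<^sub>R g i) = (\<Sum>i\<in>UNIV. if i = j then c *\<^sub>R g j else 0)"
      by (intro sum.cong) (auto simp: axis_def)
    then show ?thesis by simp
  qed
  have inC: "c *\<^sub>R g j \<in> C" if "j \<in> A" "c \<ge> 0 \<or> j \<in> E" for j c
  proof -
    have "P (c *\<^sub>R axis j 1)" using that by (auto simp: P_def axis_def)
    then show ?thesis unfolding C_def using unit[of c j, symmetric] by blast
  qed
  have "g ` A \<union> (\<lambda>i. - g i) ` E \<subseteq> C"
    using inC[of _ 1] inC[of _ "-1"] EA by auto
  then have "convex_cone hull (g ` A \<union> (\<lambda>i. - g i) ` E) \<subseteq> C"
    using \<open>convex_cone C\<close> by (rule hull_minimal)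
  moreover have "x \<in> convex_cone hull (g ` A \<union> (\<lambda>i. - g i) ` E)"
  proof (rule farkas_hull)
    fix a assume a: "\<And>s. s \<in> g ` A \<union> (\<lambda>i. - g i) ` E \<Longrightarrow> a \<bullet> s \<le> 0"
    have "x \<bullet> a \<le> 0"
    proof (rule x)
      show "g i \<bullet> a = 0" if "i \<in> E" for i
        using a[of "g i"] a[of "- g i"] that EA by (auto simp: inner_commute)
      show "g i \<bullet> a \<le> 0" if "i \<in> A - E" for i
        using a[of "g i"] that by (auto simp: inner_commute)
    qed
    then show "a \<bullet> x \<le> 0" by (simp add: inner_commute)
  qed simp
  ultimately show ?thesis unfolding C_def P_def by blast
qed

lemma inner_sum_scaleR:
  fixes g :: "'l::finite \<Rightarrow> 'a::real_inner"
  shows "(\<Sum>i\<in>UNIV. lam $ i *\<^sub>R g i) \<bullet> z = (\<Sum>i\<in>UNIV. lam $ i * (g i \<bullet> z))"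
  by (simp add: inner_sum_left)

text \<open>The solvable right-hand sides form a convex cone containing the finite set
  \<open>S\<close>, made of the slack directions, the unconstrained coordinates and both signs of
  the columns of the system. The polar of \<open>S\<close> consists of the certificates \<eta> in
  the assumption, so \<open>farkas_hull\<close> applies to \<open>c\<close>.\<close>

lemma gale:
  fixes g :: "'l::finite \<Rightarrow> 'a::euclidean_space" and c :: "real^'l"
  assumes EA: "E \<subseteq> A"
    and c: "\<And>\<eta> :: real^'l. (\<And>i. i \<notin> A \<Longrightarrow> \<eta> $ i = 0) \<Longrightarrow> (\<And>i. i \<in> A - E \<Longrightarrow> \<eta> $ i \<ge> 0) \<Longrightarrow>
       (\<Sum>i\<in>UNIV. \<eta> $ i *\<^sub>R g i) = 0 \<Longrightarrow> \<eta> \<bullet> c \<le> 0"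
  shows "\<exists>z. (\<forall>i\<in>E. g i \<bullet> z + c $ i = 0) \<and> (\<forall>i\<in>A - E. g i \<bullet> z + c $ i \<le> 0)"
proof -
  define C where "C = {c :: real^'l. \<exists>z. (\<forall>i\<in>E. g i \<bullet> z + c $ i = 0) \<and> (\<forall>i\<in>A - E. g i \<bullet> z + c $ i \<le> 0)}"
  define S where "S = (\<lambda>i. axis i 1) ` (- A) \<union> (\<lambda>i. - axis i 1) ` (- E) \<union>
     (\<lambda>b. \<chi> i. g i \<bullet> b) ` Basis \<union> (\<lambda>b. \<chi> i. - (g i \<bullet> b)) ` (Basis :: 'a set)"
  have "convex_cone C"
    unfolding convex_cone_iff
  proof (intro conjI ballI allI impI)
    show "0 \<in> C" unfolding C_def by (auto intro!: exI[of _ 0])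
    fix u v assume "u \<in> C" "v \<in> C"
    then obtain y z where yz: "\<And>i. i \<in> E \<Longrightarrow> g i \<bullet> y + u $ i = 0" "\<And>i. i \<in> A - E \<Longrightarrow> g i \<bullet> y + u $ i \<le> 0"
      "\<And>i. i \<in> E \<Longrightarrow> g i \<bullet> z + v $ i = 0" "\<And>i. i \<in> A - E \<Longrightarrow> g i \<bullet> z + v $ i \<le> 0"
      unfolding C_def by blast
    have *: "g i \<bullet> (y + z) + (u + v) $ i = (g i \<bullet> y + u $ i) + (g i \<bullet> z + v $ i)" for i
      by (simp add: inner_add_right)
    have "(\<forall>i\<in>E. g i \<bullet> (y + z) + (u + v) $ i = 0) \<and> (\<forall>i\<in>A - E. g i \<bullet> (y + z) + (u + v) $ i \<le> 0)"
      unfolding * using yz by (auto simp: add_nonpos_nonpos)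
    then show "u + v \<in> C" unfolding C_def by blast
  next
    fix u and d :: real assume "u \<in> C" "0 \<le> d"
    then obtain y where y: "\<forall>i\<in>E. g i \<bullet> y + u $ i = 0" "\<forall>i\<in>A - E. g i \<bullet> y + u $ i \<le> 0"
      unfolding C_def by blast
    have *: "g i \<bullet> (d *\<^sub>R y) + (d *\<^sub>R u) $ i = d * (g i \<bullet> y + u $ i)" for i
      by (simp add: algebra_simps)
    have "(\<forall>i\<in>E. g i \<bullet> (d *\<^sub>R y) + (d *\<^sub>R u) $ i = 0) \<and> (\<forall>i\<in>A - E. g i \<bullet> (d *\<^sub>R y) + (d *\<^sub>R u) $ i \<le> 0)"
      unfolding * using y \<open>0 \<le> d\<close> by (auto intro: mult_nonneg_nonpos)
    then show "d *\<^sub>R u \<in> C" unfolding C_def by blast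
  qed
  moreover have "S \<subseteq> C"
  proof -
    have 1: "axis j 1 \<in> C" if "j \<notin> A" for j
      unfolding C_def using that EA by (auto intro!: exI[of _ 0] simp: axis_def)
    have 2: "- axis j 1 \<in> C" if "j \<notin> E" for j
      unfolding C_def using that by (auto intro!: exI[of _ 0] simp: axis_def)
    have 3: "(\<chi> i. g i \<bullet> b) \<in> C" for b
      unfolding C_def by (auto intro!: exI[of _ "- b"])
    have 4: "(\<chi> i. - (g i \<bullet> b)) \<in> C" for b
      unfolding C_def by (auto intro!: exI[of _ b])
    show ?thesis unfolding S_def using 1 2 3 4 by auto
  qed
  ultimately have "convex_cone hull S \<subseteq> C" by (simp add: hull_minimal)
  moreover have "c \<in> convex_cone hull S"
  proof (rule farkas_hull)
    show "finite S" unfolding S_def by simp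
    fix \<eta> assume \<eta>: "\<And>s. s \<in> S \<Longrightarrow> \<eta> \<bullet> s \<le> 0"
    have ax: "\<eta> \<bullet> axis i 1 = \<eta> $ i" for i by (simp add: inner_axis)
    show "\<eta> \<bullet> c \<le> 0"
    proof (rule c)
      show E: "\<eta> $ i \<ge> 0" if "i \<in> A - E" for i
      proof -
        have "- axis i 1 \<in> S" using that by (auto simp: S_def)
        then show ?thesis using \<eta>[of "- axis i 1"] ax[of i] by simp
      qed
      show "\<eta> $ i = 0" if "i \<notin> A" for i
      proof -
        have "- axis i 1 \<in> S" "axis i 1 \<in> S" using that EA by (auto simp: S_def)
        then show ?thesis using \<eta>[of "- axis i 1"] \<eta>[of "axis i 1"] ax[of i] by simp
      qed
      show "(\<Sum>i\<in>UNIV. \<eta> $ i *\<^sub>R g i) = 0"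
      proof (rule euclidean_eqI)
        fix b :: 'a assume b: "b \<in> Basis"
        have "\<eta> \<bullet> (\<chi> i. g i \<bullet> b) \<le> 0" "\<eta> \<bullet> (\<chi> i. - (g i \<bullet> b)) \<le> 0"
          using b by (auto intro!: \<eta> simp: S_def)
        then show "(\<Sum>i\<in>UNIV. \<eta> $ i *\<^sub>R g i) \<bullet> b = 0 \<bullet> b"
          by (simp add: inner_sum_scaleR inner_vec_def sum_negf)
      qed
    qed
  qed
  ultimately show ?thesis unfolding C_def by blast
qed

lemma sum_nonpos_of_signs:
  fixes \<eta> :: "real^'l" and h :: "'l \<Rightarrow> real"
  assumes "\<And>i. i \<notin> A \<Longrightarrow> \<eta> $ i = 0" "\<And>i. i \<in> A - E \<Longrightarrow> \<eta> $ i \<ge> 0"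
    "\<And>i. i \<in> E \<Longrightarrow> h i = 0" "\<And>i. i \<in> A - E \<Longrightarrow> h i \<le> 0"
  shows "(\<Sum>i\<in>UNIV. \<eta> $ i * h i) \<le> 0"
proof (rule sum_nonpos)
  fix i
  show "\<eta> $ i * h i \<le> 0"
    using assms[of i] by (cases "i \<in> A"; cases "i \<in> E") (auto intro: mult_nonneg_nonpos)
qed

text \<open>Solutions \<open>z\<close> may be unbounded while the right-hand sides converge, so
  compactness is of no use. Instead \<open>gale\<close> exhibits the set as an intersection of
  closed half-spaces, one per certificate. Second-order systems are passed to the limit by this
  lemma.\<close>

lemma closed_solvable:
  fixes g :: "'l::finite \<Rightarrow> 'a::euclidean_space"
  assumes EA: "E \<subseteq> A"
  shows "closed {c :: real^'l. \<exists>z. (\<forall>i\<in>E. g i \<bullet> z + c $ i = 0) \<and> (\<forall>i\<in>A - E. g i \<bullet> z + c $ i \<le> 0)}"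
    (is "closed ?C")
proof -
  define N where "N = {\<eta> :: real^'l. (\<forall>i. i \<notin> A \<longrightarrow> \<eta> $ i = 0) \<and> (\<forall>i\<in>A - E. \<eta> $ i \<ge> 0) \<and>
       (\<Sum>i\<in>UNIV. \<eta> $ i *\<^sub>R g i) = 0}"
  have "?C = (\<Inter>\<eta>\<in>N. {c. \<eta> \<bullet> c \<le> 0})"
  proof (intro equalityI subsetI)
    fix c assume "c \<in> ?C"
    then obtain z where z: "\<forall>i\<in>E. g i \<bullet> z + c $ i = 0" "\<forall>i\<in>A - E. g i \<bullet> z + c $ i \<le> 0" by blast
    have "\<eta> \<bullet> c \<le> 0" if \<eta>: "\<eta> \<in> N" for \<eta>
    proof -
      have "(\<Sum>i\<in>UNIV. \<eta> $ i * (g i \<bullet> z + c $ i)) \<le> 0"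
        using \<eta> z unfolding N_def by (intro sum_nonpos_of_signs[of A \<eta> E]) auto
      moreover have "(\<Sum>i\<in>UNIV. \<eta> $ i * (g i \<bullet> z)) = 0"
        using \<eta> inner_sum_scaleR[of \<eta> g z] unfolding N_def by simp
      ultimately show ?thesis by (simp add: distrib_left sum.distrib inner_vec_def)
    qed
    then show "c \<in> (\<Inter>\<eta>\<in>N. {c. \<eta> \<bullet> c \<le> 0})" by blast
  next
    fix c assume c: "c \<in> (\<Inter>\<eta>\<in>N. {c. \<eta> \<bullet> c \<le> 0})"
    show "c \<in> ?C"
      unfolding mem_Collect_eq by (rule gale[OF EA]) (use c in \<open>auto simp: N_def\<close>)
  qed
  then show ?thesis by (simp add: closed_INT closed_halfspace_le)
qed

text \<open>The levels \<open>\<alpha>\<close> reached by \<open>n\<close> on \<open>F\<close> are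
  those for which the system with one more inequality is solvable. They form a closed set, so the
  supremum is attained even if \<open>F\<close> is unbounded.\<close>

lemma linear_attains_max:
  fixes g :: "'l::finite \<Rightarrow> 'a::euclidean_space" and c :: "real^'l"
  assumes EA: "E \<subseteq> A"
  defines "F \<equiv> {z. (\<forall>i\<in>E. g i \<bullet> z + c $ i = 0) \<and> (\<forall>i\<in>A - E. g i \<bullet> z + c $ i \<le> 0)}"
  assumes ne: "F \<noteq> {}" and bd: "\<And>z. z \<in> F \<Longrightarrow> n \<bullet> z \<le> b"
  shows "\<exists>z\<in>F. \<forall>z'\<in>F. n \<bullet> z' \<le> n \<bullet> z"
proof -
  \<comment> \<open>The index \<open>None\<close> carries the added row
    \<open>\<alpha> - n \<bullet> z \<le> 0\<close>.\<close>
  define g' where "g' = case_option (- n) g"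
  define c' where "c' \<alpha> = (\<chi> i. case_option \<alpha> (\<lambda>i. c $ i) i)" for \<alpha> :: real
  define A' where "A' = insert None (Some ` A)"
  define D where "D = {\<alpha>. \<exists>z\<in>F. \<alpha> \<le> n \<bullet> z}"
  have "D = c' -` {c. \<exists>z. (\<forall>i\<in>Some ` E. g' i \<bullet> z + c $ i = 0) \<and> (\<forall>i\<in>A' - Some ` E. g' i \<bullet> z + c $ i \<le> 0)}"
  proof -
    have "(\<forall>i\<in>Some ` E. g' i \<bullet> z + c' \<alpha> $ i = 0) \<and> (\<forall>i\<in>A' - Some ` E. g' i \<bullet> z + c' \<alpha> $ i \<le> 0) \<longleftrightarrow>
      z \<in> F \<and> \<alpha> \<le> n \<bullet> z" for z \<alpha>
    proof -
      have "A' - Some ` E = insert None (Some ` (A - E))" by (auto simp: A'_def)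
      then show ?thesis by (auto simp: F_def g'_def c'_def)
    qed
    then show ?thesis by (simp add: D_def vimage_def Bex_def)
  qed
  moreover have "continuous_on UNIV c'"
    unfolding c'_def
  proof (rule continuous_on_vec_lambda)
    fix i show "continuous_on UNIV (\<lambda>\<alpha>. case_option \<alpha> (\<lambda>i. c $ i) i)"
      by (cases i) (simp_all add: continuous_intros)
  qed
  moreover have "Some ` E \<subseteq> A'" using EA by (auto simp: A'_def)
  ultimately have "closed D"
    using continuous_closed_vimage[OF closed_solvable[of "Some ` E" A' g'], of c']
    by (simp add: continuous_on_eq_continuous_at)
  moreover have "D \<noteq> {}" using ne unfolding D_def by auto
  moreover have "bdd_above D"
    by (rule bdd_aboveI[of _ b]) (use bd in \<open>force simp: D_def\<close>)
  ultimately have "Sup D \<in> D" by (simp add: closed_contains_Sup)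
  then obtain z where z: "z \<in> F" "Sup D \<le> n \<bullet> z" unfolding D_def by blast
  have "n \<bullet> z' \<le> n \<bullet> z" if "z' \<in> F" for z'
    using cSup_upper[OF _ \<open>bdd_above D\<close>, of "n \<bullet> z'"] that z unfolding D_def by force
  with z show ?thesis by blast
qed

text \<open>Linear programming duality with complementary slackness: the dual feasible
  \<open>\<mu>0\<close> bounds \<open>n\<close> on the feasible set, so a maximiser \<open>z\<close>
  exists. Its optimality makes \<open>n\<close> nonpositive on all directions feasible at
  \<open>z\<close>, and Farkas' lemma yields multipliers supported on the rows that are tight
  there.\<close>

lemma lp_complementary:
  fixes g :: "'l::finite \<Rightarrow> 'a::euclidean_space" and c :: "real^'l" and \<mu>0 :: "real^'l"
  assumes EA: "E \<subseteq> A"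
    and z0: "\<And>i. i \<in> E \<Longrightarrow> g i \<bullet> z0 + c $ i = 0" "\<And>i. i \<in> A - E \<Longrightarrow> g i \<bullet> z0 + c $ i \<le> 0"
    and \<mu>0: "\<And>i. i \<notin> A \<Longrightarrow> \<mu>0 $ i = 0" "\<And>i. i \<in> A - E \<Longrightarrow> \<mu>0 $ i \<ge> 0"
    and n: "n = (\<Sum>i\<in>UNIV. \<mu>0 $ i *\<^sub>R g i)"
  obtains \<mu> :: "real^'l" and z where
    "\<And>i. i \<in> E \<Longrightarrow> g i \<bullet> z + c $ i = 0" "\<And>i. i \<in> A - E \<Longrightarrow> g i \<bullet> z + c $ i \<le> 0"
    "\<And>i. \<mu> $ i \<noteq> 0 \<Longrightarrow> i \<in> A \<and> g i \<bullet> z + c $ i = 0" "\<And>i. i \<in> A - E \<Longrightarrow> \<mu> $ i \<ge> 0"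
    "n = (\<Sum>i\<in>UNIV. \<mu> $ i *\<^sub>R g i)"
proof -
  define F where "F = {z. (\<forall>i\<in>E. g i \<bullet> z + c $ i = 0) \<and> (\<forall>i\<in>A - E. g i \<bullet> z + c $ i \<le> 0)}"
  have "F \<noteq> {}" using z0 unfolding F_def by blast
  moreover have "n \<bullet> z \<le> - (\<Sum>i\<in>UNIV. \<mu>0 $ i * c $ i)" if "z \<in> F" for z
  proof -
    have "(\<Sum>i\<in>UNIV. \<mu>0 $ i * (g i \<bullet> z + c $ i)) \<le> 0"
      using \<mu>0 that unfolding F_def by (intro sum_nonpos_of_signs[of A \<mu>0 E]) auto
    then show ?thesis by (simp add: n inner_sum_scaleR distrib_left sum.distrib)
  qed
  ultimately have "\<exists>z\<in>F. \<forall>z'\<in>F. n \<bullet> z' \<le> n \<bullet> z"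
    unfolding F_def by (rule linear_attains_max[OF EA])
  then obtain z where z: "z \<in> F" "\<And>z'. z' \<in> F \<Longrightarrow> n \<bullet> z' \<le> n \<bullet> z" by blast
  define B where "B = {i \<in> A. g i \<bullet> z + c $ i = 0}"
  have EB: "E \<subseteq> B" using z(1) EA unfolding B_def F_def by auto
  have "n \<bullet> a \<le> 0" if a: "\<And>i. i \<in> E \<Longrightarrow> g i \<bullet> a = 0" "\<And>i. i \<in> B - E \<Longrightarrow> g i \<bullet> a \<le> 0" for a
  proof -
    \<comment> \<open>Rows that are slack at \<open>z\<close> survive a small step \<open>s\<close>;
      the tight ones are controlled by the assumptions on \<open>a\<close>.\<close>
    have "\<forall>\<^sub>F s in at_right (0::real). \<forall>i\<in>A - B. g i \<bullet> (z + s *\<^sub>R a) + c $ i < 0"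
    proof (rule eventually_ball_finite)
      show "\<forall>i\<in>A - B. \<forall>\<^sub>F s in at_right 0. g i \<bullet> (z + s *\<^sub>R a) + c $ i < 0"
      proof
        fix i assume i: "i \<in> A - B"
        have "((\<lambda>s. g i \<bullet> (z + s *\<^sub>R a) + c $ i) \<longlongrightarrow> g i \<bullet> (z + 0 *\<^sub>R a) + c $ i) (at_right 0)"
          by (intro tendsto_intros)
        moreover have "g i \<bullet> (z + 0 *\<^sub>R a) + c $ i < 0"
          using i z(1) EB unfolding B_def F_def by force
        ultimately show "\<forall>\<^sub>F s in at_right 0. g i \<bullet> (z + s *\<^sub>R a) + c $ i < 0"
          by (rule order_tendstoD)
      qed
    qed simp
    then have "\<forall>\<^sub>F s in at_right (0::real). (\<forall>i\<in>A - B. g i \<bullet> (z + s *\<^sub>R a) + c $ i < 0) \<and> s > 0"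
      by (simp add: eventually_conj eventually_at_right_less)
    then obtain s :: real where s: "\<And>i. i \<in> A - B \<Longrightarrow> g i \<bullet> (z + s *\<^sub>R a) + c $ i < 0" "s > 0"
      by (metis (no_types, lifting) eventually_happens trivial_limit_at_right_real)
    have eq: "g i \<bullet> (z + s *\<^sub>R a) + c $ i = (g i \<bullet> z + c $ i) + s * (g i \<bullet> a)" for i
      by (simp add: inner_add_right)
    have "z + s *\<^sub>R a \<in> F"
      unfolding F_def mem_Collect_eq
    proof (intro conjI ballI)
      fix i assume "i \<in> E"
      then show "g i \<bullet> (z + s *\<^sub>R a) + c $ i = 0"
        unfolding eq using a(1)[of i] z(1) by (auto simp: F_def)
    next
      fix i assume i: "i \<in> A - E"
      show "g i \<bullet> (z + s *\<^sub>R a) + c $ i \<le> 0"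
      proof (cases "i \<in> B")
        case True
        then show ?thesis unfolding eq using a(2)[of i] i s(2) by (simp add: B_def mult_nonneg_nonpos)
      qed (use s(1)[of i] i in auto)
    qed
    from z(2)[OF this] s(2) show ?thesis by (simp add: inner_add_right mult_le_0_iff)
  qed
  then have "\<exists>\<mu> :: real^'l. (\<forall>i. i \<notin> B \<longrightarrow> \<mu> $ i = 0) \<and> (\<forall>i\<in>B - E. \<mu> $ i \<ge> 0) \<and>
    n = (\<Sum>i\<in>UNIV. \<mu> $ i *\<^sub>R g i)"
    by (rule farkas[OF EB])
  then obtain \<mu> :: "real^'l" where \<mu>: "\<And>i. i \<notin> B \<Longrightarrow> \<mu> $ i = 0" "\<And>i. i \<in> B - E \<Longrightarrow> \<mu> $ i \<ge> 0"
    "n = (\<Sum>i\<in>UNIV. \<mu> $ i *\<^sub>R g i)" by blast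
  show ?thesis
  proof (rule that[of z \<mu>])
    show "\<mu> $ i \<ge> 0" if "i \<in> A - E" for i using \<mu>(1)[of i] \<mu>(2)[of i] that by force
    show "i \<in> A \<and> g i \<bullet> z + c $ i = 0" if "\<mu> $ i \<noteq> 0" for i
      using \<mu>(1)[of i] that unfolding B_def by auto
  qed (use z \<mu>(3) in \<open>auto simp: F_def\<close>)
qed

section \<open>First and second derivatives\<close>

abbreviation grad :: "(real^'m \<Rightarrow> real^'l) \<Rightarrow> 'l \<Rightarrow> real^'m \<Rightarrow> real^'m" where
  "grad q i y \<equiv> gradient (\<lambda>x. q x $ i) y"

abbreviation hess :: "(real^'m \<Rightarrow> real^'l) \<Rightarrow> 'l \<Rightarrow> real^'m \<Rightarrow> real^'m^'m" where
  "hess q i y \<equiv> hessian (\<lambda>x. q x $ i) y"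

lemma has_derivative_gradient:
  fixes f :: "real^'m \<Rightarrow> real"
  assumes "f differentiable (at y)"
  shows "(f has_derivative (\<lambda>h. gradient f y \<bullet> h)) (at y)"
proof -
  let ?D = "frechet_derivative f (at y)"
  have D: "(f has_derivative ?D) (at y)"
    using assms by (simp add: frechet_derivative_works)
  then have lin: "linear ?D" by (rule has_derivative_linear)
  have "?D h = gradient f y \<bullet> h" for h
  proof -
    have "?D h = ?D (\<Sum>i\<in>UNIV. h $ i *\<^sub>R axis i 1)"
      using basis_expansion[of h] by (simp add: scalar_mult_eq_scaleR)
    also have "\<dots> = (\<Sum>i\<in>UNIV. h $ i * ?D (axis i 1))"
      by (simp add: linear_sum[OF lin] linear_cmul[OF lin])
    finally show ?thesis by (simp add: gradient_def inner_vec_def mult.commute)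
  qed
  then have "?D = (\<lambda>h. gradient f y \<bullet> h)" by blast
  with D show ?thesis by simp
qed

lemma gradient_unique:
  fixes f :: "real^'m \<Rightarrow> real"
  assumes "(f has_derivative (\<lambda>h. g \<bullet> h)) (at y)"
  shows "gradient f y = g"
  using frechet_derivative_at[OF assms, symmetric]
  by (simp add: gradient_def vec_eq_iff inner_axis)

lemma jacobian_unique:
  fixes f :: "real^'m \<Rightarrow> real^'n"
  assumes "(f has_derivative (\<lambda>h. M *v h)) (at y)"
  shows "jacobian f (at y) = M"
  using frechet_derivative_at[OF assms, symmetric] by (simp add: jacobian_def)

text \<open>Stated for merely bounded \<open>x\<close>, since the directions may be intermediate
  points of a mean value theorem or displacements known only through a norm bound. The Frechet
  estimate is uniform on the ball of radius \<open>M\<close>.\<close>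

lemma difference_quotient_bounded:
  fixes f :: "'a::real_normed_vector \<Rightarrow> 'b::real_normed_vector"
  assumes f: "(f has_derivative D) (at y)" and t: "\<And>k. t k > 0" "t \<longlonglongrightarrow> (0::real)"
    and x: "bounded (range x)"
  shows "(\<lambda>k. (f (y + t k *\<^sub>R x k) - f y) /\<^sub>R t k - D (x k)) \<longlonglongrightarrow> 0"
proof (rule LIMSEQ_I)
  fix e :: real assume "e > 0"
  obtain M where M: "M > 0" "\<And>k. norm (x k) \<le> M" using x by (auto simp: bounded_pos)
  interpret D: bounded_linear D using f by (rule has_derivative_bounded_linear)
  have "e / (2 * M) > 0" using \<open>e > 0\<close> M by simp
  then obtain d where d: "d > 0"
    "\<And>z. norm (z - y) < d \<Longrightarrow> norm (f z - f y - D (z - y)) \<le> e / (2 * M) * norm (z - y)"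
    using f unfolding has_derivative_at_alt by blast
  have "(\<lambda>k. t k * M) \<longlonglongrightarrow> 0" using tendsto_mult_left_zero[OF t(2)] by simp
  then obtain N where N: "\<And>k. k \<ge> N \<Longrightarrow> t k * M < d"
    using order_tendstoD(2)[of _ 0 sequentially d] \<open>d > 0\<close> unfolding eventually_sequentially by blast
  have "norm ((f (y + t k *\<^sub>R x k) - f y) /\<^sub>R t k - D (x k) - 0) < e" if "k \<ge> N" for k
  proof -
    have n: "norm (t k *\<^sub>R x k) \<le> t k * M" using t(1)[of k] M(2)[of k] by simp
    then have "norm (f (y + t k *\<^sub>R x k) - f y - D (t k *\<^sub>R x k)) \<le> e / (2 * M) * norm (t k *\<^sub>R x k)"
      using d(2)[of "y + t k *\<^sub>R x k"] N[OF that] by simp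
    also have "\<dots> \<le> e / (2 * M) * (t k * M)" using n \<open>e / (2 * M) > 0\<close> by (intro mult_left_mono) auto
    also have "\<dots> = t k * (e / 2)" using M by simp
    finally have *: "norm (f (y + t k *\<^sub>R x k) - f y - D (t k *\<^sub>R x k)) \<le> t k * (e / 2)" .
    have "(f (y + t k *\<^sub>R x k) - f y) /\<^sub>R t k - D (x k) = (f (y + t k *\<^sub>R x k) - f y - D (t k *\<^sub>R x k)) /\<^sub>R t k"
      using t(1)[of k] by (simp add: D.scaleR scaleR_diff_right)
    then have "norm ((f (y + t k *\<^sub>R x k) - f y) /\<^sub>R t k - D (x k)) \<le> e / 2"
      using * t(1)[of k] by (simp add: divide_simps mult.commute)
    then show ?thesis using \<open>e > 0\<close> by simp
  qed
  then show "\<exists>N. \<forall>k\<ge>N. norm ((f (y + t k *\<^sub>R x k) - f y) /\<^sub>R t k - D (x k) - 0) < e" by blast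
qed

lemma difference_quotient:
  fixes f :: "'a::real_normed_vector \<Rightarrow> 'b::real_normed_vector"
  assumes f: "(f has_derivative D) (at y)" and t: "\<And>k. t k > 0" "t \<longlonglongrightarrow> (0::real)"
    and x: "x \<longlonglongrightarrow> x0"
  shows "(\<lambda>k. (f (y + t k *\<^sub>R x k) - f y) /\<^sub>R t k) \<longlonglongrightarrow> D x0"
proof -
  have "bounded (range x)" using x by (rule convergent_imp_bounded)
  from difference_quotient_bounded[OF f t this]
  have "(\<lambda>k. (f (y + t k *\<^sub>R x k) - f y) /\<^sub>R t k - D (x k)) \<longlonglongrightarrow> 0" .
  moreover have "(\<lambda>k. D (x k)) \<longlonglongrightarrow> D x0"
    using has_derivative_bounded_linear[OF f] x by (rule bounded_linear.tendsto)
  ultimately show ?thesis using tendsto_add by fastforce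
qed

lemma line_derivative:
  fixes f :: "'a::real_inner \<Rightarrow> real"
  assumes "\<And>x. (f has_derivative (\<lambda>h. G x \<bullet> h)) (at x)"
  shows "((\<lambda>s. f (p + s *\<^sub>R h)) has_real_derivative G (p + s *\<^sub>R h) \<bullet> h) (at s)"
proof -
  have "((\<lambda>s. p + s *\<^sub>R h) has_derivative (\<lambda>u. u *\<^sub>R h)) (at s)"
    by (auto intro!: derivative_eq_intros)
  from has_derivative_compose[OF this assms]
  show ?thesis by (simp add: has_field_derivative_def mult_commute_abs)
qed

text \<open>The mean value theorem is applied along the segment to \<open>f\<close> minus its
  quadratic model; the differentiability of \<open>G\<close> at \<open>y\<close> then bounds the
  derivative at the intermediate point.\<close>

lemma second_order_taylor:
  fixes f :: "'a::real_inner \<Rightarrow> real"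
  assumes f: "\<And>x. (f has_derivative (\<lambda>h. G x \<bullet> h)) (at x)"
    and G: "(G has_derivative H) (at y)" and e: "e > 0"
  obtains d where "d > 0"
    "\<And>h. norm h < d \<Longrightarrow> \<bar>f (y + h) - f y - G y \<bullet> h - (h \<bullet> H h) / 2\<bar> \<le> e * (norm h)\<^sup>2"
proof -
  interpret H: bounded_linear H using G by (rule has_derivative_bounded_linear)
  obtain d where d: "d > 0"
    "\<And>z. norm (z - y) < d \<Longrightarrow> norm (G z - G y - H (z - y)) \<le> e * norm (z - y)"
    using G e unfolding has_derivative_at_alt by blast
  have "\<bar>f (y + h) - f y - G y \<bullet> h - (h \<bullet> H h) / 2\<bar> \<le> e * (norm h)\<^sup>2" if h: "norm h < d" for h
  proof -
    define \<psi> where "\<psi> s = f (y + s *\<^sub>R h) - s * (G y \<bullet> h) - s\<^sup>2 / 2 * (h \<bullet> H h)" for s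
    have "(\<psi> has_real_derivative G (y + s *\<^sub>R h) \<bullet> h - G y \<bullet> h - s * (h \<bullet> H h)) (at s)" for s
      unfolding \<psi>_def by (rule derivative_eq_intros line_derivative[OF f] refl | simp)+
    then obtain s where s: "0 < s" "s < 1"
      "\<psi> 1 - \<psi> 0 = (1 - 0) * (G (y + s *\<^sub>R h) \<bullet> h - G y \<bullet> h - s * (h \<bullet> H h))"
      using MVT2[of 0 1 \<psi> "\<lambda>s. G (y + s *\<^sub>R h) \<bullet> h - G y \<bullet> h - s * (h \<bullet> H h)"] by auto
    have "f (y + h) - f y - G y \<bullet> h - (h \<bullet> H h) / 2 = (G (y + s *\<^sub>R h) - G y - H (s *\<^sub>R h)) \<bullet> h"
    proof -
      have "(G (y + s *\<^sub>R h) - G y - H (s *\<^sub>R h)) \<bullet> h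
          = G (y + s *\<^sub>R h) \<bullet> h - G y \<bullet> h - s * (h \<bullet> H h)"
        by (simp add: H.scaleR inner_diff_left inner_diff_right inner_commute)
      then show ?thesis using s(3) by (simp add: \<psi>_def)
    qed
    also have "\<bar>\<dots>\<bar> \<le> norm (G (y + s *\<^sub>R h) - G y - H (s *\<^sub>R h)) * norm h" by (rule Cauchy_Schwarz_ineq2)
    also have "\<dots> \<le> (e * norm (s *\<^sub>R h)) * norm h"
    proof (rule mult_right_mono)
      have "norm (s *\<^sub>R h) \<le> 1 * norm h" using s unfolding norm_scaleR by (intro mult_right_mono) auto
      then have "norm (s *\<^sub>R h) < d" using h by simp
      then show "norm (G (y + s *\<^sub>R h) - G y - H (s *\<^sub>R h)) \<le> e * norm (s *\<^sub>R h)"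
        using d(2)[of "y + s *\<^sub>R h"] by simp
    qed simp
    also have "\<dots> \<le> e * (norm h)\<^sup>2"
    proof -
      have "s * (e * (norm h)\<^sup>2) \<le> 1 * (e * (norm h)\<^sup>2)" using s e by (intro mult_right_mono) auto
      then show ?thesis using s by (simp add: power2_eq_square algebra_simps)
    qed
    finally show ?thesis .
  qed
  with d(1) that show ?thesis by blast
qed

lemma second_order_quotient:
  fixes f :: "'a::real_inner \<Rightarrow> real"
  assumes f: "\<And>x. (f has_derivative (\<lambda>h. G x \<bullet> h)) (at x)"
    and G: "(G has_derivative H) (at y)"
    and t: "\<And>k. t k > 0" "t \<longlonglongrightarrow> (0::real)" and x: "x \<longlonglongrightarrow> x0"
  shows "(\<lambda>k. (f (y + t k *\<^sub>R x k) - f y - t k * (G y \<bullet> x k)) / (t k)\<^sup>2) \<longlonglongrightarrow> (x0 \<bullet> H x0) / 2"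
proof -
  interpret H: bounded_linear H using G by (rule has_derivative_bounded_linear)
  define R where "R k = f (y + t k *\<^sub>R x k) - f y - t k * (G y \<bullet> x k)" for k
  have "(\<lambda>k. R k / (t k)\<^sup>2 - (x k \<bullet> H (x k)) / 2) \<longlonglongrightarrow> 0"
  proof (rule LIMSEQ_I)
    fix e :: real assume "e > 0"
    obtain M where M: "M > 0" "\<And>k. norm (x k) \<le> M"
      using convergent_imp_bounded[OF x] by (auto simp: bounded_pos)
    have "e / (2 * M\<^sup>2) > 0" using \<open>e > 0\<close> M by simp
    from second_order_taylor[OF f G this] obtain d where d: "d > 0"
      "\<And>h. norm h < d \<Longrightarrow> \<bar>f (y + h) - f y - G y \<bullet> h - (h \<bullet> H h) / 2\<bar> \<le> e / (2 * M\<^sup>2) * (norm h)\<^sup>2"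
      by blast
    have "(\<lambda>k. t k * M) \<longlonglongrightarrow> 0" using tendsto_mult_left_zero[OF t(2)] by simp
    then obtain N where N: "\<And>k. k \<ge> N \<Longrightarrow> t k * M < d"
      using order_tendstoD(2)[of _ 0 sequentially d] \<open>d > 0\<close> unfolding eventually_sequentially by blast
    have "norm (R k / (t k)\<^sup>2 - (x k \<bullet> H (x k)) / 2 - 0) < e"
      if "k \<ge> N" for k
    proof -
      have n: "norm (t k *\<^sub>R x k) \<le> t k * M" using t(1)[of k] M(2)[of k] by simp
      have "\<bar>R k - (t k)\<^sup>2 * ((x k \<bullet> H (x k)) / 2)\<bar>
        \<le> e / (2 * M\<^sup>2) * (norm (t k *\<^sub>R x k))\<^sup>2"
        using d(2)[of "t k *\<^sub>R x k"] n N[OF that] by (simp add: R_def H.scaleR power2_eq_square)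
      also have "\<dots> \<le> e / (2 * M\<^sup>2) * (t k * M)\<^sup>2"
        using n \<open>e / (2 * M\<^sup>2) > 0\<close> by (intro mult_left_mono power_mono) auto
      also have "\<dots> = (t k)\<^sup>2 * (e / 2)" using M by (simp add: power_mult_distrib)
      finally have *: "\<bar>R k - (t k)\<^sup>2 * ((x k \<bullet> H (x k)) / 2)\<bar>
        \<le> (t k)\<^sup>2 * (e / 2)" .
      have tk: "(t k)\<^sup>2 > 0" using t(1)[of k] by simp
      have "R k / (t k)\<^sup>2 - (x k \<bullet> H (x k)) / 2
        = (R k - (t k)\<^sup>2 * ((x k \<bullet> H (x k)) / 2)) / (t k)\<^sup>2"
        using tk by (simp add: field_simps)
      then have "\<bar>R k / (t k)\<^sup>2 - (x k \<bullet> H (x k)) / 2\<bar>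
        = \<bar>R k - (t k)\<^sup>2 * ((x k \<bullet> H (x k)) / 2)\<bar> / (t k)\<^sup>2"
        using tk by (simp only: abs_divide abs_of_pos)
      also have "\<dots> \<le> e / 2" using * tk by (simp only: pos_divide_le_eq mult.commute)
      finally show ?thesis using \<open>e > 0\<close> by simp
    qed
    then show "\<exists>N. \<forall>k\<ge>N. norm (R k / (t k)\<^sup>2
        - (x k \<bullet> H (x k)) / 2 - 0) < e" by blast
  qed
  moreover have "(\<lambda>k. (x k \<bullet> H (x k)) / 2) \<longlonglongrightarrow> (x0 \<bullet> H x0) / 2"
    by (intro tendsto_intros x H.tendsto) simp
  ultimately show ?thesis unfolding R_def[symmetric] using tendsto_add by fastforce
qed

text \<open>The mixed second difference \<open>\<Delta> a b\<close> is symmetric in \<open>a\<close>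
  and \<open>b\<close>, and the mean value theorem in the direction \<open>a\<close> turns it into a
  difference of gradients tending to \<open>a \<bullet> H b\<close>. The intermediate parameters
  \<open>\<theta> k\<close> need not converge, hence the bounded form of the difference
  quotient.\<close>

lemma second_derivative_symmetric:
  fixes f :: "'a::real_inner \<Rightarrow> real"
  assumes f: "\<And>x. (f has_derivative (\<lambda>h. G x \<bullet> h)) (at x)"
    and G: "(G has_derivative H) (at y)"
  shows "a \<bullet> H b = b \<bullet> H a"
proof -
  interpret H: bounded_linear H using G by (rule has_derivative_bounded_linear)
  obtain t where t: "\<And>k. t k > 0" "t \<longlonglongrightarrow> (0::real)" using null_sequence by blast
  define \<Delta> where "\<Delta> a b k = (f (y + t k *\<^sub>R a + t k *\<^sub>R b) - f (y + t k *\<^sub>R a)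
      - f (y + t k *\<^sub>R b) + f y) / (t k)\<^sup>2" for a b k
  have lim: "\<Delta> a b \<longlonglongrightarrow> a \<bullet> H b" for a b
  proof -
    have "\<exists>\<theta>. 0 < \<theta> \<and> \<theta> < 1 \<and> \<Delta> a b k =
      ((G (y + t k *\<^sub>R (\<theta> *\<^sub>R a + b)) - G y) /\<^sub>R t k - (G (y + t k *\<^sub>R (\<theta> *\<^sub>R a)) - G y) /\<^sub>R t k) \<bullet> a" for k
    proof -
      define \<phi> where "\<phi> s = f (y + t k *\<^sub>R b + s *\<^sub>R (t k *\<^sub>R a)) - f (y + s *\<^sub>R (t k *\<^sub>R a))" for s
      have "(\<phi> has_real_derivative G (y + t k *\<^sub>R b + s *\<^sub>R (t k *\<^sub>R a)) \<bullet> (t k *\<^sub>R a)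
          - G (y + s *\<^sub>R (t k *\<^sub>R a)) \<bullet> (t k *\<^sub>R a)) (at s)" for s
        unfolding \<phi>_def by (intro DERIV_diff line_derivative[OF f])
      then obtain s where s: "0 < s" "s < 1" "\<phi> 1 - \<phi> 0 =
        (1 - 0) * (G (y + t k *\<^sub>R b + s *\<^sub>R (t k *\<^sub>R a)) \<bullet> (t k *\<^sub>R a) - G (y + s *\<^sub>R (t k *\<^sub>R a)) \<bullet> (t k *\<^sub>R a))"
        using MVT2[of 0 1 \<phi> "\<lambda>s. G (y + t k *\<^sub>R b + s *\<^sub>R (t k *\<^sub>R a)) \<bullet> (t k *\<^sub>R a)
          - G (y + s *\<^sub>R (t k *\<^sub>R a)) \<bullet> (t k *\<^sub>R a)"] by auto
      have e1: "y + t k *\<^sub>R b + s *\<^sub>R (t k *\<^sub>R a) = y + t k *\<^sub>R (s *\<^sub>R a + b)"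
        by (simp add: algebra_simps)
      have e2: "y + s *\<^sub>R (t k *\<^sub>R a) = y + t k *\<^sub>R (s *\<^sub>R a)" by (simp add: algebra_simps)
      have "\<Delta> a b k = (\<phi> 1 - \<phi> 0) / (t k)\<^sup>2"
        by (simp add: \<Delta>_def \<phi>_def add.commute add.left_commute)
      also have "\<dots> = t k * ((G (y + t k *\<^sub>R (s *\<^sub>R a + b)) - G (y + t k *\<^sub>R (s *\<^sub>R a))) \<bullet> a) / (t k)\<^sup>2"
        unfolding s(3) e1 e2 by (simp add: algebra_simps)
      also have "\<dots> = ((G (y + t k *\<^sub>R (s *\<^sub>R a + b)) - G y) /\<^sub>R t k - (G (y + t k *\<^sub>R (s *\<^sub>R a)) - G y) /\<^sub>R t k) \<bullet> a"
        using t(1)[of k] by (simp add: power2_eq_square inner_diff_left divide_simps)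
      finally show ?thesis using s by blast
    qed
    then obtain \<theta> where \<theta>: "\<And>k. 0 < \<theta> k" "\<And>k. \<theta> k < 1" and \<Delta>: "\<And>k. \<Delta> a b k =
      ((G (y + t k *\<^sub>R (\<theta> k *\<^sub>R a + b)) - G y) /\<^sub>R t k - (G (y + t k *\<^sub>R (\<theta> k *\<^sub>R a)) - G y) /\<^sub>R t k) \<bullet> a"
      by metis
    have n: "norm (\<theta> k *\<^sub>R a) \<le> norm a" for k
      using \<theta>[of k] mult_right_mono[of "\<theta> k" 1 "norm a"] by simp
    have "bounded (range (\<lambda>k. \<theta> k *\<^sub>R a))" unfolding bounded_iff using n by auto
    moreover have "bounded (range (\<lambda>k. \<theta> k *\<^sub>R a + b))"
      unfolding bounded_iff using n by (auto intro!: exI[of _ "norm a + norm b"] norm_triangle_mono)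
    ultimately have "(\<lambda>k. (((G (y + t k *\<^sub>R (\<theta> k *\<^sub>R a + b)) - G y) /\<^sub>R t k - H (\<theta> k *\<^sub>R a + b))
      - ((G (y + t k *\<^sub>R (\<theta> k *\<^sub>R a)) - G y) /\<^sub>R t k - H (\<theta> k *\<^sub>R a)) + H b) \<bullet> a) \<longlonglongrightarrow> (0 - 0 + H b) \<bullet> a"
      by (intro tendsto_intros difference_quotient_bounded[OF G t])
    moreover have "((G (y + t k *\<^sub>R (\<theta> k *\<^sub>R a + b)) - G y) /\<^sub>R t k - H (\<theta> k *\<^sub>R a + b))
      - ((G (y + t k *\<^sub>R (\<theta> k *\<^sub>R a)) - G y) /\<^sub>R t k - H (\<theta> k *\<^sub>R a)) + H b
      = (G (y + t k *\<^sub>R (\<theta> k *\<^sub>R a + b)) - G y) /\<^sub>R t k - (G (y + t k *\<^sub>R (\<theta> k *\<^sub>R a)) - G y) /\<^sub>R t k" for k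
      by (simp add: H.add)
    ultimately show ?thesis
      unfolding \<Delta>[abs_def] by (simp only: diff_zero add_0 inner_commute[of "H b"])
  qed
  have "\<Delta> a b = \<Delta> b a" by (rule ext) (simp add: \<Delta>_def add.commute add.left_commute)
  with lim[of a b] lim[of b a] show ?thesis using LIMSEQ_unique by metis
qed

locale twice_differentiable =
  fixes q :: "real^'m \<Rightarrow> real^'l"
  assumes C2: "twice_cont_diff q"
begin

lemma has_grad: "((\<lambda>x. q x $ i) has_derivative (\<lambda>h. grad q i y \<bullet> h)) (at y)"
  using C2 by (intro has_derivative_gradient) (simp add: twice_cont_diff_def differentiable_on_def)

lemma has_hess: "(grad q i has_derivative (\<lambda>h. hess q i y *v h)) (at y)"
  using C2 jacobian_works[of "grad q i" "at y"]
  by (simp add: twice_cont_diff_def differentiable_on_def hessian_def)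

lemma hess_commute: "a \<bullet> (hess q i y *v b) = b \<bullet> (hess q i y *v a)"
  by (rule second_derivative_symmetric[OF has_grad has_hess])

lemma isCont_component: "isCont (\<lambda>x. q x $ i) y"
  using has_grad has_derivative_continuous by blast

lemma isCont_grad: "isCont (grad q i) y"
  using has_hess has_derivative_continuous by blast

lemma isCont_hess: "isCont (hess q i) y"
  using C2 by (simp add: twice_cont_diff_def continuous_on_eq_continuous_at)

lemma differentiable: "(q has_derivative (\<lambda>h. \<chi> i. grad q i y \<bullet> h)) (at y)"
proof -
  have "((\<lambda>x. q x \<bullet> b) has_derivative (\<lambda>h. (\<chi> i. grad q i y \<bullet> h) \<bullet> b)) (at y)"
    if "b \<in> Basis" for b :: "real^'l"
  proof -
    obtain i where "b = axis i 1" using \<open>b \<in> Basis\<close> by (auto simp: Basis_vec_def)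
    then show ?thesis using has_grad[of i y] by (simp add: inner_axis)
  qed
  then show ?thesis using has_derivative_componentwise_within[of q _ y UNIV] by blast
qed

lemma continuous_on_q: "continuous_on S q"
  using differentiable has_derivative_continuous continuous_at_imp_continuous_on by blast

lemma transpose_jacobian_mult:
  "transpose (jacobian q (at y)) *v lam = (\<Sum>i\<in>UNIV. lam $ i *\<^sub>R grad q i y)"
proof -
  have "jacobian q (at y) $ i = grad q i y" for i
    using jacobian_row differentiable differentiable_def by blast
  then show ?thesis
    by (simp add: vec_eq_iff matrix_vector_mult_def transpose_def mult.commute)
qed

lemma lag_hessian_mult:
  "lag_hessian q y lam *v w = (\<Sum>i\<in>UNIV. lam $ i *\<^sub>R (hess q i y *v w))"
proof -
  have "((\<lambda>x. lam \<bullet> q x) has_derivative (\<lambda>h. \<Sum>i\<in>UNIV. lam $ i * (grad q i x \<bullet> h))) (at x)" for x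
    unfolding inner_vec_def[of lam] inner_real_def by (intro has_derivative_sum has_derivative_mult_right has_grad)
  then have "((\<lambda>x. lam \<bullet> q x) has_derivative (\<lambda>h. (\<Sum>i\<in>UNIV. lam $ i *\<^sub>R grad q i x) \<bullet> h)) (at x)" for x
    by (simp add: inner_sum_left)
  then have g: "gradient (\<lambda>x. lam \<bullet> q x) = (\<lambda>x. \<Sum>i\<in>UNIV. lam $ i *\<^sub>R grad q i x)"
    using gradient_unique by blast
  have eq: "(\<Sum>i\<in>UNIV. lam $ i *\<^sub>R (hess q i y *v h)) = (\<Sum>i\<in>UNIV. lam $ i *\<^sub>R hess q i y) *v h" for h
    by (simp add: vec_eq_iff matrix_vector_mult_def sum_distrib_left sum_distrib_right
        mult.assoc sum.swap[of _ "UNIV :: 'm set"])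
  have "((\<lambda>x. \<Sum>i\<in>UNIV. lam $ i *\<^sub>R grad q i x) has_derivative
      (\<lambda>h. \<Sum>i\<in>UNIV. lam $ i *\<^sub>R (hess q i y *v h))) (at y)"
    by (intro has_derivative_sum has_derivative_scaleR_right has_hess)
  then have "lag_hessian q y lam = (\<Sum>i\<in>UNIV. lam $ i *\<^sub>R hess q i y)"
    unfolding eq hessian_def[of "\<lambda>x. lam \<bullet> q x"] g by (rule jacobian_unique)
  then show ?thesis by (simp add: eq)
qed

lemma lag_hessian_commute: "a \<bullet> (lag_hessian q y lam *v b) = b \<bullet> (lag_hessian q y lam *v a)"
  unfolding lag_hessian_mult by (simp add: inner_sum_right hess_commute[of a _ _ b])

lemma lag_hessian_tendsto:
  assumes "lamk \<longlonglongrightarrow> lam" "yk \<longlonglongrightarrow> y" "wk \<longlonglongrightarrow> w"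
  shows "(\<lambda>k. lag_hessian q (yk k) (lamk k) *v wk k) \<longlonglongrightarrow> lag_hessian q y lam *v w"
proof -
  have "(\<lambda>k. hess q i (yk k)) \<longlonglongrightarrow> hess q i y" for i
    using isCont_tendsto_compose[OF isCont_hess assms(2)] .
  then have "(\<lambda>k. hess q i (yk k) *v wk k) \<longlonglongrightarrow> hess q i y *v w" for i
    unfolding matrix_vector_mult_def using assms(3)
    by (intro tendsto_intros)
  then show ?thesis
    unfolding lag_hessian_mult using assms(1) by (intro tendsto_intros)
qed

end

section \<open>Tangent cones, normal cones and metric regularity\<close>

lemma contingent_coneI:
  assumes t: "\<And>k. t k > 0" "t \<longlonglongrightarrow> (0::real)" and U: "U \<longlonglongrightarrow> u"
    and ev: "\<forall>\<^sub>F k in sequentially. z + t k *\<^sub>R U k \<in> \<Omega>"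
  shows "u \<in> contingent_cone \<Omega> z"
proof -
  obtain N where "\<And>k. k \<ge> N \<Longrightarrow> z + t k *\<^sub>R U k \<in> \<Omega>"
    using ev by (auto simp: eventually_sequentially)
  then show ?thesis
    unfolding contingent_cone_def mem_Collect_eq
    using LIMSEQ_ignore_initial_segment[OF t(2), of N] LIMSEQ_ignore_initial_segment[OF U, of N] t(1)
    by (intro exI[of _ "\<lambda>k. t (k + N)"] exI[of _ "\<lambda>k. U (k + N)"]) auto
qed

lemma tendsto_scaleR_add:
  fixes U :: "nat \<Rightarrow> 'a::real_normed_vector"
  assumes "t \<longlonglongrightarrow> (0::real)" "U \<longlonglongrightarrow> u"
  shows "(\<lambda>k. y + t k *\<^sub>R U k) \<longlonglongrightarrow> y"
  using tendsto_add[OF tendsto_const tendsto_scaleR[OF assms], of y] by simp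

lemma nonneg_perturbation:
  fixes lam mu :: "real^'l"
  assumes t: "t \<longlonglongrightarrow> (0::real)" "\<And>k. t k > 0"
    and lam: "\<And>i. lam $ i \<ge> 0" and mu: "\<And>i. lam $ i = 0 \<Longrightarrow> mu $ i \<ge> 0"
  shows "\<forall>\<^sub>F k in sequentially. \<forall>i. lam $ i + t k * mu $ i \<ge> 0"
proof (rule eventually_all_finite)
  fix i
  show "\<forall>\<^sub>F k in sequentially. lam $ i + t k * mu $ i \<ge> 0"
  proof (cases "lam $ i = 0")
    case True
    then show ?thesis using t(2) mu[of i] by (simp add: less_imp_le)
  next
    case False
    then have "lam $ i > 0" using lam[of i] by simp
    moreover have "(\<lambda>k. lam $ i + t k * mu $ i) \<longlonglongrightarrow> lam $ i + 0 * mu $ i" by (intro tendsto_intros t)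
    ultimately have "\<forall>\<^sub>F k in sequentially. lam $ i + t k * mu $ i > 0"
      by (intro order_tendstoD) auto
    then show ?thesis by (rule eventually_mono) simp
  qed
qed

text \<open>The infimum in \<open>edist_set\<close> may not be attained, which the slack
  \<open>\<delta>\<close> compensates. The finite upper bound also excludes an empty inverse image,
  whose distance is infinite.\<close>

lemma edist_set_le_near:
  assumes le: "edist_set u (inv_mf \<Psi> v) \<le> ereal \<kappa> * edist_set v (\<Psi> u)" and \<kappa>: "\<kappa> > 0"
    and w: "w \<in> \<Psi> u" and \<delta>: "\<delta> > 0"
  obtains u' where "v \<in> \<Psi> u'" "dist u u' < \<kappa> * dist v w + \<delta>"
proof -
  have "edist_set v (\<Psi> u) \<le> ereal (dist v w)" unfolding edist_set_def by (rule INF_lower) (rule w)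
  then have "ereal \<kappa> * edist_set v (\<Psi> u) \<le> ereal (\<kappa> * dist v w)"
    using \<kappa> ereal_mult_left_mono[of _ "ereal (dist v w)" "ereal \<kappa>"] by simp
  then have "edist_set u (inv_mf \<Psi> v) < ereal (\<kappa> * dist v w + \<delta>)"
  proof -
    have "edist_set u (inv_mf \<Psi> v) \<le> ereal (\<kappa> * dist v w)"
      using le \<open>ereal \<kappa> * edist_set v (\<Psi> u) \<le> ereal (\<kappa> * dist v w)\<close> by (rule order_trans)
    also have "\<dots> < ereal (\<kappa> * dist v w + \<delta>)" using \<delta> by simp
    finally show ?thesis .
  qed
  then show ?thesis
    unfolding edist_set_def INF_less_iff using that by (auto simp: inv_mf_def)
qed

lemma constraint_mf_iff: "w \<in> constraint_mf q u \<longleftrightarrow> (\<forall>i. q u $ i \<le> w $ i)"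
proof
  assume "\<forall>i. q u $ i \<le> w $ i"
  then have "w = q u - (q u - w) \<and> q u - w \<in> nonpos_orthant"
    by (simp add: nonpos_orthant_def)
  then show "w \<in> constraint_mf q u" unfolding constraint_mf_def by blast
qed (auto simp: constraint_mf_def nonpos_orthant_def)

lemma metrically_regular_imp_subregular:
  assumes "metrically_regular_near \<Psi> \<kappa> u0 v0"
  shows "metrically_subregular_at \<Psi> u0 v0"
  using assms unfolding metrically_regular_near_def metrically_subregular_at_def by blast

abbreviation lag_grad :: "(real^'m \<Rightarrow> real^'l) \<Rightarrow> real^'m \<Rightarrow> real^'l \<Rightarrow> real^'m" where
  "lag_grad q y lam \<equiv> \<Sum>i\<in>UNIV. lam $ i *\<^sub>R grad q i y"

abbreviation normal_graph :: "(real^'m \<Rightarrow> real^'l) \<Rightarrow> ((real^'m) \<times> (real^'m)) set" where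
  "normal_graph q \<equiv> gph (regular_normal_cone (feasible q))"

lemma multiplier_cone_active: "lam \<in> multiplier_cone q y \<Longrightarrow> lam $ i \<noteq> 0 \<Longrightarrow> i \<in> active q y"
  by (auto simp: multiplier_cone_def)

lemma multiplier_cone_iff:
  "lam \<in> multiplier_cone q y \<longleftrightarrow> (\<forall>i. lam $ i \<ge> 0) \<and> (\<forall>i. lam $ i > 0 \<longrightarrow> i \<in> active q y)"
  by (auto simp: multiplier_cone_def order_less_le)

text \<open>Adding a positive multiple of \<open>v\<close> leaves the values on
  \<open>active_dir\<close> unchanged and lowers the others, whose slope along \<open>v\<close> is
  strictly negative. Hence second-order feasibility has to be secured on \<open>active_dir\<close>
  only.\<close>

lemma second_order_shift:
  assumes v: "\<And>i. i \<in> active q y \<Longrightarrow> dcomp q y i v \<le> 0"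
    and z: "\<And>i. i \<in> active_dir q y v \<Longrightarrow> dcomp q y i z + d2comp q y i v v \<le> 0"
  obtains c where "z + c *\<^sub>R v \<in> second_order_set q y v"
proof -
  have "\<forall>i. \<exists>c\<ge>0. i \<in> active q y \<longrightarrow> dcomp q y i (z + c *\<^sub>R v) + d2comp q y i v v \<le> 0"
  proof
    fix i
    let ?a = "dcomp q y i z + d2comp q y i v v"
    show "\<exists>c\<ge>0. i \<in> active q y \<longrightarrow> dcomp q y i (z + c *\<^sub>R v) + d2comp q y i v v \<le> 0"
    proof (cases "i \<in> active q y \<and> dcomp q y i v < 0")
      case True
      define c where "c = \<bar>?a\<bar> / (- dcomp q y i v)"
      have "c * dcomp q y i v = - \<bar>?a\<bar>" using True by (simp add: c_def)
      then have "dcomp q y i (z + c *\<^sub>R v) + d2comp q y i v v \<le> 0"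
        using abs_ge_self[of ?a] by (simp add: inner_add_right)
      moreover have "c \<ge> 0" using True unfolding c_def by (intro divide_nonneg_pos) auto
      ultimately show ?thesis by blast
    next
      case False
      then show ?thesis using z[of i] v[of i] by (auto intro!: exI[of _ 0] simp: active_dir_def)
    qed
  qed
  then obtain c where c: "\<And>i. c i \<ge> 0"
    "\<And>i. i \<in> active q y \<Longrightarrow> dcomp q y i (z + c i *\<^sub>R v) + d2comp q y i v v \<le> 0" by metis
  \<comment> \<open>A larger multiple never hurts, so the sum serves all indices at once.\<close>
  have "z + (\<Sum>j\<in>UNIV. c j) *\<^sub>R v \<in> second_order_set q y v"
    unfolding second_order_set_def mem_Collect_eq
  proof
    fix i assume i: "i \<in> active q y"
    have "c i \<le> (\<Sum>j\<in>UNIV. c j)" by (rule member_le_sum) (use c in auto)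
    then have "(\<Sum>j\<in>UNIV. c j) * dcomp q y i v \<le> c i * dcomp q y i v"
      using v[OF i] by (rule mult_right_mono_neg)
    then show "dcomp q y i (z + (\<Sum>j\<in>UNIV. c j) *\<^sub>R v) + d2comp q y i v v \<le> 0"
      using c(2)[OF i] by (simp add: inner_add_right)
  qed
  then show ?thesis by (rule that)
qed

lemma second_order_active_shift:
  "second_order_active q y v (z + c *\<^sub>R v) = second_order_active q y v z"
  by (auto simp: second_order_active_def active_dir_def inner_add_right)

context twice_differentiable
begin

lemma tendsto_component: "yk \<longlonglongrightarrow> y \<Longrightarrow> (\<lambda>k. q (yk k) $ i) \<longlonglongrightarrow> q y $ i"
  by (rule isCont_tendsto_compose[OF isCont_component])

lemma tendsto_grad: "yk \<longlonglongrightarrow> y \<Longrightarrow> (\<lambda>k. grad q i (yk k)) \<longlonglongrightarrow> grad q i y"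
  by (rule isCont_tendsto_compose[OF isCont_grad])

lemma eventually_active_subset:
  assumes "yk \<longlonglongrightarrow> y" "y \<in> feasible q"
  shows "\<forall>\<^sub>F k in sequentially. active q (yk k) \<subseteq> active q y"
proof -
  have "\<forall>\<^sub>F k in sequentially. \<forall>i\<in>- active q y. q (yk k) $ i < 0"
  proof (rule eventually_ball_finite)
    show "\<forall>i\<in>- active q y. \<forall>\<^sub>F k in sequentially. q (yk k) $ i < 0"
    proof
      fix i assume "i \<in> - active q y"
      then have "q y $ i < 0" using assms(2) by (auto simp: active_def feasible_def order_less_le)
      then show "\<forall>\<^sub>F k in sequentially. q (yk k) $ i < 0"
        using order_tendstoD(2)[OF tendsto_component[OF assms(1)]] by blast
    qed
  qed simp
  then show ?thesis by (rule eventually_mono) (force simp: active_def)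
qed

lemma contingent_cone_linearized:
  assumes v: "v \<in> contingent_cone (feasible q) y" and i: "i \<in> active q y"
  shows "dcomp q y i v \<le> 0"
proof -
  obtain t U where t: "\<And>k. t k > 0" "t \<longlonglongrightarrow> (0::real)" "U \<longlonglongrightarrow> v" "\<And>k. y + t k *\<^sub>R U k \<in> feasible q"
    using v unfolding contingent_cone_def by blast
  have "(\<lambda>k. (q (y + t k *\<^sub>R U k) $ i - q y $ i) /\<^sub>R t k) \<longlonglongrightarrow> dcomp q y i v"
    by (rule difference_quotient[OF has_grad t(1-3)])
  moreover have "(q (y + t k *\<^sub>R U k) $ i - q y $ i) /\<^sub>R t k \<le> 0" for k
    using t(1,4)[of k] i by (simp add: feasible_def active_def divide_nonpos_pos mult_nonneg_nonpos)
  ultimately show ?thesis by (intro LIMSEQ_le_const2) auto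
qed

lemma lag_grad_inner_nonpos:
  assumes "lam \<in> multiplier_cone q y" "\<And>i. i \<in> active q y \<Longrightarrow> dcomp q y i v \<le> 0"
  shows "lag_grad q y lam \<bullet> v \<le> 0"
  unfolding inner_sum_scaleR using assms
  by (intro sum_nonpos_of_signs[of "active q y" lam "{}"]) (auto simp: multiplier_cone_def)

lemma lag_grad_normal:
  assumes "y \<in> feasible q" "lam \<in> multiplier_cone q y"
  shows "lag_grad q y lam \<in> regular_normal_cone (feasible q) y"
  using assms lag_grad_inner_nonpos contingent_cone_linearized
  unfolding regular_normal_cone_def neg_polar_def by simp

lemma lag_grad_in_graph:
  assumes "y \<in> feasible q" "lam \<in> multiplier_cone q y"
  shows "(y, lag_grad q y lam) \<in> normal_graph q"
  using lag_grad_normal[OF assms] by (simp add: gph_def)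

text \<open>Because the first-order terms are nonpositive, the straight line \<open>y + t v\<close>
  violates the constraints only by an amount of order \<open>t\<close> squared. Subregularity
  repairs this by a displacement of the same order, whose rescaling is the bounded sequence
  \<open>z\<close>.\<close>

lemma subregular_expansion:
  assumes sub: "metrically_subregular_at (constraint_mf q) y 0" and y: "y \<in> feasible q"
    and v: "\<And>i. i \<in> active q y \<Longrightarrow> dcomp q y i v \<le> 0"
  obtains t z z0 where "\<And>k. t k > 0" "t \<longlonglongrightarrow> (0::real)" "z \<longlonglongrightarrow> z0"
    "\<And>k. y + t k *\<^sub>R (v + t k *\<^sub>R z k) \<in> feasible q"
proof -
  obtain \<kappa> U where \<kappa>: "\<kappa> > 0" "open U" "y \<in> U"
    "\<And>u. u \<in> U \<Longrightarrow> edist_set u (inv_mf (constraint_mf q) 0) \<le> ereal \<kappa> * edist_set 0 (constraint_mf q u)"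
    using sub unfolding metrically_subregular_at_def by blast
  obtain t where t: "\<And>k. t k > 0" "t \<longlonglongrightarrow> (0::real)" using null_sequence by blast
  have yt: "(\<lambda>k. y + t k *\<^sub>R v) \<longlonglongrightarrow> y" by (rule tendsto_scaleR_add[OF t(2) tendsto_const])
  \<comment> \<open>The positive part of \<open>q u\<close> belongs to
    \<open>constraint_mf q u\<close>, so its norm bounds the distance from 0 to that set.\<close>
  define p where "p u = (\<chi> i. max (q u $ i) 0)" for u
  have "\<exists>C. \<forall>\<^sub>F k in sequentially. \<bar>p (y + t k *\<^sub>R v) $ i\<bar> \<le> C * (t k)\<^sup>2" for i
  proof (cases "i \<in> active q y")
    case True
    define C where "C = max 0 (d2comp q y i v v / 2 + 1)"
    let ?Q = "\<lambda>k. (q (y + t k *\<^sub>R v) $ i - q y $ i - t k * dcomp q y i v) / (t k)\<^sup>2"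
    have "?Q \<longlonglongrightarrow> d2comp q y i v v / 2"
      by (rule second_order_quotient[OF has_grad has_hess t tendsto_const])
    then have "\<forall>\<^sub>F k in sequentially. ?Q k < d2comp q y i v v / 2 + 1"
      by (rule order_tendstoD) simp
    then have "\<forall>\<^sub>F k in sequentially. \<bar>p (y + t k *\<^sub>R v) $ i\<bar> \<le> C * (t k)\<^sup>2"
    proof (rule eventually_mono)
      fix k assume "?Q k < d2comp q y i v v / 2 + 1"
      then have "?Q k \<le> C" unfolding C_def by simp
      then have "q (y + t k *\<^sub>R v) $ i - q y $ i - t k * dcomp q y i v \<le> C * (t k)\<^sup>2"
        using t(1)[of k] by (simp add: divide_le_eq)
      moreover have "q y $ i = 0" using True by (simp add: active_def)
      moreover have "t k * dcomp q y i v \<le> 0" using v[OF True] t(1)[of k] by (simp add: mult_nonneg_nonpos)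
      moreover have "0 \<le> C * (t k)\<^sup>2" by (simp add: C_def)
      ultimately show "\<bar>p (y + t k *\<^sub>R v) $ i\<bar> \<le> C * (t k)\<^sup>2" unfolding p_def by simp
    qed
    then show ?thesis by blast
  next
    case False
    then have "q y $ i < 0" using y by (auto simp: active_def feasible_def order_less_le)
    then have "\<forall>\<^sub>F k in sequentially. q (y + t k *\<^sub>R v) $ i < 0"
      using order_tendstoD(2)[OF tendsto_component[OF yt]] by blast
    then have "\<forall>\<^sub>F k in sequentially. \<bar>p (y + t k *\<^sub>R v) $ i\<bar> \<le> 0 * (t k)\<^sup>2"
      by (rule eventually_mono) (simp add: p_def)
    then show ?thesis by blast
  qed
  then obtain C where "\<And>i. \<forall>\<^sub>F k in sequentially. \<bar>p (y + t k *\<^sub>R v) $ i\<bar> \<le> C i * (t k)\<^sup>2" by metis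
  then have C: "\<forall>\<^sub>F k in sequentially. \<forall>i. \<bar>p (y + t k *\<^sub>R v) $ i\<bar> \<le> C i * (t k)\<^sup>2"
    by (rule eventually_all_finite)
  \<comment> \<open>The summand 1 pays for the slack \<open>(t k)\<^sup>2\<close> in the
    near-minimal choice of \<open>u\<close>.\<close>
  define M where "M = \<kappa> * (\<Sum>i\<in>UNIV. C i) + 1"
  have "\<forall>\<^sub>F k in sequentially. y + t k *\<^sub>R v \<in> U"
    using yt \<kappa>(2,3) by (rule topological_tendstoD)
  with C have "\<forall>\<^sub>F k in sequentially. \<exists>u. u \<in> feasible q \<and> norm (u - (y + t k *\<^sub>R v)) \<le> M * (t k)\<^sup>2"
  proof eventually_elim
    case (elim k)
    let ?u = "y + t k *\<^sub>R v"
    have "norm (p ?u) \<le> (\<Sum>i\<in>UNIV. \<bar>p ?u $ i\<bar>)" by (rule norm_le_l1_cart)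
    also have "\<dots> \<le> (\<Sum>i\<in>UNIV. C i) * (t k)\<^sup>2"
      unfolding sum_distrib_right using elim by (intro sum_mono) auto
    finally have *: "norm (p ?u) \<le> (\<Sum>i\<in>UNIV. C i) * (t k)\<^sup>2" .
    have "p ?u \<in> constraint_mf q ?u" by (simp add: constraint_mf_iff p_def)
    moreover have "(t k)\<^sup>2 > 0" using t(1)[of k] by simp
    ultimately obtain u where u: "0 \<in> constraint_mf q u" "dist ?u u < \<kappa> * dist 0 (p ?u) + (t k)\<^sup>2"
      using edist_set_le_near[OF \<kappa>(4) \<kappa>(1)] elim by metis
    have "norm (u - ?u) \<le> \<kappa> * norm (p ?u) + (t k)\<^sup>2" using u(2) by (simp add: dist_norm norm_minus_commute)
    also have "\<dots> \<le> \<kappa> * ((\<Sum>i\<in>UNIV. C i) * (t k)\<^sup>2) + (t k)\<^sup>2" using * \<kappa>(1) by simp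
    also have "\<dots> = M * (t k)\<^sup>2" by (simp add: M_def algebra_simps)
    finally show ?case using u(1) by (auto simp: constraint_mf_iff feasible_def)
  qed
  then obtain N where "\<And>k. \<exists>u. u \<in> feasible q \<and> norm (u - (y + t (k + N) *\<^sub>R v)) \<le> M * (t (k + N))\<^sup>2"
    unfolding eventually_sequentially by (metis le_add2)
  then obtain u where u: "\<And>k. u k \<in> feasible q" "\<And>k. norm (u k - (y + t (k + N) *\<^sub>R v)) \<le> M * (t (k + N))\<^sup>2"
    by metis
  define z where "z k = (u k - (y + t (k + N) *\<^sub>R v)) /\<^sub>R (t (k + N))\<^sup>2" for k
  have "norm (z k) \<le> M" for k
    using u(2)[of k] t(1)[of "k + N"] by (simp add: z_def divide_simps mult.commute)
  then have "bounded (range z)" unfolding bounded_iff by auto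
  then obtain z0 r where r: "strict_mono r" "(z \<circ> r) \<longlonglongrightarrow> z0"
    using bounded_imp_convergent_subsequence by blast
  have ut: "u k = y + t (k + N) *\<^sub>R (v + t (k + N) *\<^sub>R z k)" for k
  proof -
    have "t (k + N) \<noteq> 0" using t(1)[of "k + N"] by simp
    then have "(t (k + N))\<^sup>2 *\<^sub>R z k = u k - (y + t (k + N) *\<^sub>R v)" by (simp add: z_def)
    then show ?thesis by (simp add: scaleR_add_right power2_eq_square)
  qed
  show ?thesis
  proof (rule that[of "\<lambda>k. t (r k + N)" "z \<circ> r" z0])
    show "(\<lambda>k. t (r k + N)) \<longlonglongrightarrow> 0"
      using LIMSEQ_subseq_LIMSEQ[OF LIMSEQ_ignore_initial_segment[OF t(2), of N] r(1)] by (simp add: o_def)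
    show "y + t (r k + N) *\<^sub>R (v + t (r k + N) *\<^sub>R (z \<circ> r) k) \<in> feasible q" for k
      using u(1)[of "r k"] ut[of "r k"] by simp
  qed (use t r in auto)
qed

text \<open>The correction in \<open>subregular_expansion\<close> is small relative to
  \<open>t\<close>, so the corrected directions still converge to \<open>v\<close>. This is the
  Abadie property of the constraint system.\<close>

lemma subregular_contingent:
  assumes sub: "metrically_subregular_at (constraint_mf q) y 0" and y: "y \<in> feasible q"
    and v: "\<And>i. i \<in> active q y \<Longrightarrow> dcomp q y i v \<le> 0"
  shows "v \<in> contingent_cone (feasible q) y"
proof -
  obtain t z z0 where tz: "\<And>k. t k > 0" "t \<longlonglongrightarrow> (0::real)" "z \<longlonglongrightarrow> z0"
    "\<And>k. y + t k *\<^sub>R (v + t k *\<^sub>R z k) \<in> feasible q"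
    using subregular_expansion[OF sub y, of v] v by blast
  show ?thesis
    by (rule contingent_coneI[OF tz(1,2) tendsto_scaleR_add[OF tz(2,3)]]) (simp add: tz(4))
qed

text \<open>Inserting the feasible expansion into the constraints and dividing by the square of
  \<open>t\<close> leaves, in the limit, the required inequality with a factor 1/2 at the Hessian
  term.\<close>

lemma subregular_second_order:
  assumes sub: "metrically_subregular_at (constraint_mf q) y 0" and y: "y \<in> feasible q"
    and v: "\<And>i. i \<in> active q y \<Longrightarrow> dcomp q y i v \<le> 0"
  shows "second_order_set q y v \<noteq> {}"
proof -
  obtain t z z0 where t: "\<And>k. t k > 0" "t \<longlonglongrightarrow> (0::real)" and z: "z \<longlonglongrightarrow> z0"
    and f: "\<And>k. y + t k *\<^sub>R (v + t k *\<^sub>R z k) \<in> feasible q"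
    using subregular_expansion[OF sub y, of v] v by blast
  have x: "(\<lambda>k. v + t k *\<^sub>R z k) \<longlonglongrightarrow> v" by (rule tendsto_scaleR_add[OF t(2) z])
  have 0: "dcomp q y i z0 + d2comp q y i v v / 2 \<le> 0" if "i \<in> active_dir q y v" for i
  proof -
    have i: "i \<in> active q y" "dcomp q y i v = 0" using that by (auto simp: active_dir_def)
    let ?Q = "\<lambda>k. (q (y + t k *\<^sub>R (v + t k *\<^sub>R z k)) $ i - q y $ i - t k * dcomp q y i (v + t k *\<^sub>R z k)) / (t k)\<^sup>2"
    have "(\<lambda>k. dcomp q y i (z k) + ?Q k) \<longlonglongrightarrow> dcomp q y i z0 + d2comp q y i v v / 2"
      by (intro tendsto_add tendsto_inner tendsto_const z second_order_quotient[OF has_grad has_hess t x])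
    moreover have "dcomp q y i (z k) + ?Q k \<le> 0" for k
    proof -
      have "dcomp q y i (z k) + ?Q k = q (y + t k *\<^sub>R (v + t k *\<^sub>R z k)) $ i / (t k)\<^sup>2"
        using i t(1)[of k] by (simp add: active_def inner_add_right field_simps power2_eq_square)
      then show ?thesis using f[of k] by (simp add: feasible_def divide_nonpos_nonneg)
    qed
    ultimately show ?thesis by (intro LIMSEQ_le_const2) auto
  qed
  \<comment> \<open>\<open>second_order_set\<close> carries no factor 1/2, hence the doubling of
    \<open>z0\<close>.\<close>
  have "dcomp q y i (2 *\<^sub>R z0) + d2comp q y i v v \<le> 0" if "i \<in> active_dir q y v" for i
    using 0[OF that] by simp
  then show ?thesis using second_order_shift[OF v, of "2 *\<^sub>R z0"] by blast
qed

text \<open>Since every linearised direction is tangent, a normal satisfies the hypothesis of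
  Farkas' lemma for the active gradients.\<close>

lemma subregular_normal_multiplier:
  assumes sub: "metrically_subregular_at (constraint_mf q) y 0"
    and ys: "ys \<in> regular_normal_cone (feasible q) y"
  obtains lam where "lam \<in> multiplier_cone q y" "ys = lag_grad q y lam"
proof -
  have y: "y \<in> feasible q" and polar: "ys \<in> neg_polar (contingent_cone (feasible q) y)"
    using ys by (auto simp: regular_normal_cone_def split: if_splits)
  have "ys \<bullet> a \<le> 0" if "\<And>i. i \<in> active q y - {} \<Longrightarrow> grad q i y \<bullet> a \<le> 0" for a
    using subregular_contingent[OF sub y, of a] that polar by (simp add: neg_polar_def)
  then have "\<exists>lam :: real^'l. (\<forall>i. i \<notin> active q y \<longrightarrow> lam $ i = 0) \<and> (\<forall>i\<in>active q y - {}. lam $ i \<ge> 0) \<and>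
    ys = lag_grad q y lam"
    by (intro farkas) auto
  then obtain lam :: "real^'l" where lam: "\<forall>i. i \<notin> active q y \<longrightarrow> lam $ i = 0"
    "\<forall>i\<in>active q y. lam $ i \<ge> 0" "ys = lag_grad q y lam" by auto
  then have "lam \<in> multiplier_cone q y" unfolding multiplier_cone_def by force
  with lam that show ?thesis by blast
qed

text \<open>Metric regularity for the perturbed right-hand side \<open>- t lam\<close> gives points
  \<open>u\<close> with \<open>q u \<le> - t lam\<close> on the support of \<open>lam\<close>, at a
  distance of about \<open>\<kappa> * t * norm lam\<close>. Pairing the first-order expansion with
  \<open>lam\<close> bounds the square of \<open>norm lam\<close> by
  \<open>\<kappa> * norm lam\<close> times the norm of \<open>lag_grad\<close>. With a modulus
  common to all nearby points this keeps multipliers bounded along a sequence.\<close>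

lemma regular_multiplier_bound:
  assumes reg: "metrically_regular_near (constraint_mf q) \<kappa> y 0" and y: "y \<in> feasible q"
    and lam: "lam \<in> multiplier_cone q y"
  shows "norm lam \<le> \<kappa> * norm (lag_grad q y lam)"
proof (cases "lam = 0")
  case False
  obtain U V where \<kappa>: "\<kappa> > 0" and UV: "y \<in> U" "open V" "0 \<in> V"
    "\<And>u v. u \<in> U \<Longrightarrow> v \<in> V \<Longrightarrow> edist_set u (inv_mf (constraint_mf q) v) \<le> ereal \<kappa> * edist_set v (constraint_mf q u)"
    using reg unfolding metrically_regular_near_def by blast
  obtain t where t: "\<And>k. t k > 0" "t \<longlonglongrightarrow> (0::real)" "\<And>k. t k \<le> 1" using null_sequence by blast
  have "(\<lambda>k. 0 + t k *\<^sub>R (- lam)) \<longlonglongrightarrow> 0" by (rule tendsto_scaleR_add[OF t(2) tendsto_const])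
  then have "\<forall>\<^sub>F k in sequentially. 0 + t k *\<^sub>R (- lam) \<in> V" using UV(2,3) by (rule topological_tendstoD)
  then have "\<forall>\<^sub>F k in sequentially. \<exists>u. t k *\<^sub>R (- lam) \<in> constraint_mf q u \<and>
     norm (u - y) \<le> \<kappa> * (t k * norm lam) + (t k)\<^sup>2"
  proof (rule eventually_mono)
    fix k assume "0 + t k *\<^sub>R (- lam) \<in> V"
    then have "t k *\<^sub>R (- lam) \<in> V" by simp
    moreover have "0 \<in> constraint_mf q y" using y by (simp add: constraint_mf_iff feasible_def)
    moreover have "(t k)\<^sup>2 > 0" using t(1)[of k] by simp
    ultimately obtain u where u: "t k *\<^sub>R (- lam) \<in> constraint_mf q u"
      "dist y u < \<kappa> * dist (t k *\<^sub>R (- lam)) 0 + (t k)\<^sup>2"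
      using edist_set_le_near[OF UV(4)[OF UV(1)] \<kappa>] by metis
    then have "norm (u - y) \<le> \<kappa> * (t k * norm lam) + (t k)\<^sup>2"
      using t(1)[of k] by (simp add: dist_norm norm_minus_commute)
    with u(1) show "\<exists>u. t k *\<^sub>R (- lam) \<in> constraint_mf q u \<and> norm (u - y) \<le> \<kappa> * (t k * norm lam) + (t k)\<^sup>2"
      by blast
  qed
  then obtain N where "\<And>k. \<exists>u. t (k + N) *\<^sub>R (- lam) \<in> constraint_mf q u \<and>
     norm (u - y) \<le> \<kappa> * (t (k + N) * norm lam) + (t (k + N))\<^sup>2"
    unfolding eventually_sequentially by (metis le_add2)
  then obtain u where u: "\<And>k. t (k + N) *\<^sub>R (- lam) \<in> constraint_mf q (u k)"
     "\<And>k. norm (u k - y) \<le> \<kappa> * (t (k + N) * norm lam) + (t (k + N))\<^sup>2" by metis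
  define s where "s k = t (k + N)" for k
  have s: "\<And>k. s k > 0" "s \<longlonglongrightarrow> 0" unfolding s_def using t LIMSEQ_ignore_initial_segment[OF t(2)] by auto
  define x where "x k = (u k - y) /\<^sub>R s k" for k
  have ux: "u k = y + s k *\<^sub>R x k" for k using s(1)[of k] by (simp add: x_def)
  have xb: "norm (x k) \<le> \<kappa> * norm lam + s k" for k
  proof -
    have "norm (u k - y) \<le> s k * (\<kappa> * norm lam + s k)"
      using u(2)[of k] unfolding s_def[symmetric] by (simp add: power2_eq_square algebra_simps)
    moreover have "norm (x k) = norm (u k - y) / s k"
      using s(1)[of k] by (simp add: x_def divide_inverse_commute)
    ultimately show ?thesis using s(1)[of k] by (simp only: pos_divide_le_eq mult.commute)
  qed
  have "s k \<le> 1" for k using t(3) by (simp add: s_def)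
  then have "norm (x k) \<le> \<kappa> * norm lam + 1" for k using xb[of k] by (meson add_left_mono order_trans)
  then have bx: "bounded (range x)" unfolding bounded_iff by blast
  define r where "r k = (\<Sum>i\<in>UNIV. lam $ i * ((q (y + s k *\<^sub>R x k) $ i - q y $ i) /\<^sub>R s k - grad q i y \<bullet> x k))" for k
  have r: "r \<longlonglongrightarrow> (\<Sum>i\<in>UNIV. lam $ i * 0)"
    unfolding r_def by (intro tendsto_intros difference_quotient_bounded[OF has_grad s bx])
  have "(norm lam)\<^sup>2 \<le> norm (lag_grad q y lam) * (\<kappa> * norm lam + s k) - r k" for k
  proof -
    have "lam $ i * ((q (y + s k *\<^sub>R x k) $ i - q y $ i) /\<^sub>R s k) \<le> - (lam $ i * lam $ i)" for i
    proof (cases "lam $ i = 0")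
      case False
      then have "q y $ i = 0" using multiplier_cone_active[OF lam] by (simp add: active_def)
      moreover have "q (u k) $ i \<le> s k * (- lam $ i)" using u(1)[of k] by (simp add: constraint_mf_iff s_def)
      ultimately have "(q (y + s k *\<^sub>R x k) $ i - q y $ i) /\<^sub>R s k \<le> - lam $ i"
        using s(1)[of k] by (simp add: ux[symmetric] field_simps)
      then show ?thesis
        using lam mult_left_mono[of _ "- lam $ i" "lam $ i"] by (simp add: multiplier_cone_def)
    qed simp
    then have "(\<Sum>i\<in>UNIV. lam $ i * ((q (y + s k *\<^sub>R x k) $ i - q y $ i) /\<^sub>R s k)) \<le> (\<Sum>i\<in>UNIV. - (lam $ i * lam $ i))"
      by (rule sum_mono)
    moreover have "(\<Sum>i\<in>UNIV. - (lam $ i * lam $ i)) = - (norm lam)\<^sup>2"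
      by (simp add: power2_norm_eq_inner inner_vec_def sum_negf)
    moreover have "(\<Sum>i\<in>UNIV. lam $ i * ((q (y + s k *\<^sub>R x k) $ i - q y $ i) /\<^sub>R s k)) = r k + lag_grad q y lam \<bullet> x k"
      unfolding r_def inner_sum_scaleR sum.distrib[symmetric] by (intro sum.cong) (auto simp: algebra_simps)
    moreover have "- (lag_grad q y lam \<bullet> x k) \<le> norm (lag_grad q y lam) * (\<kappa> * norm lam + s k)"
    proof -
      have "- (lag_grad q y lam \<bullet> x k) \<le> norm (lag_grad q y lam) * norm (x k)"
        using norm_cauchy_schwarz[of "lag_grad q y lam" "- x k"] by simp
      also have "\<dots> \<le> norm (lag_grad q y lam) * (\<kappa> * norm lam + s k)"
        using xb by (intro mult_left_mono) auto
      finally show ?thesis .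
    qed
    ultimately show ?thesis by linarith
  qed
  moreover have "(\<lambda>k. norm (lag_grad q y lam) * (\<kappa> * norm lam + s k) - r k)
     \<longlonglongrightarrow> norm (lag_grad q y lam) * (\<kappa> * norm lam + 0) - (\<Sum>i\<in>UNIV. lam $ i * 0)"
    by (intro tendsto_intros s r)
  ultimately have "(norm lam)\<^sup>2 \<le> norm (lag_grad q y lam) * (\<kappa> * norm lam + 0) - (\<Sum>i\<in>UNIV. lam $ i * 0)"
    by (intro LIMSEQ_le_const) auto
  then have "norm lam * norm lam \<le> norm lam * (\<kappa> * norm (lag_grad q y lam))"
    by (simp add: power2_eq_square algebra_simps)
  with False show ?thesis by simp
qed (use reg in \<open>simp add: metrically_regular_near_def\<close>)

text \<open>With \<open>lam\<close> fixed and its support active along the curve,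
  \<open>lag_grad\<close> at the moved point is again a normal, and its difference quotient tends to
  the Hessian of the Lagrangian applied to \<open>v\<close>.\<close>

lemma graph_tangent:
  assumes lam: "lam \<in> multiplier_cone q y"
    and t: "\<And>k. t k > 0" "t \<longlonglongrightarrow> (0::real)" and V: "V \<longlonglongrightarrow> v"
    and f: "\<And>k. y + t k *\<^sub>R V k \<in> feasible q"
    and a: "\<And>k i. lam $ i > 0 \<Longrightarrow> i \<in> active q (y + t k *\<^sub>R V k)"
  shows "(v, lag_hessian q y lam *v v) \<in> contingent_cone (normal_graph q) (y, lag_grad q y lam)"
proof (rule contingent_coneI[OF t])
  define W where "W k = (\<Sum>i\<in>UNIV. lam $ i *\<^sub>R ((grad q i (y + t k *\<^sub>R V k) - grad q i y) /\<^sub>R t k))" for k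
  have "W \<longlonglongrightarrow> lag_hessian q y lam *v v"
    unfolding W_def lag_hessian_mult
    by (intro tendsto_intros difference_quotient[OF has_hess t V])
  with V show "(\<lambda>k. (V k, W k)) \<longlonglongrightarrow> (v, lag_hessian q y lam *v v)" by (rule tendsto_Pair)
  have "(y, lag_grad q y lam) + t k *\<^sub>R (V k, W k) \<in> normal_graph q" for k
  proof -
    have "t k *\<^sub>R W k = (\<Sum>i\<in>UNIV. lam $ i *\<^sub>R grad q i (y + t k *\<^sub>R V k) - lam $ i *\<^sub>R grad q i y)"
      unfolding W_def scaleR_sum_right using t(1)[of k]
      by (intro sum.cong) (auto simp: scaleR_diff_right field_simps)
    then have "lag_grad q y lam + t k *\<^sub>R W k = lag_grad q (y + t k *\<^sub>R V k) lam"
      by (simp add: sum_subtractf)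
    moreover have "lam \<in> multiplier_cone q (y + t k *\<^sub>R V k)"
      using lam a by (simp add: multiplier_cone_iff)
    ultimately show ?thesis using lag_grad_in_graph[OF f] by simp
  qed
  then show "\<forall>\<^sub>F k in sequentially. (y, lag_grad q y lam) + t k *\<^sub>R (V k, W k) \<in> normal_graph q"
    by simp
qed

text \<open>Here the base point is fixed and the multiplier moves. These tangents determine the
  linear conditions on the component \<open>w\<close> of a normal \<open>(ws, w)\<close>.\<close>

lemma graph_tangent_vertical:
  assumes y: "y \<in> feasible q" and lam: "lam \<in> multiplier_cone q y"
    and mu: "\<And>i. i \<notin> active q y \<Longrightarrow> mu $ i = 0" "\<And>i. lam $ i = 0 \<Longrightarrow> mu $ i \<ge> 0"
  shows "(0, lag_grad q y mu) \<in> contingent_cone (normal_graph q) (y, lag_grad q y lam)"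
proof -
  obtain t where t: "\<And>k. t k > 0" "t \<longlonglongrightarrow> (0::real)" using null_sequence by blast
  have "\<forall>\<^sub>F k in sequentially. \<forall>i. lam $ i + t k * mu $ i \<ge> 0"
    by (rule nonneg_perturbation[OF t(2,1) _ mu(2)]) (use lam in \<open>simp add: multiplier_cone_def\<close>)
  then have "\<forall>\<^sub>F k in sequentially. (y, lag_grad q y lam) + t k *\<^sub>R (0, lag_grad q y mu) \<in> normal_graph q"
  proof (rule eventually_mono)
    fix k assume *: "\<forall>i. lam $ i + t k * mu $ i \<ge> 0"
    have "lag_grad q y lam + t k *\<^sub>R lag_grad q y mu = lag_grad q y (lam + t k *\<^sub>R mu)"
      by (simp add: scaleR_sum_right sum.distrib scaleR_left_distrib)
    moreover have "lam + t k *\<^sub>R mu \<in> multiplier_cone q y"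
      using * mu(1) lam by (auto simp: multiplier_cone_def)
    ultimately show "(y, lag_grad q y lam) + t k *\<^sub>R (0, lag_grad q y mu) \<in> normal_graph q"
      using lag_grad_in_graph[OF y, of "lam + t k *\<^sub>R mu"] by (simp only: add_Pair scaleR_Pair scaleR_zero_right add_0_right)
  qed
  then show ?thesis by (rule contingent_coneI[OF t tendsto_const])
qed

end

section \<open>Consequences of 2-regularity\<close>

text \<open>Solving for the unit vectors and extending linearly fixes one solution operator, so that
  later corrections depend continuously and boundedly on \<open>b\<close>.\<close>

lemma two_regular_linear:
  fixes q :: "real^'m \<Rightarrow> real^'l"
  assumes "two_regular q J y v"
  obtains U W :: "real^'l \<Rightarrow> real^'m" where "bounded_linear U" "bounded_linear W"
    "\<And>i b. i \<in> J \<Longrightarrow> dcomp q y i (W b) = 0"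
    "\<And>i b. i \<in> J \<Longrightarrow> dcomp q y i (U b) + d2comp q y i v (W b) = b $ i"
proof -
  have "\<forall>j. \<exists>u w. \<forall>i\<in>J. dcomp q y i u + d2comp q y i v w = (if i = j then 1 else 0) \<and> dcomp q y i w = 0"
  proof
    fix j
    show "\<exists>u w. \<forall>i\<in>J. dcomp q y i u + d2comp q y i v w = (if i = j then 1 else 0) \<and> dcomp q y i w = 0"
      using assms unfolding two_regular_def by (rule spec)
  qed
  then obtain u w where uw: "\<And>i j. i \<in> J \<Longrightarrow> dcomp q y i (u j) + d2comp q y i v (w j) = (if i = j then 1 else 0)"
    "\<And>i j. i \<in> J \<Longrightarrow> dcomp q y i (w j) = 0" by metis
  define U where "U b = (\<Sum>j\<in>UNIV. b $ j *\<^sub>R u j)" for b :: "real^'l"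
  define W where "W b = (\<Sum>j\<in>UNIV. b $ j *\<^sub>R w j)" for b :: "real^'l"
  show ?thesis
  proof (rule that[of U W])
    show "bounded_linear U" "bounded_linear W"
      unfolding U_def W_def
      by (intro bounded_linear_sum bounded_linear_scaleR_const bounded_linear_vec_nth)+
    show "dcomp q y i (W b) = 0" if "i \<in> J" for i b
      using uw(2)[OF that] by (simp add: W_def inner_sum_right)
    show "dcomp q y i (U b) + d2comp q y i v (W b) = b $ i" if i: "i \<in> J" for i b
    proof -
      have "dcomp q y i (U b) + d2comp q y i v (W b) =
          (\<Sum>j\<in>UNIV. b $ j * (dcomp q y i (u j) + d2comp q y i v (w j)))"
        by (simp add: U_def W_def linear_sum[OF matrix_vector_mul_linear] matrix_vector_mult_scaleR
            inner_sum_right sum.distrib distrib_left)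
      also have "\<dots> = (\<Sum>j\<in>UNIV. if j = i then b $ i else 0)"
        using uw(1)[OF i] by (intro sum.cong) auto
      finally show ?thesis by simp
    qed
  qed
qed

lemma two_regular_mono: "two_regular q J y v \<Longrightarrow> I \<subseteq> J \<Longrightarrow> two_regular q I y v"
  unfolding two_regular_def by (meson subsetD)

lemma exists_maximal_in:
  assumes "finite F" "I \<in> F"
  obtains J where "maximal_in F J" "I \<subseteq> J"
  using finite_has_maximal2[OF assms] that unfolding maximal_in_def by metis

text \<open>Moving from a second-order point along a direction that keeps the indices of \<open>J\<close> active
  must not hit a further constraint.\<close>

lemma maximal_kernel:
  assumes v: "\<And>i. i \<in> active q y \<Longrightarrow> dcomp q y i v \<le> 0"
    and J: "maximal_in (index_family q y v) J"
    and w: "\<And>i. i \<in> J \<Longrightarrow> dcomp q y i w = 0" and i: "i \<in> active_dir q y v"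
  shows "dcomp q y i w = 0"
proof -
  have nonpos: "dcomp q y i w \<le> 0" if w: "\<And>i. i \<in> J \<Longrightarrow> dcomp q y i w = 0"
    and i: "i \<in> active_dir q y v" for i w
  proof (rule ccontr)
    assume "\<not> dcomp q y i w \<le> 0"
    then have pos: "dcomp q y i w > 0" by simp
    obtain z where z: "z \<in> second_order_set q y v" "J = second_order_active q y v z"
      using J unfolding maximal_in_def index_family_def by blast
    define D where "D = {i \<in> active_dir q y v. dcomp q y i w > 0}"
    \<comment> \<open>Ratio test: the least \<open>s j\<close> over \<open>D\<close> is the first
      step length along \<open>w\<close> at which another second-order constraint becomes
      tight.\<close>
    define s where "s j = - (dcomp q y j z + d2comp q y j v v) / dcomp q y j w" for j
    have D: "finite D" "D \<noteq> {}" unfolding D_def using i pos by auto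
    then obtain j where j: "j \<in> D" "\<And>k. k \<in> D \<Longrightarrow> s j \<le> s k"
      using arg_min_if_finite[OF D, of s] by (metis leI)
    have le: "dcomp q y k z + d2comp q y k v v \<le> 0" if "k \<in> active_dir q y v" for k
      using z(1) that by (auto simp: second_order_set_def active_dir_def)
    have "dcomp q y j w > 0" "j \<in> active_dir q y v" using j(1) by (auto simp: D_def)
    then have sj: "s j \<ge> 0" using le[of j] unfolding s_def by (intro divide_nonneg_pos) auto
    have "dcomp q y k (z + s j *\<^sub>R w) + d2comp q y k v v \<le> 0" if k: "k \<in> active_dir q y v" for k
    proof (cases "k \<in> D")
      case True
      then have "s j * dcomp q y k w \<le> - (dcomp q y k z + d2comp q y k v v)"
        using j(2)[OF True] unfolding s_def[of k] by (simp add: D_def pos_le_divide_eq)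
      then show ?thesis by (simp add: inner_add_right)
    next
      case False
      then have "s j * dcomp q y k w \<le> 0" using k sj by (simp add: D_def mult_nonneg_nonpos)
      then show ?thesis using le[OF k] by (simp add: inner_add_right)
    qed
    then obtain c where c: "(z + s j *\<^sub>R w) + c *\<^sub>R v \<in> second_order_set q y v"
      using second_order_shift[of q y v "z + s j *\<^sub>R w"] v by blast
    have "J \<subseteq> second_order_active q y v (z + s j *\<^sub>R w)"
    proof
      fix k assume "k \<in> J"
      then show "k \<in> second_order_active q y v (z + s j *\<^sub>R w)"
        using w[of k] unfolding z(2) by (simp add: second_order_active_def inner_add_right)
    qed
    moreover have "second_order_active q y v (z + s j *\<^sub>R w) \<in> index_family q y v"
      unfolding index_family_def using c second_order_active_shift by (metis imageI)
    ultimately have "second_order_active q y v (z + s j *\<^sub>R w) = J"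
      using J unfolding maximal_in_def by blast
    moreover have "j \<in> second_order_active q y v (z + s j *\<^sub>R w)"
      using j(1) by (simp add: second_order_active_def D_def s_def inner_add_right)
    ultimately show False using w[of j] j(1) by (auto simp: D_def)
  qed
  \<comment> \<open>The kernel condition on \<open>J\<close> is invariant under a change of sign, so
    the one-sided bound applies to \<open>w\<close> and to \<open>- w\<close>.\<close>
  have "dcomp q y i w \<le> 0" "dcomp q y i (- w) \<le> 0"
    using nonpos[of w i] nonpos[of "- w" i] w i by simp_all
  then show ?thesis by simp
qed

context twice_differentiable
begin

text \<open>Points are sought as \<open>y + t (v + (t / 2) z + W b + t U b)\<close>. By
  \<open>maximal_kernel\<close>, \<open>W b\<close> is annihilated by all gradients in
  \<open>active_dir\<close>, so those constraint values are of order \<open>t\<close> squared; on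
  \<open>J\<close> their scaled limits are \<open>b\<close> plus a constant and a quadratic term.
  Brouwer's theorem on a small ball of \<open>b\<close> then prescribes the values on
  \<open>J\<close>. The radius \<eta> is fixed before \<open>t\<close> because the quadratic term
  does not vanish with \<open>t\<close>; hence closeness to \<open>v\<close> is claimed only to
  order \<eta>.\<close>

lemma curve_step:
  assumes y: "y \<in> feasible q" and v: "\<And>i. i \<in> active q y \<Longrightarrow> dcomp q y i v \<le> 0"
    and J: "maximal_in (index_family q y v) J" and reg: "two_regular q J y v"
    and z: "z \<in> second_order_set q y v" and Iz: "I \<subseteq> second_order_active q y v z"
    and zJ: "second_order_active q y v z \<subseteq> J"
  obtains M \<eta>0 where "\<eta>0 > 0" "\<And>\<eta>. 0 < \<eta> \<Longrightarrow> \<eta> < \<eta>0 \<Longrightarrow>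
     \<exists>t V. 0 < t \<and> t < \<eta> \<and> norm (V - v) \<le> M * \<eta> \<and> y + t *\<^sub>R V \<in> feasible q \<and> active q (y + t *\<^sub>R V) = I"
proof -
  obtain U W where UW: "bounded_linear U" "bounded_linear W"
    "\<And>i b. i \<in> J \<Longrightarrow> dcomp q y i (W b) = 0"
    "\<And>i b. i \<in> J \<Longrightarrow> dcomp q y i (U b) + d2comp q y i v (W b) = b $ i"
    using two_regular_linear[OF reg] by metis
  interpret U: bounded_linear U by fact
  interpret W: bounded_linear W by fact
  have JA: "J \<subseteq> active_dir q y v"
    using J unfolding maximal_in_def index_family_def second_order_active_def by auto
  have W0: "dcomp q y i (W b) = 0" if "i \<in> active_dir q y v" for i b
    using maximal_kernel[OF v J UW(3) that] .
  define c where "c i = dcomp q y i z + d2comp q y i v v" for i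
  have c0: "c i \<le> 0" if "i \<in> active q y" for i
    using z that by (auto simp: c_def second_order_set_def)
  \<comment> \<open>The factor 1/2 at \<open>z\<close> matches the one in Taylor's formula, so that
    both together contribute \<open>c i / 2\<close>.\<close>
  define x where "x t b = (t / 2) *\<^sub>R z + W b + t *\<^sub>R U b" for t b
  define \<phi> where "\<phi> i b = c i / 2 + (dcomp q y i (U b) + d2comp q y i v (W b)) + d2comp q y i (W b) (W b) / 2" for i b
  have x_lim: "(\<lambda>k. x (t k) (b k)) \<longlonglongrightarrow> W b0" if "t \<longlonglongrightarrow> 0" "b \<longlonglongrightarrow> b0"
    for t and b :: "nat \<Rightarrow> real^'l" and b0
  proof -
    have "(\<lambda>k. x (t k) (b k)) \<longlonglongrightarrow> (0 / 2) *\<^sub>R z + W b0 + 0 *\<^sub>R U b0"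
      unfolding x_def by (intro tendsto_intros that U.tendsto W.tendsto) simp
    then show ?thesis by simp
  qed
  have h_lim: "(\<lambda>k. y + t k *\<^sub>R (v + x (t k) (b k))) \<longlonglongrightarrow> y" if "t \<longlonglongrightarrow> 0" "b \<longlonglongrightarrow> b0"
    for t and b :: "nat \<Rightarrow> real^'l" and b0
    by (rule tendsto_scaleR_add[OF that(1) tendsto_add[OF tendsto_const x_lim[OF that]]])
  have \<phi>_lim: "(\<lambda>k. q (y + t k *\<^sub>R (v + x (t k) (b k))) $ i / (t k)\<^sup>2) \<longlonglongrightarrow> \<phi> i b0"
    if t: "\<And>k. t k > 0" "t \<longlonglongrightarrow> 0" and b: "b \<longlonglongrightarrow> b0" and i: "i \<in> active_dir q y v"
    for t and b :: "nat \<Rightarrow> real^'l" and b0 i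
  proof -
    have ia: "q y $ i = 0" "dcomp q y i v = 0" using i by (auto simp: active_dir_def active_def)
    let ?X = "\<lambda>k. v + x (t k) (b k)"
    have "(\<lambda>k. (q (y + t k *\<^sub>R ?X k) $ i - q y $ i - t k * dcomp q y i (?X k)) / (t k)\<^sup>2
        + (dcomp q y i z / 2 + dcomp q y i (U (b k))))
      \<longlonglongrightarrow> d2comp q y i (v + W b0) (v + W b0) / 2 + (dcomp q y i z / 2 + dcomp q y i (U b0))"
      by (intro tendsto_add second_order_quotient[OF has_grad has_hess t] tendsto_const
          x_lim[OF t(2) b] tendsto_inner U.tendsto b)
    moreover have "(q (y + t k *\<^sub>R ?X k) $ i - q y $ i - t k * dcomp q y i (?X k)) / (t k)\<^sup>2
        + (dcomp q y i z / 2 + dcomp q y i (U (b k))) = q (y + t k *\<^sub>R ?X k) $ i / (t k)\<^sup>2" for k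
    proof -
      have "dcomp q y i (?X k) = t k * (dcomp q y i z / 2 + dcomp q y i (U (b k)))"
        using ia W0[OF i, of "b k"] by (simp add: x_def inner_add_right algebra_simps)
      then show ?thesis using ia t(1)[of k] by (simp add: power2_eq_square field_simps)
    qed
    moreover have "d2comp q y i (v + W b0) (v + W b0) / 2 + (dcomp q y i z / 2 + dcomp q y i (U b0)) = \<phi> i b0"
      using hess_commute[of "W b0" i y v]
      by (simp add: \<phi>_def c_def matrix_vector_right_distrib inner_add_left inner_add_right field_simps)
    ultimately show ?thesis by simp
  qed
  have \<phi>J: "\<phi> i b = c i / 2 + b $ i + d2comp q y i (W b) (W b) / 2" if "i \<in> J" for i b
    unfolding \<phi>_def using UW(4)[OF that] by simp
  \<comment> \<open>A zero of \<open>\<Phi> t\<close> gives the constraints in \<open>J\<close> the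
    scaled values \<open>c i / 2\<close> on \<open>I\<close>, where \<open>c i\<close> is 0, and
    \<open>c i / 2 - t\<close> elsewhere, which is negative. Outside \<open>J\<close> the entry
    \<open>b $ i\<close> pads \<open>\<Phi>\<close> to a map of the whole space.\<close>
  define \<Phi> where "\<Phi> t b = (\<chi> i. if i \<in> J then q (y + t *\<^sub>R (v + x t b)) $ i / t\<^sup>2 - (c i / 2 - (if i \<in> I then 0 else t))
      else b $ i)" for t b
  obtain t where t: "\<And>k. t k > 0" "t \<longlonglongrightarrow> (0::real)" using null_sequence by blast
  obtain B where B: "B \<ge> 0" "\<And>b. norm (W b) \<le> norm b * B" using W.nonneg_bounded by blast
  have "\<exists>K\<ge>0. \<forall>w. norm (hess q i y *v w) \<le> norm w * K" for i
    using bounded_linear.nonneg_bounded[OF matrix_vector_mul_bounded_linear] by blast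
  then obtain K where K: "\<And>i. K i \<ge> 0" "\<And>i w. norm (hess q i y *v w) \<le> norm w * K i" by metis
  \<comment> \<open>\<open>C\<close> bounds the quadratic term relative to the squared norm of
    \<open>b\<close>; the added 1 keeps it positive.\<close>
  define C where "C = (\<Sum>i\<in>UNIV. B * (B * K i)) + 1"
  have C: "C > 0" unfolding C_def using B(1) K(1) by (simp add: sum_nonneg add_nonneg_pos)
  have quad: "\<bar>d2comp q y i (W b) (W b) / 2\<bar> \<le> (B * (B * K i)) * (norm b)\<^sup>2" for i b
  proof -
    have "\<bar>d2comp q y i (W b) (W b)\<bar> \<le> norm (W b) * norm (hess q i y *v W b)" by (rule Cauchy_Schwarz_ineq2)
    also have "\<dots> \<le> norm (W b) * (norm (W b) * K i)" using K by (intro mult_left_mono) auto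
    also have "\<dots> \<le> (norm b * B) * ((norm b * B) * K i)"
      using B K by (intro mult_mono mult_right_mono) auto
    finally show ?thesis by (simp add: power2_eq_square mult_ac)
  qed
  \<comment> \<open>In the limit \<open>\<Phi>\<close> differs from the identity by the quadratic
    term alone, which is below \<eta> on the ball of radius \<eta> because
    \<open>C * \<eta> < 1\<close>.\<close>
  have claim1: "\<forall>\<^sub>F k in sequentially. \<forall>b\<in>cball 0 \<eta>. norm (\<Phi> (t k) b - b) \<le> \<eta>"
    if \<eta>: "0 < \<eta>" "\<eta> < 1 / C" for \<eta>
  proof (rule eventually_ball_compact)
    fix r :: "nat \<Rightarrow> nat" and b :: "nat \<Rightarrow> real^'l" and b0
    assume r: "strict_mono r" and b: "b \<longlonglongrightarrow> b0" "b0 \<in> cball 0 \<eta>"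
    have tr: "\<And>k. t (r k) > 0" "(\<lambda>k. t (r k)) \<longlonglongrightarrow> 0"
      using t LIMSEQ_subseq_LIMSEQ[OF t(2) r] by (auto simp: o_def)
    define e where "e = (\<chi> i. if i \<in> J then d2comp q y i (W b0) (W b0) / 2 else 0)"
    have "(\<lambda>k. \<Phi> (t (r k)) (b k) - b k) \<longlonglongrightarrow> e"
    proof (rule vec_tendstoI)
      fix i
      show "(\<lambda>k. (\<Phi> (t (r k)) (b k) - b k) $ i) \<longlonglongrightarrow> e $ i"
      proof (cases "i \<in> J")
        case True
        have ti: "(\<lambda>k. if i \<in> I then 0 else t (r k)) \<longlonglongrightarrow> (if i \<in> I then 0 else 0)"
          using tr(2) by (cases "i \<in> I") auto
        have "(\<lambda>k. q (y + t (r k) *\<^sub>R (v + x (t (r k)) (b k))) $ i / (t (r k))\<^sup>2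
            - (c i / 2 - (if i \<in> I then 0 else t (r k))) - b k $ i) \<longlonglongrightarrow> \<phi> i b0 - (c i / 2 - (if i \<in> I then 0 else 0)) - b0 $ i"
          by (intro tendsto_diff \<phi>_lim[OF tr b(1)] tendsto_const tendsto_vec_nth b(1) ti)
             (use JA True in auto)
        then show ?thesis using True by (simp add: \<Phi>_def e_def \<phi>J)
      qed (simp add: \<Phi>_def e_def)
    qed
    then have "(\<lambda>k. norm (\<Phi> (t (r k)) (b k) - b k)) \<longlonglongrightarrow> norm e" by (rule tendsto_norm)
    moreover have "norm e < \<eta>"
    proof -
      have "norm e \<le> (\<Sum>i\<in>UNIV. \<bar>e $ i\<bar>)" by (rule norm_le_l1_cart)
      also have "\<dots> \<le> (\<Sum>i\<in>UNIV. (B * (B * K i)) * (norm b0)\<^sup>2)"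
        using quad[where b = b0] B(1) K(1) by (intro sum_mono) (auto simp: e_def)
      also have "\<dots> \<le> C * (norm b0)\<^sup>2"
        unfolding C_def sum_distrib_right[symmetric] by (intro mult_right_mono) auto
      also have "\<dots> \<le> C * \<eta>\<^sup>2" using b(2) C by (intro mult_left_mono power_mono) auto
      also have "\<dots> < \<eta>"
      proof -
        have "C * \<eta> < 1" using \<eta>(2) C by (simp add: field_simps)
        then have "(C * \<eta>) * \<eta> < 1 * \<eta>" using \<eta>(1) by (rule mult_strict_right_mono)
        then show ?thesis by (simp add: power2_eq_square mult.assoc)
      qed
      finally show ?thesis .
    qed
    ultimately have "\<forall>\<^sub>F k in sequentially. norm (\<Phi> (t (r k)) (b k) - b k) < \<eta>" by (rule order_tendstoD)
    from sequentially_witness[OF this] show "\<exists>k. norm (\<Phi> (t (r k)) (b k) - b k) \<le> \<eta>"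
      using less_imp_le by blast
  qed simp
  \<comment> \<open>The leading coefficient of an active constraint: of second order on
    \<open>active_dir\<close>, of first order otherwise. Off \<open>J\<close> it is negative at
    \<open>b = 0\<close> and hence for small \<open>b\<close>.\<close>
  define \<psi> where "\<psi> i b = (if i \<in> active_dir q y v then \<phi> i b else dcomp q y i (v + W b))" for i b
  have "\<forall>\<^sub>F b in nhds 0. \<forall>i\<in>active q y - J. \<psi> i b < 0"
  proof (rule eventually_ball_finite)
    show "\<forall>i\<in>active q y - J. \<forall>\<^sub>F b in nhds 0. \<psi> i b < 0"
    proof
      fix i assume i: "i \<in> active q y - J"
      have lim: "(U \<longlongrightarrow> U 0) (nhds 0)" "(W \<longlongrightarrow> W 0) (nhds 0)"
        by (intro U.tendsto W.tendsto filterlim_ident)+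
      have "(\<psi> i \<longlongrightarrow> \<psi> i 0) (nhds 0)"
      proof -
        have "(\<phi> i \<longlongrightarrow> \<phi> i 0) (nhds 0)"
          unfolding \<phi>_def
          by (intro tendsto_intros lim bounded_linear.tendsto[OF matrix_vector_mul_bounded_linear]) simp_all
        moreover have "((\<lambda>b. dcomp q y i (v + W b)) \<longlongrightarrow> dcomp q y i (v + W 0)) (nhds 0)"
          by (intro tendsto_intros lim)
        ultimately show ?thesis
          unfolding \<psi>_def by (cases "i \<in> active_dir q y v") (simp_all only: if_True if_False)
      qed
      moreover have "\<psi> i 0 < 0"
      proof (cases "i \<in> active_dir q y v")
        case True
        then have "c i \<noteq> 0" using i zJ by (auto simp: second_order_active_def c_def)
        then show ?thesis using True c0[of i] i by (simp add: \<psi>_def \<phi>_def U.zero W.zero)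
      next
        case False
        then show ?thesis using v[of i] i by (auto simp: \<psi>_def active_dir_def W.zero order_less_le)
      qed
      ultimately show "\<forall>\<^sub>F b in nhds 0. \<psi> i b < 0" by (rule order_tendstoD)
    qed
  qed simp
  then obtain d where d: "d > 0" "\<And>b i. norm b < d \<Longrightarrow> i \<in> active q y - J \<Longrightarrow> \<psi> i b < 0"
    unfolding eventually_nhds_metric by auto
  have claim2: "\<forall>\<^sub>F k in sequentially. \<forall>i\<in>-J. \<forall>b\<in>cball 0 \<eta>. q (y + t k *\<^sub>R (v + x (t k) b)) $ i < 0"
    if \<eta>: "0 < \<eta>" "\<eta> < d" for \<eta>
  proof (rule eventually_ball_finite)
    show "\<forall>i\<in>-J. \<forall>\<^sub>F k in sequentially. \<forall>b\<in>cball 0 \<eta>. q (y + t k *\<^sub>R (v + x (t k) b)) $ i < 0"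
    proof
      fix i assume iJ: "i \<in> - J"
      show "\<forall>\<^sub>F k in sequentially. \<forall>b\<in>cball 0 \<eta>. q (y + t k *\<^sub>R (v + x (t k) b)) $ i < 0"
      proof (rule eventually_ball_compact)
        fix r :: "nat \<Rightarrow> nat" and b :: "nat \<Rightarrow> real^'l" and b0
        assume r: "strict_mono r" and b: "b \<longlonglongrightarrow> b0" "b0 \<in> cball 0 \<eta>"
        have tr: "\<And>k. t (r k) > 0" "(\<lambda>k. t (r k)) \<longlonglongrightarrow> 0"
          using t LIMSEQ_subseq_LIMSEQ[OF t(2) r] by (auto simp: o_def)
        have bd: "norm b0 < d" using b(2) \<eta> by simp
        have "\<forall>\<^sub>F k in sequentially. q (y + t (r k) *\<^sub>R (v + x (t (r k)) (b k))) $ i < 0"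
        proof (cases "i \<in> active q y")
          case False
          then have "q y $ i < 0" using y by (auto simp: active_def feasible_def order_less_le)
          then show ?thesis using order_tendstoD(2)[OF tendsto_component[OF h_lim[OF tr(2) b(1)]]] by blast
        next
          case True
          have neg: "\<psi> i b0 < 0" using d(2)[OF bd] True iJ by simp
          show ?thesis
          proof (cases "i \<in> active_dir q y v")
            case ad: True
            have "\<phi> i b0 < 0" using neg ad by (simp add: \<psi>_def)
            with \<phi>_lim[OF tr b(1) ad]
            have "\<forall>\<^sub>F k in sequentially. q (y + t (r k) *\<^sub>R (v + x (t (r k)) (b k))) $ i / (t (r k))\<^sup>2 < 0"
              by (rule order_tendstoD)
            then show ?thesis
              by (rule eventually_mono) (use tr(1) in \<open>simp add: divide_less_0_iff\<close>)
          next
            case ad: False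
            have "dcomp q y i (v + W b0) < 0" using neg ad by (simp add: \<psi>_def)
            with difference_quotient[OF has_grad[of i y] tr tendsto_add[OF tendsto_const x_lim[OF tr(2) b(1)]]]
            have "\<forall>\<^sub>F k in sequentially. (q (y + t (r k) *\<^sub>R (v + x (t (r k)) (b k))) $ i - q y $ i) /\<^sub>R t (r k) < 0"
              by (rule order_tendstoD)
            then show ?thesis
            proof (rule eventually_mono)
              fix k assume "(q (y + t (r k) *\<^sub>R (v + x (t (r k)) (b k))) $ i - q y $ i) /\<^sub>R t (r k) < 0"
              then show "q (y + t (r k) *\<^sub>R (v + x (t (r k)) (b k))) $ i < 0"
                using tr(1)[of k] True by (simp add: active_def mult_less_0_iff)
            qed
          qed
        qed
        then show "\<exists>k. q (y + t (r k) *\<^sub>R (v + x (t (r k)) (b k))) $ i < 0"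
          by (rule sequentially_witness)
      qed simp
    qed
  qed simp
  obtain BU where BU: "BU \<ge> 0" "\<And>b. norm (U b) \<le> norm b * BU" using U.nonneg_bounded by blast
  define M where "M = norm z + B + BU"
  show ?thesis
  proof (rule that[of "min 1 (min (1 / C) d)" M])
    show "min 1 (min (1 / C) d) > 0" using C d by simp
    fix \<eta> :: real assume \<eta>: "0 < \<eta>" "\<eta> < min 1 (min (1 / C) d)"
    have "\<forall>\<^sub>F k in sequentially. t k < \<eta>" using t(2) \<eta>(1) by (rule order_tendstoD)
    then have "\<forall>\<^sub>F k in sequentially. (\<forall>b\<in>cball 0 \<eta>. norm (\<Phi> (t k) b - b) \<le> \<eta>) \<and>
      (\<forall>i\<in>-J. \<forall>b\<in>cball 0 \<eta>. q (y + t k *\<^sub>R (v + x (t k) b)) $ i < 0) \<and> t k < \<eta>"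
      using claim1[of \<eta>] claim2[of \<eta>] \<eta> by (intro eventually_conj) auto
    from sequentially_witness[OF this] obtain k where k: "\<And>b. b \<in> cball 0 \<eta> \<Longrightarrow> norm (\<Phi> (t k) b - b) \<le> \<eta>"
      "\<And>i b. i \<notin> J \<Longrightarrow> b \<in> cball 0 \<eta> \<Longrightarrow> q (y + t k *\<^sub>R (v + x (t k) b)) $ i < 0" "t k < \<eta>"
      by blast
    have tk: "t k > 0" by (rule t)
    have cont: "continuous_on (cball 0 \<eta>) (\<lambda>b. b - \<Phi> (t k) b)"
    proof (rule continuous_on_diff[OF continuous_on_id])
      have 1: "continuous_on (cball 0 \<eta>) (\<lambda>b. y + t k *\<^sub>R (v + x (t k) b))"
        unfolding x_def
        by (intro continuous_intros bounded_linear.continuous_on[OF UW(1)] bounded_linear.continuous_on[OF UW(2)])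
      have 2: "continuous_on (cball 0 \<eta>) (\<lambda>b. q (y + t k *\<^sub>R (v + x (t k) b)) $ i)" for i
        by (intro continuous_intros continuous_on_compose2[OF continuous_on_q[of UNIV] 1]) simp
      show "continuous_on (cball 0 \<eta>) (\<Phi> (t k))"
        unfolding \<Phi>_def
      proof (rule continuous_on_vec_lambda)
        fix i
        show "continuous_on (cball 0 \<eta>) (\<lambda>b. if i \<in> J then q (y + t k *\<^sub>R (v + x (t k) b)) $ i / (t k)\<^sup>2
           - (c i / 2 - (if i \<in> I then 0 else t k)) else b $ i)"
          using tk by (cases "i \<in> J") (auto intro!: continuous_intros 2)
      qed
    qed
    \<comment> \<open>A fixed point of \<open>b - \<Phi> (t k) b\<close> is a zero of
      \<open>\<Phi> (t k)\<close>.\<close>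
    have "(\<lambda>b. b - \<Phi> (t k) b) \<in> cball 0 \<eta> \<rightarrow> cball 0 \<eta>"
      using k(1) by (auto simp: norm_minus_commute)
    then obtain b where b: "b \<in> cball 0 \<eta>" "b - \<Phi> (t k) b = b"
      using brouwer_ball[OF \<eta>(1) cont] by blast
    define V where "V = v + x (t k) b"
    have \<Phi>0: "\<Phi> (t k) b $ i = 0" for i using b(2) by simp
    have qJ: "q (y + t k *\<^sub>R V) $ i = (c i / 2 - (if i \<in> I then 0 else t k)) * (t k)\<^sup>2" if "i \<in> J" for i
      using \<Phi>0[of i] that tk by (simp add: \<Phi>_def V_def[symmetric] field_simps)
    have qn: "q (y + t k *\<^sub>R V) $ i < 0" if "i \<notin> J" for i
      using k(2)[OF that b(1)] by (simp add: V_def)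
    have IJ: "I \<subseteq> J" using Iz zJ by blast
    have qI: "q (y + t k *\<^sub>R V) $ i = 0" if "i \<in> I" for i
    proof -
      have "c i = 0" "i \<in> J" using that IJ Iz by (auto simp: second_order_active_def c_def)
      then show ?thesis using qJ[of i] that by simp
    qed
    have qJI: "q (y + t k *\<^sub>R V) $ i < 0" if "i \<in> J" "i \<notin> I" for i
    proof -
      have "c i \<le> 0" using c0[of i] that(1) JA by (auto simp: active_dir_def)
      then show ?thesis using qJ[OF that(1)] that(2) tk by (auto intro!: mult_neg_pos)
    qed
    have qneg: "q (y + t k *\<^sub>R V) $ i < 0" if "i \<notin> I" for i
      using qJI[of i] qn[of i] that by blast
    have "q (y + t k *\<^sub>R V) $ i \<le> 0" for i
      using qI[of i] qneg[of i] by (cases "i \<in> I") auto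
    then have "y + t k *\<^sub>R V \<in> feasible q" by (simp add: feasible_def)
    moreover have "active q (y + t k *\<^sub>R V) = I"
    proof (intro equalityI subsetI)
      fix i assume "i \<in> active q (y + t k *\<^sub>R V)"
      then have "q (y + t k *\<^sub>R V) $ i = 0" by (simp add: active_def)
      then show "i \<in> I" using qneg[of i] by force
    qed (simp add: active_def qI)
    moreover have "norm (V - v) \<le> M * \<eta>"
    proof -
      have bn: "norm b \<le> \<eta>" using b(1) by simp
      have "norm (x (t k) b) \<le> norm ((t k / 2) *\<^sub>R z) + norm (W b) + norm (t k *\<^sub>R U b)"
        unfolding x_def by (intro order_trans[OF norm_triangle_ineq] add_right_mono norm_triangle_ineq)
      also have "\<dots> \<le> \<eta> * norm z + \<eta> * B + \<eta> * BU"
      proof (intro add_mono)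
        show "norm ((t k / 2) *\<^sub>R z) \<le> \<eta> * norm z"
        proof -
          have "(t k / 2) * norm z \<le> \<eta> * norm z" using tk k(3) by (intro mult_right_mono) auto
          then show ?thesis using tk by simp
        qed
        show "norm (W b) \<le> \<eta> * B" using B(2)[of b] mult_right_mono[OF bn B(1)] by linarith
        have "norm (U b) \<le> \<eta> * BU" using BU(2)[of b] mult_right_mono[OF bn BU(1)] by linarith
        moreover have "t k * norm (U b) \<le> 1 * norm (U b)" using k(3) \<eta> by (intro mult_right_mono) auto
        ultimately show "norm (t k *\<^sub>R U b) \<le> \<eta> * BU" using tk by simp
      qed
      finally show ?thesis by (simp add: V_def M_def algebra_simps)
    qed
    ultimately show "\<exists>t V. 0 < t \<and> t < \<eta> \<and> norm (V - v) \<le> M * \<eta> \<and> y + t *\<^sub>R V \<in> feasible q \<and> active q (y + t *\<^sub>R V) = I"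
      using tk k(3) by blast
  qed
qed

text \<open>Each radius in \<open>curve_step\<close> yields one point; radii tending to 0 turn these
  points into a sequence whose directions converge to \<open>v\<close>.\<close>

lemma curve:
  assumes y: "y \<in> feasible q" and v: "\<And>i. i \<in> active q y \<Longrightarrow> dcomp q y i v \<le> 0"
    and J: "maximal_in (index_family q y v) J" and reg: "two_regular q J y v"
    and z: "z \<in> second_order_set q y v" and Iz: "I \<subseteq> second_order_active q y v z"
    and zJ: "second_order_active q y v z \<subseteq> J"
  obtains t V where "\<And>k. t k > 0" "t \<longlonglongrightarrow> (0::real)" "V \<longlonglongrightarrow> v"
    "\<And>k. y + t k *\<^sub>R V k \<in> feasible q" "\<And>k. active q (y + t k *\<^sub>R V k) = I"
proof -
  obtain M \<eta>0 where M: "\<eta>0 > 0" "\<And>\<eta>. 0 < \<eta> \<Longrightarrow> \<eta> < \<eta>0 \<Longrightarrow>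
     \<exists>t V. 0 < t \<and> t < \<eta> \<and> norm (V - v) \<le> M * \<eta> \<and> y + t *\<^sub>R V \<in> feasible q \<and> active q (y + t *\<^sub>R V) = I"
    using curve_step[OF y v J reg z Iz zJ] by blast
  \<comment> \<open>The shift by two keeps \<open>\<eta> k\<close> strictly below
    \<open>\<eta>0\<close> already at \<open>k = 0\<close>.\<close>
  define \<eta> where "\<eta> k = \<eta>0 * (1 / real (Suc (Suc k)))" for k
  have \<eta>: "0 < \<eta> k" "\<eta> k < \<eta>0" for k
    using M(1) mult_strict_left_mono[of "1 / real (Suc (Suc k))" 1 \<eta>0] by (simp_all add: \<eta>_def)
  have "\<eta> \<longlonglongrightarrow> \<eta>0 * 0"
    unfolding \<eta>_def using lim_inverse_n'[THEN LIMSEQ_Suc, THEN LIMSEQ_Suc] by (intro tendsto_mult tendsto_const) simp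
  then have \<eta>_lim: "\<eta> \<longlonglongrightarrow> 0" by simp
  have "\<forall>k. \<exists>t V. 0 < t \<and> t < \<eta> k \<and> norm (V - v) \<le> M * \<eta> k \<and> y + t *\<^sub>R V \<in> feasible q \<and> active q (y + t *\<^sub>R V) = I"
    using M(2)[OF \<eta>] by blast
  then obtain t V where tV: "\<And>k. 0 < t k" "\<And>k. t k < \<eta> k" "\<And>k. norm (V k - v) \<le> M * \<eta> k"
    "\<And>k. y + t k *\<^sub>R V k \<in> feasible q" "\<And>k. active q (y + t k *\<^sub>R V k) = I" by metis
  have "t \<longlonglongrightarrow> 0"
    by (rule tendsto_sandwich[OF _ _ tendsto_const \<eta>_lim]) (use tV(1,2) in \<open>auto intro!: always_eventually less_imp_le\<close>)
  moreover have "V \<longlonglongrightarrow> v"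
  proof (rule LIM_zero_cancel, rule Lim_null_comparison)
    show "\<forall>\<^sub>F k in sequentially. norm (V k - v) \<le> M * \<eta> k" using tV(3) by simp
    show "(\<lambda>k. M * \<eta> k) \<longlonglongrightarrow> 0" using tendsto_mult_right_zero[OF \<eta>_lim] by simp
  qed
  ultimately show ?thesis using that tV by blast
qed

text \<open>Prescribing the support of \<open>lam\<close> as the active set of the curve keeps
  \<open>lam\<close> a multiplier at all its points, so \<open>graph_tangent\<close>
  applies.\<close>

lemma graph_tangent_direction:
  assumes y: "y \<in> feasible q" and v: "\<And>i. i \<in> active q y \<Longrightarrow> dcomp q y i v \<le> 0"
    and reg: "\<And>J. maximal_in (index_family q y v) J \<Longrightarrow> two_regular q J y v"
    and lam: "lam \<in> multiplier_cone q y"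
    and z: "z \<in> second_order_set q y v" and lz: "{i. lam $ i > 0} \<subseteq> second_order_active q y v z"
  shows "(v, lag_hessian q y lam *v v) \<in> contingent_cone (normal_graph q) (y, lag_grad q y lam)"
proof -
  have "second_order_active q y v z \<in> index_family q y v" using z by (simp add: index_family_def)
  then obtain J where J: "maximal_in (index_family q y v) J" "second_order_active q y v z \<subseteq> J"
    using exists_maximal_in[of "index_family q y v"] by auto
  obtain t V where tV: "\<And>k. t k > 0" "t \<longlonglongrightarrow> (0::real)" "V \<longlonglongrightarrow> v"
    "\<And>k. y + t k *\<^sub>R V k \<in> feasible q" "\<And>k. active q (y + t k *\<^sub>R V k) = {i. lam $ i > 0}"
    using curve[OF y v J(1) reg[OF J(1)] z lz J(2)] by blast
  show ?thesis by (rule graph_tangent[OF lam tV(1-4)]) (use tV(5) in auto)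
qed

text \<open>The gradients at \<open>y + t V\<close>, applied to \<open>W b + t U b\<close> and
  divided by \<open>t\<close>, converge on \<open>J\<close> to \<open>b\<close> uniformly over the
  unit ball. A linear map within 1/2 of the identity has an inverse bounded by 2; undoing the
  scaling costs the factor \<open>1 / t\<close>.\<close>

lemma two_regular_solvable:
  assumes reg: "two_regular q J y v"
    and t: "\<And>k. t k > 0" "t \<longlonglongrightarrow> (0::real)" and V: "V \<longlonglongrightarrow> v"
  obtains C where "\<forall>\<^sub>F k in sequentially. \<forall>r :: real^'l. \<exists>a.
     (\<forall>i\<in>J. dcomp q (y + t k *\<^sub>R V k) i a = r $ i) \<and> norm a \<le> C * norm r / t k"
proof -
  obtain U W where UW: "bounded_linear U" "bounded_linear W"
    "\<And>i b. i \<in> J \<Longrightarrow> dcomp q y i (W b) = 0"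
    "\<And>i b. i \<in> J \<Longrightarrow> dcomp q y i (U b) + d2comp q y i v (W b) = b $ i"
    using two_regular_linear[OF reg] by metis
  interpret U: bounded_linear U by fact
  interpret W: bounded_linear W by fact
  obtain BU BW where B: "BU \<ge> 0" "\<And>b. norm (U b) \<le> norm b * BU" "BW \<ge> 0" "\<And>b. norm (W b) \<le> norm b * BW"
    using U.nonneg_bounded W.nonneg_bounded by metis
  \<comment> \<open>Padding with \<open>b $ i\<close> outside \<open>J\<close> makes
    \<open>L k\<close> an endomorphism, so injectivity implies surjectivity.\<close>
  define L where "L k b = (\<chi> i. if i \<in> J then dcomp q (y + t k *\<^sub>R V k) i (W b + t k *\<^sub>R U b) / t k else b $ i)" for k b
  have lin: "linear (L k)" for k
    unfolding L_def by (rule linearI)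
      (auto simp: vec_eq_iff W.add U.add W.scaleR U.scaleR scaleR_add_right inner_add_right add_divide_distrib algebra_simps)
  have "\<forall>\<^sub>F k in sequentially. \<forall>b\<in>cball 0 1. norm (L k b - b) \<le> 1 / 2"
  proof (rule eventually_ball_compact)
    fix r :: "nat \<Rightarrow> nat" and b :: "nat \<Rightarrow> real^'l" and b0
    assume r: "strict_mono r" and b: "b \<longlonglongrightarrow> b0"
    have tr: "\<And>k. t (r k) > 0" "(\<lambda>k. t (r k)) \<longlonglongrightarrow> 0" and Vr: "(\<lambda>k. V (r k)) \<longlonglongrightarrow> v"
      using t LIMSEQ_subseq_LIMSEQ[OF t(2) r] LIMSEQ_subseq_LIMSEQ[OF V r] by (auto simp: o_def)
    have yr: "(\<lambda>k. y + t (r k) *\<^sub>R V (r k)) \<longlonglongrightarrow> y" by (rule tendsto_scaleR_add[OF tr(2) Vr])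
    have "(\<lambda>k. L (r k) (b k) - b k) \<longlonglongrightarrow> 0"
    proof (rule vec_tendstoI)
      fix i
      show "(\<lambda>k. (L (r k) (b k) - b k) $ i) \<longlonglongrightarrow> 0 $ i"
      proof (cases "i \<in> J")
        case True
        have "(\<lambda>k. ((grad q i (y + t (r k) *\<^sub>R V (r k)) - grad q i y) /\<^sub>R t (r k)) \<bullet> W (b k)
            + grad q i (y + t (r k) *\<^sub>R V (r k)) \<bullet> U (b k) - b k $ i)
          \<longlonglongrightarrow> (hess q i y *v v) \<bullet> W b0 + grad q i y \<bullet> U b0 - b0 $ i"
          by (intro tendsto_intros difference_quotient[OF has_hess tr Vr] tendsto_grad[OF yr] U.tendsto W.tendsto b)
        moreover have "(hess q i y *v v) \<bullet> W b0 + grad q i y \<bullet> U b0 - b0 $ i = 0"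
          using UW(4)[OF True, of b0] hess_commute[of v i y "W b0"] by (simp add: inner_commute)
        moreover have "((grad q i (y + t (r k) *\<^sub>R V (r k)) - grad q i y) /\<^sub>R t (r k)) \<bullet> W (b k)
            + grad q i (y + t (r k) *\<^sub>R V (r k)) \<bullet> U (b k) - b k $ i = (L (r k) (b k) - b k) $ i" for k
          using True tr(1)[of k] UW(3)[OF True]
          by (simp add: L_def inner_add_right inner_diff_left divide_inverse algebra_simps)
        ultimately show ?thesis by simp
      qed (simp add: L_def)
    qed
    then have "(\<lambda>k. norm (L (r k) (b k) - b k)) \<longlonglongrightarrow> 0" by (rule tendsto_norm_zero)
    then have "\<forall>\<^sub>F k in sequentially. norm (L (r k) (b k) - b k) < 1 / 2" by (rule order_tendstoD) simp
    from sequentially_witness[OF this] show "\<exists>k. norm (L (r k) (b k) - b k) \<le> 1 / 2"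
      using less_imp_le by blast
  qed simp
  moreover have "\<forall>\<^sub>F k in sequentially. t k < 1" using t(2) by (rule order_tendstoD) simp
  ultimately have "\<forall>\<^sub>F k in sequentially. \<forall>r :: real^'l. \<exists>a.
     (\<forall>i\<in>J. dcomp q (y + t k *\<^sub>R V k) i a = r $ i) \<and> norm a \<le> (2 * (BU + BW)) * norm r / t k"
  proof eventually_elim
    case (elim k)
    have tk: "t k > 0" by (rule t)
    interpret L: linear "L k" by (rule lin)
    have half: "norm (L k b - b) \<le> norm b / 2" for b
    proof (cases "b = 0")
      case False
      have "norm (L k (b /\<^sub>R norm b) - b /\<^sub>R norm b) \<le> 1 / 2" using elim(1) False by simp
      moreover have "L k (b /\<^sub>R norm b) - b /\<^sub>R norm b = (L k b - b) /\<^sub>R norm b"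
        by (simp add: L.scaleR scaleR_diff_right)
      ultimately have "norm ((L k b - b) /\<^sub>R norm b) \<le> 1 / 2" by simp
      then show ?thesis using False by (simp add: divide_simps mult.commute)
    qed (simp add: L.zero)
    have lower: "norm b \<le> 2 * norm (L k b)" for b
      using half[of b] norm_triangle_ineq3[of b "L k b"] by (simp add: norm_minus_commute)
    have "inj (L k)"
      unfolding linear_inj_iff_eq_0[OF lin] using lower by (metis mult_zero_right norm_le_zero_iff norm_zero)
    then have "surj (L k)" using linear_injective_imp_surjective[OF lin] by blast
    show ?case
    proof
      fix r :: "real^'l"
      obtain b where b: "L k b = r" using \<open>surj (L k)\<close> by (metis surjD)
      define a where "a = (W b + t k *\<^sub>R U b) /\<^sub>R t k"
      have "dcomp q (y + t k *\<^sub>R V k) i a = r $ i" if "i \<in> J" for i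
        using b that by (auto simp: L_def a_def divide_inverse_commute)
      moreover have "norm a \<le> (2 * (BU + BW)) * norm r / t k"
      proof -
        have "norm (W b + t k *\<^sub>R U b) \<le> norm (W b) + t k * norm (U b)"
          using norm_triangle_ineq[of "W b" "t k *\<^sub>R U b"] tk by simp
        also have "\<dots> \<le> norm b * BW + 1 * (norm b * BU)"
          using B elim(2) tk by (intro add_mono mult_mono) auto
        also have "\<dots> = norm b * (BU + BW)" by (simp add: algebra_simps)
        also have "\<dots> \<le> (2 * norm r) * (BU + BW)" using lower[of b] b B by (intro mult_right_mono) auto
        finally have "norm (W b + t k *\<^sub>R U b) \<le> (2 * (BU + BW)) * norm r" by (simp add: mult_ac)
        moreover have "norm a = norm (W b + t k *\<^sub>R U b) / t k" using tk by (simp add: a_def divide_inverse_commute)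
        ultimately show ?thesis using tk by (simp add: divide_right_mono)
      qed
      ultimately show "\<exists>a. (\<forall>i\<in>J. dcomp q (y + t k *\<^sub>R V k) i a = r $ i) \<and> norm a \<le> (2 * (BU + BW)) * norm r / t k"
        by blast
    qed
  qed
  then show ?thesis by (rule that)
qed

end

section \<open>Limits of index cones\<close>

lemma index_cone_Int:
  "index_cone q y Ip I = (\<Inter>i\<in>Ip. {w. dcomp q y i w = 0}) \<inter> (\<Inter>i\<in>I - Ip. {w. dcomp q y i w \<le> 0})"
  unfolding index_cone_def by blast

lemma closed_index_cone: "closed (index_cone q y Ip I)"
  unfolding index_cone_Int by (intro closed_Int closed_INT ballI closed_hyperplane closed_halfspace_le)

lemma convex_cone_index_cone: "convex_cone (index_cone q y Ip I)"
  unfolding convex_cone_iff index_cone_def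
  by (auto simp: inner_add_right add_nonpos_nonpos mult_nonneg_nonpos)

text \<open>Moreau decomposition: subtracting from \<open>n\<close> its projection
  \<open>p k\<close> onto the cone leaves an element of the polar. A cluster point \<open>p0\<close>
  of the projections lies in \<open>K0\<close>, so \<open>n \<bullet> p0 \<le> 0\<close>, while this
  number is a limit of squared norms of projections; hence they tend to 0.\<close>

lemma neg_polar_limit:
  fixes K :: "nat \<Rightarrow> 'a::euclidean_space set"
  assumes K: "\<And>k. closed (K k)" "\<And>k. convex_cone (K k)"
    and outer: "\<And>r w w0. strict_mono (r :: nat \<Rightarrow> nat) \<Longrightarrow> (\<And>k. w k \<in> K (r k)) \<Longrightarrow> w \<longlonglongrightarrow> w0 \<Longrightarrow> w0 \<in> K0"
    and n: "n \<in> neg_polar K0"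
  obtains N where "N \<longlonglongrightarrow> n" "\<And>k. N k \<in> neg_polar (K k)"
proof -
  define p where "p k = closest_point (K k) n" for k
  have cv: "convex (K k)" for k using K(2)[of k] by (simp add: convex_cone_def)
  have pK: "p k \<in> K k" for k
    unfolding p_def using K by (intro closest_point_in_set convex_cone_nonempty)
  have le: "(n - p k) \<bullet> (u - p k) \<le> 0" if "u \<in> K k" for u k
    unfolding p_def by (rule closest_point_dot[OF cv K(1) that])
  have orth: "(n - p k) \<bullet> p k = 0" for k
    using le[OF convex_cone_contains_0[OF K(2)], of k] le[OF convex_cone_scaleR[OF K(2) _ pK, of 2], of k]
    by (simp add: scaleR_2)
  have np: "n - p k \<in> neg_polar (K k)" for k
    unfolding neg_polar_def using le[of _ k] orth[of k] by (auto simp: inner_diff_right)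
  have pn: "(norm (p k))\<^sup>2 = n \<bullet> p k" for k
    using orth[of k] by (simp add: inner_diff_left power2_norm_eq_inner)
  have pb: "norm (p k) \<le> norm n" for k
  proof -
    have "norm (p k) * norm (p k) \<le> norm n * norm (p k)"
      using pn[of k] norm_cauchy_schwarz[of n "p k"] by (simp add: power2_eq_square)
    then show ?thesis by (cases "p k = 0") auto
  qed
  have "p \<longlonglongrightarrow> 0"
  proof (rule tendstoI)
    fix e :: real assume "e > 0"
    show "\<forall>\<^sub>F k in sequentially. dist (p k) 0 < e"
    proof (rule ccontr)
      assume "\<not> ?thesis"
      then obtain r :: "nat \<Rightarrow> nat" where r: "strict_mono r" "\<And>k. \<not> dist (p (r k)) 0 < e"
        using infinite_subseq[of "\<lambda>k. dist (p k) 0 < e"] by blast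
      have "bounded (range (\<lambda>k. p (r k)))" unfolding bounded_iff using pb by auto
      then obtain p0 s where s: "strict_mono s" "((\<lambda>k. p (r k)) \<circ> s) \<longlonglongrightarrow> p0"
        using bounded_imp_convergent_subsequence by blast
      have lim: "(\<lambda>k. p (r (s k))) \<longlonglongrightarrow> p0" using s(2) by (simp add: o_def)
      have "p0 \<in> K0"
        by (rule outer[OF strict_mono_o[OF r(1) s(1)] _ lim]) (simp add: pK)
      then have "n \<bullet> p0 \<le> 0" using n by (simp add: neg_polar_def)
      have sq: "(\<lambda>k. (norm (p (r (s k))))\<^sup>2) \<longlonglongrightarrow> n \<bullet> p0"
        unfolding pn by (intro tendsto_intros lim)
      have "e\<^sup>2 \<le> (norm (p (r (s k))))\<^sup>2" for k
        using r(2)[of "s k"] \<open>e > 0\<close> by (intro power_mono) auto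
      then have "e\<^sup>2 \<le> n \<bullet> p0" by (intro LIMSEQ_le_const[OF sq]) blast
      with \<open>n \<bullet> p0 \<le> 0\<close> \<open>e > 0\<close> show False using zero_less_power[of e 2] by linarith
    qed
  qed
  then have "(\<lambda>k. n - p k) \<longlonglongrightarrow> n - 0" by (intro tendsto_intros)
  with that[of "\<lambda>k. n - p k"] np show ?thesis by simp
qed

context twice_differentiable
begin

text \<open>The vector \<open>w k /\<^sub>R t k\<close> solves the second-order system whose
  right-hand side is the difference quotient of the gradients paired with \<open>w k\<close>. It is
  in general unbounded, so \<open>closed_solvable\<close> provides the limiting
  \<open>z\<close>.\<close>

lemma index_cone_outer_limit:
  assumes t: "\<And>k. t k > 0" "t \<longlonglongrightarrow> (0::real)" and V: "V \<longlonglongrightarrow> v" and w: "w \<longlonglongrightarrow> w0"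
    and IpI: "Ip \<subseteq> I" and mem: "\<And>k. w k \<in> index_cone q (y + t k *\<^sub>R V k) Ip I"
  shows "w0 \<in> index_cone_dir q y Ip I v"
proof -
  have y: "(\<lambda>k. y + t k *\<^sub>R V k) \<longlonglongrightarrow> y" by (rule tendsto_scaleR_add[OF t(2) V])
  have lim: "(\<lambda>k. dcomp q (y + t k *\<^sub>R V k) i (w k)) \<longlonglongrightarrow> dcomp q y i w0" for i
    by (intro tendsto_intros tendsto_grad y w)
  have eq: "dcomp q y i w0 = 0" if i: "i \<in> Ip" for i
  proof -
    have "dcomp q (y + t k *\<^sub>R V k) i (w k) = 0" for k using mem[of k] i by (simp add: index_cone_def)
    with lim[of i] show ?thesis by (simp add: LIMSEQ_const_iff)
  qed
  have le: "dcomp q y i w0 \<le> 0" if i: "i \<in> I - Ip" for i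
    by (rule LIMSEQ_le_const2[OF lim]) (use mem i in \<open>auto simp: index_cone_def\<close>)
  define c where "c k = (\<chi> i. ((grad q i (y + t k *\<^sub>R V k) - grad q i y) /\<^sub>R t k) \<bullet> w k)" for k
  have "c \<longlonglongrightarrow> (\<chi> i. d2comp q y i v w0)"
  proof (rule vec_tendstoI)
    fix i
    have "(\<lambda>k. ((grad q i (y + t k *\<^sub>R V k) - grad q i y) /\<^sub>R t k) \<bullet> w k) \<longlonglongrightarrow> (hess q i y *v v) \<bullet> w0"
      by (intro tendsto_inner difference_quotient[OF has_hess t V] w)
    moreover have "(hess q i y *v v) \<bullet> w0 = d2comp q y i v w0"
      using hess_commute[of w0 i y v] by (simp add: inner_commute)
    ultimately show "(\<lambda>k. c k $ i) \<longlonglongrightarrow> (\<chi> i. d2comp q y i v w0) $ i" by (simp add: c_def)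
  qed
  moreover have "\<exists>z. (\<forall>i\<in>Ip. dcomp q y i z + c k $ i = 0) \<and> (\<forall>i\<in>I - Ip. dcomp q y i z + c k $ i \<le> 0)" for k
  proof (intro exI conjI ballI)
    have *: "dcomp q y i (w k /\<^sub>R t k) + c k $ i = dcomp q (y + t k *\<^sub>R V k) i (w k) / t k" for i
      by (simp add: c_def inner_diff_left divide_inverse algebra_simps)
    show "dcomp q y i (w k /\<^sub>R t k) + c k $ i = 0" if "i \<in> Ip" for i
      unfolding * using mem[of k] that by (simp add: index_cone_def)
    show "dcomp q y i (w k /\<^sub>R t k) + c k $ i \<le> 0" if "i \<in> I - Ip" for i
      unfolding * using mem[of k] that t(1)[of k] by (auto simp: index_cone_def intro: divide_nonpos_pos)
  qed
  ultimately have "\<exists>z. (\<forall>i\<in>Ip. dcomp q y i z + (\<chi> i. d2comp q y i v w0) $ i = 0) \<and>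
      (\<forall>i\<in>I - Ip. dcomp q y i z + (\<chi> i. d2comp q y i v w0) $ i \<le> 0)"
    using closed_sequentially[OF closed_solvable[OF IpI, of "\<lambda>i. grad q i y"], of c] by blast
  then show ?thesis using eq le by (simp add: index_cone_dir_def index_cone_def)
qed

text \<open>The point \<open>w + t z\<close> meets the cone conditions at the moved base point up to
  an error \<open>r\<close> that is small compared with \<open>t\<close>. Removing it by
  \<open>two_regular_solvable\<close> costs a correction of order \<open>r / t\<close>, which still
  tends to 0.\<close>

lemma index_cone_inner_limit:
  assumes reg: "two_regular q I y v"
    and t: "\<And>k. t k > 0" "t \<longlonglongrightarrow> (0::real)" and V: "V \<longlonglongrightarrow> v"
    and IpI: "Ip \<subseteq> I" and w: "w \<in> index_cone_dir q y Ip I v"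
  obtains W where "W \<longlonglongrightarrow> w" "\<forall>\<^sub>F k in sequentially. W k \<in> index_cone q (y + t k *\<^sub>R V k) Ip I"
proof -
  have y: "(\<lambda>k. y + t k *\<^sub>R V k) \<longlonglongrightarrow> y" by (rule tendsto_scaleR_add[OF t(2) V])
  obtain z where z: "\<And>i. i \<in> Ip \<Longrightarrow> dcomp q y i z + d2comp q y i v w = 0"
    "\<And>i. i \<in> I - Ip \<Longrightarrow> dcomp q y i z + d2comp q y i v w \<le> 0"
    using w unfolding index_cone_dir_def by blast
  have wc: "\<And>i. i \<in> Ip \<Longrightarrow> dcomp q y i w = 0" "\<And>i. i \<in> I - Ip \<Longrightarrow> dcomp q y i w \<le> 0"
    using w unfolding index_cone_dir_def index_cone_def by auto
  define r where "r k = (\<chi> i. dcomp q (y + t k *\<^sub>R V k) i (w + t k *\<^sub>R z)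
     - (dcomp q y i w + t k * (dcomp q y i z + d2comp q y i v w)))" for k
  have r: "(\<lambda>k. r k /\<^sub>R t k) \<longlonglongrightarrow> 0"
  proof (rule vec_tendstoI)
    fix i
    have "(\<lambda>k. ((grad q i (y + t k *\<^sub>R V k) - grad q i y) /\<^sub>R t k) \<bullet> w + dcomp q (y + t k *\<^sub>R V k) i z
       - (dcomp q y i z + d2comp q y i v w)) \<longlonglongrightarrow> (hess q i y *v v) \<bullet> w + dcomp q y i z - (dcomp q y i z + d2comp q y i v w)"
      by (intro tendsto_intros difference_quotient[OF has_hess t V] tendsto_grad y)
    moreover have "(hess q i y *v v) \<bullet> w = d2comp q y i v w"
      using hess_commute[of w i y v] by (simp add: inner_commute)
    moreover have "((grad q i (y + t k *\<^sub>R V k) - grad q i y) /\<^sub>R t k) \<bullet> w + dcomp q (y + t k *\<^sub>R V k) i z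
       - (dcomp q y i z + d2comp q y i v w) = (r k /\<^sub>R t k) $ i" for k
    proof -
      have "t k \<noteq> 0" using t(1)[of k] by simp
      have "r k $ i = (grad q i (y + t k *\<^sub>R V k) - grad q i y) \<bullet> w
          + t k * (dcomp q (y + t k *\<^sub>R V k) i z - (dcomp q y i z + d2comp q y i v w))"
        by (simp add: r_def inner_add_right inner_diff_left algebra_simps)
      then have "(r k /\<^sub>R t k) $ i = ((grad q i (y + t k *\<^sub>R V k) - grad q i y) \<bullet> w) / t k
          + (dcomp q (y + t k *\<^sub>R V k) i z - (dcomp q y i z + d2comp q y i v w))"
        using \<open>t k \<noteq> 0\<close> by (simp add: divide_inverse_commute distrib_left)
      then show ?thesis by (simp add: divide_inverse_commute)
    qed
    ultimately show "(\<lambda>k. (r k /\<^sub>R t k) $ i) \<longlonglongrightarrow> 0 $ i" by simp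
  qed
  obtain C where "\<forall>\<^sub>F k in sequentially. \<forall>r :: real^'l. \<exists>a.
     (\<forall>i\<in>I. dcomp q (y + t k *\<^sub>R V k) i a = r $ i) \<and> norm a \<le> C * norm r / t k"
    using two_regular_solvable[OF reg t V] by blast
  then have "\<forall>\<^sub>F k in sequentially. \<exists>a. (\<forall>i\<in>I. dcomp q (y + t k *\<^sub>R V k) i a = r k $ i) \<and> norm a \<le> C * norm (r k) / t k"
    by (rule eventually_mono) blast
  then obtain a where a: "\<forall>\<^sub>F k in sequentially. (\<forall>i\<in>I. dcomp q (y + t k *\<^sub>R V k) i (a k) = r k $ i) \<and> norm (a k) \<le> C * norm (r k) / t k"
    by (rule choice_eventually)
  have "a \<longlonglongrightarrow> 0"
  proof (rule Lim_null_comparison)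
    show "\<forall>\<^sub>F k in sequentially. norm (a k) \<le> C * norm (r k /\<^sub>R t k)"
      using a by (rule eventually_mono) (use t(1) in \<open>simp add: divide_inverse_commute abs_of_pos mult_ac\<close>)
    show "(\<lambda>k. C * norm (r k /\<^sub>R t k)) \<longlonglongrightarrow> 0"
      using tendsto_mult_right_zero[OF tendsto_norm_zero[OF r]] by simp
  qed
  then have "(\<lambda>k. w + t k *\<^sub>R z - a k) \<longlonglongrightarrow> w - 0"
    by (intro tendsto_diff tendsto_scaleR_add[OF t(2) tendsto_const])
  moreover have "\<forall>\<^sub>F k in sequentially. w + t k *\<^sub>R z - a k \<in> index_cone q (y + t k *\<^sub>R V k) Ip I"
    using a
  proof (rule eventually_mono)
    fix k assume "(\<forall>i\<in>I. dcomp q (y + t k *\<^sub>R V k) i (a k) = r k $ i) \<and> norm (a k) \<le> C * norm (r k) / t k"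
    then have *: "dcomp q (y + t k *\<^sub>R V k) i (w + t k *\<^sub>R z - a k)
        = dcomp q y i w + t k * (dcomp q y i z + d2comp q y i v w)" if "i \<in> I" for i
      using that by (simp add: inner_diff_right r_def)
    show "w + t k *\<^sub>R z - a k \<in> index_cone q (y + t k *\<^sub>R V k) Ip I"
      unfolding index_cone_def mem_Collect_eq
    proof (intro conjI ballI)
      fix i assume i: "i \<in> Ip"
      then show "dcomp q (y + t k *\<^sub>R V k) i (w + t k *\<^sub>R z - a k) = 0"
        using *[of i] IpI z(1)[OF i] wc(1)[OF i] by auto
    next
      fix i assume i: "i \<in> I - Ip"
      have "t k * (dcomp q y i z + d2comp q y i v w) \<le> 0"
        using z(2)[OF i] t(1)[of k] by (simp add: mult_nonneg_nonpos)
      then show "dcomp q (y + t k *\<^sub>R V k) i (w + t k *\<^sub>R z - a k) \<le> 0"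
        using *[of i] i wc(2)[OF i] by auto
    qed
  qed
  ultimately show ?thesis using that by simp
qed

end

section \<open>Regular normals to the graph at points with independent gradients\<close>

lemma lag_grad_axis: "lag_grad q y (c *\<^sub>R axis j 1) = c *\<^sub>R grad q j y"
proof -
  have "lag_grad q y (c *\<^sub>R axis j 1) = (\<Sum>i\<in>UNIV. if i = j then c *\<^sub>R grad q j y else 0)"
    by (intro sum.cong) (auto simp: axis_def)
  then show ?thesis by simp
qed

text \<open>Linear independence of the active gradients in its dual form, solvability for every
  right-hand side, which is what \<open>two_regular_solvable\<close> delivers.\<close>

definition licq :: "(real^'m \<Rightarrow> real^'l) \<Rightarrow> real^'m \<Rightarrow> bool" where
  "licq q y \<longleftrightarrow> (\<forall>r :: real^'l. \<exists>a. \<forall>i\<in>active q y. dcomp q y i a = r $ i)"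

text \<open>With \<open>w = 0\<close> the Hessian term disappears. The results on curves and
  tangents thereby become available at such a point for every direction.\<close>

lemma licq_two_regular:
  assumes "licq q y" "J \<subseteq> active q y"
  shows "two_regular q J y v"
  unfolding two_regular_def
proof
  fix \<alpha>
  obtain a where a: "\<And>i. i \<in> active q y \<Longrightarrow> dcomp q y i a = (\<chi> i. \<alpha> i) $ i"
    using assms(1) unfolding licq_def by meson
  show "\<exists>u w. \<forall>i\<in>J. dcomp q y i u + d2comp q y i v w = \<alpha> i \<and> dcomp q y i w = 0"
    by (intro exI[of _ a] exI[of _ 0]) (use a assms(2) in auto)
qed

lemma index_family_subset_active: "J \<in> index_family q y v \<Longrightarrow> J \<subseteq> active q y"
  by (auto simp: index_family_def second_order_active_def active_dir_def)

context twice_differentiable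
begin

text \<open>Vertical tangents exist along the gradient of any active constraint, and with both signs
  where \<open>lam $ i > 0\<close>; testing the normal with them gives the inequalities and the
  equalities.\<close>

lemma normal_in_index_cone:
  assumes y: "y \<in> feasible q" and lam: "lam \<in> multiplier_cone q y"
    and n: "(ws, w) \<in> regular_normal_cone (normal_graph q) (y, lag_grad q y lam)"
  shows "w \<in> index_cone q y {i. lam $ i > 0} (active q y)"
proof -
  have polar: "w \<bullet> b \<le> 0" if "(0, b) \<in> contingent_cone (normal_graph q) (y, lag_grad q y lam)" for b
    using n that by (force simp: regular_normal_cone_def neg_polar_def split: if_splits)
  have le: "c * dcomp q y i w \<le> 0" if i: "i \<in> active q y" "c \<ge> 0 \<or> lam $ i > 0" for i c
  proof -
    have "(0, lag_grad q y (c *\<^sub>R axis i 1)) \<in> contingent_cone (normal_graph q) (y, lag_grad q y lam)"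
      by (rule graph_tangent_vertical[OF y lam]) (use i in \<open>auto simp: axis_def\<close>)
    from polar[OF this] show ?thesis unfolding lag_grad_axis by (simp add: inner_commute)
  qed
  have "dcomp q y i w = 0" if "lam $ i > 0" for i
    using le[of i 1] le[of i "-1"] multiplier_cone_active[OF lam, of i] that by simp
  then show ?thesis using le[of _ 1] by (auto simp: index_cone_def)
qed

text \<open>Independent gradients allow a \<open>z\<close> that makes all active second-order
  expressions for \<open>u\<close> vanish. So each \<open>u\<close> in the cone gives a graph
  tangent, and symmetry of the Hessian moves it over to \<open>w\<close>.\<close>

lemma licq_normal_subset:
  assumes y: "y \<in> feasible q" and lam: "lam \<in> multiplier_cone q y" and licq: "licq q y"
    and n: "(ws, w) \<in> regular_normal_cone (normal_graph q) (y, lag_grad q y lam)"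
  shows "ws + lag_hessian q y lam *v w \<in> neg_polar (index_cone q y {i. lam $ i > 0} (active q y))"
  unfolding neg_polar_def mem_Collect_eq
proof
  fix u assume u: "u \<in> index_cone q y {i. lam $ i > 0} (active q y)"
  have lin: "dcomp q y i u \<le> 0" if "i \<in> active q y" for i
    using u that by (cases "lam $ i > 0") (auto simp: index_cone_def)
  obtain z where "\<And>i. i \<in> active q y \<Longrightarrow> dcomp q y i z = (\<chi> i. - d2comp q y i u u) $ i"
    using licq unfolding licq_def by meson
  then have z: "\<And>i. i \<in> active q y \<Longrightarrow> dcomp q y i z + d2comp q y i u u = 0" by simp
  have "(u, lag_hessian q y lam *v u) \<in> contingent_cone (normal_graph q) (y, lag_grad q y lam)"
  proof (rule graph_tangent_direction[OF y lin _ lam])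
    show "z \<in> second_order_set q y u" using z by (simp add: second_order_set_def)
    show "{i. lam $ i > 0} \<subseteq> second_order_active q y u z"
      using z u multiplier_cone_active[OF lam]
      by (force simp: second_order_active_def active_dir_def index_cone_def)
    show "two_regular q J y u" if "maximal_in (index_family q y u) J" for J
      using that index_family_subset_active[of J q y u]
      by (intro licq_two_regular[OF licq]) (simp add: maximal_in_def)
  qed
  then have "(ws, w) \<bullet> (u, lag_hessian q y lam *v u) \<le> 0"
    using n by (force simp: regular_normal_cone_def neg_polar_def split: if_splits)
  then show "(ws + lag_hessian q y lam *v w) \<bullet> u \<le> 0"
    using lag_hessian_commute[where a = w and b = u] by (simp add: inner_add_left inner_add_right inner_commute)
qed

text \<open>Here tangents have to be estimated rather than constructed. A tangent
  \<open>(a, b)\<close> comes with multipliers \<open>l k\<close> at nearby points, and independence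
  of the gradients bounds the quotients \<open>d k\<close>. This puts \<open>a\<close> into the
  critical cone and makes the product of \<open>b - lag_hessian q y lam *v a\<close> with
  \<open>w\<close> nonpositive.\<close>

lemma licq_normal_supset:
  assumes y: "y \<in> feasible q" and lam: "lam \<in> multiplier_cone q y" and licq: "licq q y"
    and N: "open N" "y \<in> N"
      "\<And>y' ys. y' \<in> N \<Longrightarrow> ys \<in> regular_normal_cone (feasible q) y' \<Longrightarrow>
         \<exists>lam\<in>multiplier_cone q y'. ys = lag_grad q y' lam"
    and w: "w \<in> index_cone q y {i. lam $ i > 0} (active q y)"
    and ws: "ws + lag_hessian q y lam *v w \<in> neg_polar (index_cone q y {i. lam $ i > 0} (active q y))"
  shows "(ws, w) \<in> regular_normal_cone (normal_graph q) (y, lag_grad q y lam)"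
proof -
  have "(ws, w) \<bullet> (a, b) \<le> 0" if ab: "(a, b) \<in> contingent_cone (normal_graph q) (y, lag_grad q y lam)" for a b
  proof -
    obtain t X where t: "\<And>k. t k > 0" "t \<longlonglongrightarrow> (0::real)" and X: "X \<longlonglongrightarrow> (a, b)"
      "\<And>k. (y, lag_grad q y lam) + t k *\<^sub>R X k \<in> normal_graph q"
      using ab unfolding contingent_cone_def by blast
    define u where "u k = fst (X k)" for k
    define s where "s k = snd (X k)" for k
    define yk where "yk k = y + t k *\<^sub>R u k" for k
    have u: "u \<longlonglongrightarrow> a" and s: "s \<longlonglongrightarrow> b"
      unfolding u_def s_def using tendsto_fst[OF X(1)] tendsto_snd[OF X(1)] by simp_all
    have yk_lim: "yk \<longlonglongrightarrow> y" unfolding yk_def by (rule tendsto_scaleR_add[OF t(2) u])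
    have nk: "lag_grad q y lam + t k *\<^sub>R s k \<in> regular_normal_cone (feasible q) (yk k)" for k
      using X(2)[of k] unfolding u_def s_def yk_def gph_def
      by (cases "X k") simp
    have ykf: "yk k \<in> feasible q" for k
      using nk[of k] by (auto simp: regular_normal_cone_def split: if_splits)
    have "\<forall>\<^sub>F k in sequentially. yk k \<in> N" using yk_lim N(1,2) by (rule topological_tendstoD)
    then have "\<forall>\<^sub>F k in sequentially. \<exists>l. l \<in> multiplier_cone q (yk k) \<and> lag_grad q y lam + t k *\<^sub>R s k = lag_grad q (yk k) l"
      by (rule eventually_mono) (use N(3) nk in blast)
    then obtain l where "\<forall>\<^sub>F k in sequentially. l k \<in> multiplier_cone q (yk k) \<and> lag_grad q y lam + t k *\<^sub>R s k = lag_grad q (yk k) (l k)"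
      by (rule choice_eventually)
    then have l: "\<forall>\<^sub>F k in sequentially. l k \<in> multiplier_cone q (yk k) \<and>
        lag_grad q y lam + t k *\<^sub>R s k = lag_grad q (yk k) (l k) \<and> active q (yk k) \<subseteq> active q y"
      using eventually_active_subset[OF yk_lim y] by eventually_elim blast
    define d where "d k = (l k - lam) /\<^sub>R t k" for k
    \<comment> \<open>The part of \<open>s k\<close> due to the change of the multiplier, after the
      change of the gradients has been removed; it equals
      \<open>lag_grad q (yk k) (d k)\<close>.\<close>
    define m where "m k = s k - (\<Sum>i\<in>UNIV. lam $ i *\<^sub>R ((grad q i (yk k) - grad q i y) /\<^sub>R t k))" for k
    have m: "m \<longlonglongrightarrow> b - lag_hessian q y lam *v a"
      unfolding m_def lag_hessian_mult yk_def
      by (intro tendsto_intros s difference_quotient[OF has_hess t u])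
    have md: "m k = lag_grad q (yk k) (d k)" if "lag_grad q y lam + t k *\<^sub>R s k = lag_grad q (yk k) (l k)" for k
    proof -
      have "t k \<noteq> 0" using t(1)[of k] by simp
      then have 1: "t k *\<^sub>R (\<Sum>i\<in>UNIV. lam $ i *\<^sub>R ((grad q i (yk k) - grad q i y) /\<^sub>R t k))
          = lag_grad q (yk k) lam - lag_grad q y lam"
        unfolding scaleR_sum_right sum_subtractf[symmetric]
        by (intro sum.cong) (auto simp: scaleR_diff_right field_simps)
      have td: "t k * d k $ i = l k $ i - lam $ i" for i using \<open>t k \<noteq> 0\<close> by (simp add: d_def)
      have "t k *\<^sub>R lag_grad q (yk k) (d k) = lag_grad q (yk k) (l k) - lag_grad q (yk k) lam"
        unfolding scaleR_sum_right sum_subtractf[symmetric]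
        by (intro sum.cong) (simp_all add: td scaleR_diff_left)
      also have "\<dots> = t k *\<^sub>R m k"
        by (simp only: m_def scaleR_diff_right[of "t k" "s k"] 1 that[symmetric])
           (simp only: diff_diff_eq2 add_diff_eq diff_add_eq add.commute)
      finally show ?thesis using \<open>t k \<noteq> 0\<close> by simp
    qed
    \<comment> \<open>For direction 0 the Hessian term vanishes, so \<open>U\<close> is a right
      inverse of the active gradients at \<open>y\<close>.\<close>
    obtain U W :: "real^'l \<Rightarrow> real^'m" where UW: "bounded_linear U" "bounded_linear W"
      "\<And>i b. i \<in> active q y \<Longrightarrow> dcomp q y i (W b) = 0"
      "\<And>i b. i \<in> active q y \<Longrightarrow> dcomp q y i (U b) + d2comp q y i 0 (W b) = b $ i"
      using two_regular_linear[OF licq_two_regular[OF licq order_refl, where v = 0]] by metis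
    obtain C where C: "C \<ge> 0" "\<And>b. norm (U b) \<le> norm b * C"
      using bounded_linear.nonneg_bounded[OF UW(1)] by blast
    define \<epsilon> where "\<epsilon> k = (\<Sum>i\<in>UNIV. norm (grad q i (yk k) - grad q i y))" for k
    have "(\<lambda>k. \<epsilon> k * C) \<longlonglongrightarrow> (\<Sum>i\<in>UNIV. norm (grad q i y - grad q i y)) * C"
      unfolding \<epsilon>_def by (intro tendsto_intros tendsto_grad yk_lim)
    then have \<epsilon>: "\<forall>\<^sub>F k in sequentially. \<epsilon> k * C < 1 / 2"
      by (intro order_tendstoD(2)[where y = "(\<Sum>i\<in>UNIV. norm (grad q i y - grad q i y)) * C"]) simp_all
    obtain Mm where Mm: "\<And>k. norm (m k) \<le> Mm"
      using convergent_imp_bounded[OF m] by (auto simp: bounded_iff)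
    define D where "D = 2 * C * Mm"
    have dz: "d k $ i = 0" if "l k \<in> multiplier_cone q (yk k)" "active q (yk k) \<subseteq> active q y" "i \<notin> active q y" for k i
    proof -
      have "l k $ i = 0" using multiplier_cone_active[OF that(1), of i] that(2,3) by blast
      moreover have "lam $ i = 0" using multiplier_cone_active[OF lam, of i] that(3) by blast
      ultimately show ?thesis by (simp add: d_def)
    qed
    \<comment> \<open>Testing \<open>lag_grad q y (d k)\<close> with \<open>U (d k)\<close>
      reproduces the squared norm of \<open>d k\<close>; the error from the gradients at
      \<open>yk k\<close> is absorbed because \<open>\<epsilon> k * C < 1 / 2\<close>.\<close>
    have dD: "\<forall>\<^sub>F k in sequentially. norm (d k) \<le> D"
      using l \<epsilon>
    proof eventually_elim
      case (elim k)
      have "(norm (d k))\<^sup>2 = lag_grad q y (d k) \<bullet> U (d k)"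
      proof -
        have "(norm (d k))\<^sup>2 = (\<Sum>i\<in>UNIV. d k $ i * d k $ i)" by (simp add: power2_norm_eq_inner inner_vec_def)
        also have "\<dots> = (\<Sum>i\<in>UNIV. d k $ i * dcomp q y i (U (d k)))"
        proof (rule sum.cong)
          fix i
          show "d k $ i * d k $ i = d k $ i * dcomp q y i (U (d k))"
            using UW(4)[of i "d k"] dz[of k i] elim by (cases "i \<in> active q y") auto
        qed simp
        finally show ?thesis unfolding inner_sum_scaleR .
      qed
      also have "\<dots> = m k \<bullet> U (d k) - (\<Sum>i\<in>UNIV. d k $ i *\<^sub>R (grad q i (yk k) - grad q i y)) \<bullet> U (d k)"
        using md[of k] elim by (simp add: scaleR_diff_right sum_subtractf inner_diff_left)
      also have "\<dots> \<le> Mm * (norm (d k) * C) + (norm (d k) * \<epsilon> k) * (norm (d k) * C)"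
      proof -
        have "m k \<bullet> U (d k) \<le> norm (m k) * norm (U (d k))" by (rule norm_cauchy_schwarz)
        also have "\<dots> \<le> Mm * (norm (d k) * C)"
          using Mm[of k] C order_trans[OF norm_ge_zero Mm] by (intro mult_mono) auto
        finally have 1: "m k \<bullet> U (d k) \<le> Mm * (norm (d k) * C)" .
        let ?e = "\<Sum>i\<in>UNIV. d k $ i *\<^sub>R (grad q i (yk k) - grad q i y)"
        have "norm ?e \<le> (\<Sum>i\<in>UNIV. norm (d k) * norm (grad q i (yk k) - grad q i y))"
        proof (rule order_trans[OF norm_sum], rule sum_mono)
          fix i
          show "norm (d k $ i *\<^sub>R (grad q i (yk k) - grad q i y)) \<le> norm (d k) * norm (grad q i (yk k) - grad q i y)"
            using component_le_norm_cart[of "d k" i] by (simp add: mult_right_mono)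
        qed
        then have e: "norm ?e \<le> norm (d k) * \<epsilon> k" by (simp add: \<epsilon>_def sum_distrib_left)
        have "- (?e \<bullet> U (d k)) \<le> norm ?e * norm (U (d k))"
          using norm_cauchy_schwarz[of "- ?e" "U (d k)"] by simp
        also have "\<dots> \<le> (norm (d k) * \<epsilon> k) * (norm (d k) * C)"
          using e C(2) order_trans[OF norm_ge_zero e] by (intro mult_mono) auto
        finally show ?thesis using 1 by linarith
      qed
      also have "(norm (d k) * \<epsilon> k) * (norm (d k) * C) \<le> (norm (d k))\<^sup>2 * (1 / 2)"
        using mult_left_mono[of "\<epsilon> k * C" "1 / 2" "(norm (d k))\<^sup>2"] elim by (simp add: power2_eq_square mult_ac)
      finally have "norm (d k) * norm (d k) \<le> norm (d k) * D"
        by (simp add: power2_eq_square D_def algebra_simps)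
      moreover have "D \<ge> 0" using C(1) order_trans[OF norm_ge_zero Mm] by (simp add: D_def)
      ultimately show ?case by (cases "d k = 0") auto
    qed
    \<comment> \<open>Since \<open>d k\<close> is bounded, \<open>l k\<close> stays positive where
      \<open>lam\<close> is, so these constraints remain active along the sequence.\<close>
    have aP: "dcomp q y i a = 0" if i: "lam $ i > 0" for i
    proof -
      have ia: "q y $ i = 0" using multiplier_cone_active[OF lam, of i] i by (simp add: active_def)
      have "(\<lambda>k. t k * D) \<longlonglongrightarrow> 0" using tendsto_mult_left_zero[OF t(2)] by simp
      then have "\<forall>\<^sub>F k in sequentially. t k * D < lam $ i" using i by (rule order_tendstoD)
      then have "\<forall>\<^sub>F k in sequentially. (q (y + t k *\<^sub>R u k) $ i - q y $ i) /\<^sub>R t k = 0"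
        using l dD
      proof eventually_elim
        case (elim k)
        have "t k \<noteq> 0" using t(1)[of k] by simp
        then have "t k *\<^sub>R d k = l k - lam" by (simp add: d_def)
        then have "l k $ i = lam $ i + t k * d k $ i" by (simp add: vec_eq_iff)
        moreover have "- (t k * d k $ i) \<le> t k * D"
        proof -
          have "- d k $ i \<le> D" using component_le_norm_cart[of "d k" i] elim by linarith
          then have "t k * (- d k $ i) \<le> t k * D" using t(1)[of k] by (intro mult_left_mono) auto
          then show ?thesis by simp
        qed
        ultimately have "l k $ i \<noteq> 0" using elim by linarith
        then have "i \<in> active q (yk k)" using multiplier_cone_active elim by blast
        then show ?case using ia by (simp add: active_def yk_def)
      qed
      then have "(\<lambda>k. (q (y + t k *\<^sub>R u k) $ i - q y $ i) /\<^sub>R t k) \<longlonglongrightarrow> 0" by (rule tendsto_eventually)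
      with difference_quotient[OF has_grad[of i y] t u] show ?thesis using LIMSEQ_unique by blast
    qed
    have "a \<in> contingent_cone (feasible q) y"
      by (rule contingent_coneI[OF t u]) (use ykf in \<open>simp add: yk_def\<close>)
    then have aK: "a \<in> index_cone q y {i. lam $ i > 0} (active q y)"
      unfolding index_cone_def using aP contingent_cone_linearized by blast
    \<comment> \<open>The cost of replacing the gradients at \<open>yk k\<close> by those at
      \<open>y\<close>; for the latter, the signs of \<open>d k\<close> and the cone conditions on
      \<open>w\<close> give a nonpositive sum.\<close>
    define e where "e k = D * (\<Sum>i\<in>UNIV. \<bar>dcomp q (yk k) i w - dcomp q y i w\<bar>)" for k
    have "e \<longlonglongrightarrow> D * (\<Sum>i\<in>UNIV. \<bar>dcomp q y i w - dcomp q y i w\<bar>)"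
      unfolding e_def by (intro tendsto_intros tendsto_grad yk_lim)
    then have e: "e \<longlonglongrightarrow> 0" by simp
    have "\<forall>\<^sub>F k in sequentially. m k \<bullet> w \<le> e k"
      using l dD
    proof eventually_elim
      case (elim k)
      have "m k \<bullet> w = (\<Sum>i\<in>UNIV. d k $ i * dcomp q (yk k) i w)"
        using md[of k] elim by (simp add: inner_sum_scaleR)
      also have "\<dots> = (\<Sum>i\<in>UNIV. d k $ i * dcomp q y i w) + (\<Sum>i\<in>UNIV. d k $ i * (dcomp q (yk k) i w - dcomp q y i w))"
        by (simp add: sum.distrib[symmetric] algebra_simps)
      also have "\<dots> \<le> 0 + e k"
      proof (rule add_mono)
        show "(\<Sum>i\<in>UNIV. d k $ i * dcomp q y i w) \<le> 0"
        proof (rule sum_nonpos_of_signs[of "active q y" "d k" "{i. lam $ i > 0}"])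
          show "d k $ i = 0" if "i \<notin> active q y" for i using dz[of k i] elim that by blast
          show "d k $ i \<ge> 0" if "i \<in> active q y - {i. lam $ i > 0}" for i
          proof -
            have "lam $ i = 0" using lam that by (auto simp: multiplier_cone_def order_less_le)
            moreover have "l k $ i \<ge> 0" using elim by (simp add: multiplier_cone_def)
            ultimately show ?thesis using t(1)[of k] by (simp add: d_def)
          qed
        qed (use w in \<open>auto simp: index_cone_def\<close>)
        have "d k $ i * (dcomp q (yk k) i w - dcomp q y i w) \<le> D * \<bar>dcomp q (yk k) i w - dcomp q y i w\<bar>" for i
        proof -
          have "\<bar>d k $ i\<bar> \<le> D" using component_le_norm_cart[of "d k" i] elim by linarith
          then have "\<bar>d k $ i\<bar> * \<bar>dcomp q (yk k) i w - dcomp q y i w\<bar> \<le> D * \<bar>dcomp q (yk k) i w - dcomp q y i w\<bar>"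
            by (rule mult_right_mono) simp
          then show ?thesis
            using abs_ge_self[of "d k $ i * (dcomp q (yk k) i w - dcomp q y i w)"] unfolding abs_mult
            by (rule order_trans[rotated])
        qed
        then show "(\<Sum>i\<in>UNIV. d k $ i * (dcomp q (yk k) i w - dcomp q y i w)) \<le> e k"
          unfolding e_def sum_distrib_left by (rule sum_mono)
      qed
      finally show ?case by simp
    qed
    then have "(b - lag_hessian q y lam *v a) \<bullet> w \<le> 0"
      using tendsto_le[OF sequentially_bot e tendsto_inner[OF m tendsto_const]] by blast
    moreover have "(ws + lag_hessian q y lam *v w) \<bullet> a \<le> 0" using ws aK by (simp add: neg_polar_def)
    ultimately show ?thesis
      using lag_hessian_commute[where a = w and b = a] by (simp add: inner_diff_left inner_diff_right inner_add_left inner_add_right inner_commute)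
  qed
  moreover have "(y, lag_grad q y lam) \<in> normal_graph q" by (rule lag_grad_in_graph[OF y lam])
  ultimately show ?thesis by (auto simp: regular_normal_cone_def neg_polar_def)
qed

end

section \<open>Limiting normals\<close>

text \<open>Graph points and normals are collected jointly, so that limiting normals become a
  closure in the product space and successive approximations compose without diagonal
  sequences.\<close>

definition punctured_normals ::
    "(real^'m \<Rightarrow> real^'l) \<Rightarrow> real^'m \<Rightarrow> (((real^'m) \<times> (real^'m)) \<times> ((real^'m) \<times> (real^'m))) set" where
  "punctured_normals q y0 =
     {((y, ys), n). y \<noteq> y0 \<and> n \<in> regular_normal_cone (normal_graph q) (y, ys)}"

lemma lag_grad_inner_eq_0D:
  fixes q :: "real^'m \<Rightarrow> real^'l"
  assumes lam: "lam \<in> multiplier_cone q y" and u: "\<And>i. i \<in> active q y \<Longrightarrow> dcomp q y i u \<le> 0"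
    and 0: "lag_grad q y lam \<bullet> u = 0" and i: "lam $ i > 0"
  shows "dcomp q y i u = 0"
proof -
  have "(\<Sum>i\<in>UNIV. - (lam $ i * dcomp q y i u)) = 0"
    using 0 by (simp add: inner_sum_scaleR sum_negf)
  moreover have "0 \<le> - (lam $ i * dcomp q y i u)" for i
    using lam u[of i] multiplier_cone_active[OF lam, of i] by (cases "lam $ i = 0") (auto simp: multiplier_cone_def mult_nonneg_nonpos)
  ultimately have "- (lam $ i * dcomp q y i u) = 0"
    by (subst (asm) sum_nonneg_eq_0_iff) auto
  with i show ?thesis by simp
qed

section \<open>Directional multipliers and linear programming duality\<close>

context twice_differentiable
begin

lemma tendsto_lag_grad:
  assumes "lamk \<longlonglongrightarrow> lam" "yk \<longlonglongrightarrow> y"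
  shows "(\<lambda>k. lag_grad q (yk k) (lamk k)) \<longlonglongrightarrow> lag_grad q y lam"
  by (intro tendsto_intros tendsto_grad assms)

lemma multipliers_iff: "lam \<in> multipliers q y ys \<longleftrightarrow> lam \<in> multiplier_cone q y \<and> lag_grad q y lam = ys"
  by (simp only: multipliers_def mem_Collect_eq transpose_jacobian_mult)

lemma lag_hessian_inner: "a \<bullet> (lag_hessian q y lam *v b) = (\<Sum>i\<in>UNIV. lam $ i * d2comp q y i a b)"
  by (simp add: lag_hessian_mult inner_sum_right)

text \<open>This is the duality gap of the program that maximises
  \<open>v \<bullet> (lag_hessian q y lam *v v)\<close> over the multipliers, whose dual variable is
  the second-order vector \<open>z\<close>.\<close>

lemma second_order_value:
  assumes "lam \<in> multipliers q y ys"
  shows "(\<Sum>i\<in>UNIV. lam $ i * (dcomp q y i z + d2comp q y i v v)) = ys \<bullet> z + v \<bullet> (lag_hessian q y lam *v v)"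
proof -
  have "ys = lag_grad q y lam" using assms by (simp add: multipliers_iff)
  then show ?thesis by (simp add: lag_hessian_inner inner_sum_scaleR distrib_left sum.distrib)
qed

lemma second_order_value_nonpos:
  assumes lam: "lam \<in> multipliers q y ys" and z: "z \<in> second_order_set q y v"
  shows "lam $ i * (dcomp q y i z + d2comp q y i v v) \<le> 0"
  using lam z multiplier_cone_active[of lam q y i]
  by (cases "lam $ i = 0") (auto simp: multipliers_iff multiplier_cone_def second_order_set_def mult_nonneg_nonpos)

text \<open>Weak duality: a second-order point \<open>z\<close> bounds the objective of every
  multiplier by \<open>- (ys \<bullet> z)\<close>, and complementarity means that \<open>lam\<close>
  attains this bound.\<close>

lemma dir_multipliersI:
  assumes lam: "lam \<in> multipliers q y ys" and z: "z \<in> second_order_set q y v"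
    and comp: "\<And>i. lam $ i > 0 \<Longrightarrow> dcomp q y i z + d2comp q y i v v = 0"
  shows "lam \<in> dir_multipliers q y ys v"
  unfolding dir_multipliers_def mem_Collect_eq
proof (intro conjI ballI)
  fix lam' assume lam': "lam' \<in> multipliers q y ys"
  have "lam $ i * (dcomp q y i z + d2comp q y i v v) = 0" for i
    using lam comp[of i] by (cases "lam $ i = 0") (auto simp: multipliers_iff multiplier_cone_def order_less_le)
  then have "ys \<bullet> z + v \<bullet> (lag_hessian q y lam *v v) = 0"
    unfolding second_order_value[OF lam, symmetric] by (intro sum.neutral ballI)
  moreover have "ys \<bullet> z + v \<bullet> (lag_hessian q y lam' *v v) \<le> 0"
    unfolding second_order_value[OF lam', symmetric]
    by (rule sum_nonpos) (rule second_order_value_nonpos[OF lam' z])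
  ultimately show "v \<bullet> (lag_hessian q y lam' *v v) \<le> v \<bullet> (lag_hessian q y lam *v v)" by simp
qed (rule lam)

text \<open>The complementary pair \<open>lam'\<close>, \<open>z\<close> has no duality gap, and
  \<open>lam\<close> does at least as well as \<open>lam'\<close>. Its gap is a sum of terms of one
  sign, so each of them vanishes.\<close>

lemma dir_multipliers_complementary:
  assumes lam: "lam \<in> dir_multipliers q y ys v" and z: "z \<in> second_order_set q y v"
    and lam': "lam' \<in> multipliers q y ys"
    and comp: "\<And>i. lam' $ i > 0 \<Longrightarrow> dcomp q y i z + d2comp q y i v v = 0" and i: "lam $ i > 0"
  shows "dcomp q y i z + d2comp q y i v v = 0"
proof -
  have l: "lam \<in> multipliers q y ys" using lam by (simp add: dir_multipliers_def)
  have "lam' $ i * (dcomp q y i z + d2comp q y i v v) = 0" for i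
    using lam' comp[of i] by (cases "lam' $ i = 0") (auto simp: multipliers_iff multiplier_cone_def order_less_le)
  then have "ys \<bullet> z + v \<bullet> (lag_hessian q y lam' *v v) = 0"
    unfolding second_order_value[OF lam', symmetric] by (intro sum.neutral ballI)
  moreover have "v \<bullet> (lag_hessian q y lam' *v v) \<le> v \<bullet> (lag_hessian q y lam *v v)"
    using lam lam' by (simp add: dir_multipliers_def)
  ultimately have "(\<Sum>i\<in>UNIV. - (lam $ i * (dcomp q y i z + d2comp q y i v v))) \<le> 0"
    using second_order_value[OF l, of z v] by (simp add: sum_negf)
  moreover have "0 \<le> - (lam $ i * (dcomp q y i z + d2comp q y i v v))" for i
    using second_order_value_nonpos[OF l z, of i] by simp
  ultimately have "(\<Sum>i\<in>UNIV. - (lam $ i * (dcomp q y i z + d2comp q y i v v))) = 0"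
    by (simp add: order_antisym sum_nonneg)
  then have "- (lam $ i * (dcomp q y i z + d2comp q y i v v)) = 0"
    using \<open>\<And>i. 0 \<le> - (lam $ i * (dcomp q y i z + d2comp q y i v v))\<close>
    by (subst (asm) sum_nonneg_eq_0_iff) auto
  with i show ?thesis by simp
qed

end

section \<open>Normals approached through base points other than the reference point\<close>

locale regular_vicinity = twice_differentiable q for q :: "real^'m \<Rightarrow> real^'l" +
  fixes ybar :: "real^'m" and N :: "(real^'m) set" and \<kappa> :: real
  assumes feasible_base: "ybar \<in> feasible q"
    and N: "open N" "ybar \<in> N"
    and regular: "\<And>y. y \<in> feasible q \<Longrightarrow> y \<in> N \<Longrightarrow> y \<noteq> ybar \<Longrightarrow>
       metrically_regular_near (constraint_mf q) \<kappa> y 0"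
begin

lemma normal_multiplier:
  assumes "y \<in> N" "y \<noteq> ybar" and ys: "ys \<in> regular_normal_cone (feasible q) y"
  obtains lam where "lam \<in> multiplier_cone q y" "ys = lag_grad q y lam" "norm lam \<le> \<kappa> * norm ys"
proof -
  have y: "y \<in> feasible q" using ys by (auto simp: regular_normal_cone_def split: if_splits)
  note reg = regular[OF y assms(1,2)]
  obtain lam where "lam \<in> multiplier_cone q y" "ys = lag_grad q y lam"
    using subregular_normal_multiplier[OF metrically_regular_imp_subregular[OF reg] ys] by blast
  with regular_multiplier_bound[OF reg y] that show ?thesis by blast
qed

text \<open>Along a curve with active set \<open>I\<close> the gradients are eventually independent,
  so \<open>licq_normal_supset\<close> yields normals there. The inner limit of the index cones
  supplies the approximations \<open>W\<close> of \<open>w\<close>; the outer limit, through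
  \<open>neg_polar_limit\<close>, supplies polar vectors \<open>M\<close> from which
  \<open>ws\<close> is recovered.\<close>

lemma Q_set_subset_closure:
  assumes v: "v \<noteq> 0" "\<And>i. i \<in> active q ybar \<Longrightarrow> dcomp q ybar i v \<le> 0"
    and reg: "\<And>J. maximal_in (index_family q ybar v) J \<Longrightarrow> two_regular q J ybar v"
    and z: "z \<in> second_order_set q ybar v" and I: "Ip \<subseteq> I" "I \<subseteq> second_order_active q ybar v z"
    and lam: "lam \<in> multiplier_cone q ybar" "{i. lam $ i > 0} \<subseteq> Ip"
    and Q: "(ws, w) \<in> Q_set q ybar v lam Ip I"
  shows "((ybar, lag_grad q ybar lam), (ws, w)) \<in> closure (punctured_normals q ybar)"
proof -
  have "second_order_active q ybar v z \<in> index_family q ybar v" using z by (simp add: index_family_def)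
  then obtain J where J: "maximal_in (index_family q ybar v) J" "second_order_active q ybar v z \<subseteq> J"
    using exists_maximal_in[of "index_family q ybar v"] by auto
  obtain t V where t: "\<And>k. t k > 0" "t \<longlonglongrightarrow> (0::real)" and V: "V \<longlonglongrightarrow> v"
    and f: "\<And>k. ybar + t k *\<^sub>R V k \<in> feasible q" and act: "\<And>k. active q (ybar + t k *\<^sub>R V k) = I"
    using curve[OF feasible_base v(2) J(1) reg[OF J(1)] z I(2) J(2)] by blast
  have regI: "two_regular q I ybar v" using two_regular_mono[OF reg[OF J(1)]] I(2) J(2) by blast
  define yk where "yk k = ybar + t k *\<^sub>R V k" for k
  have y_lim: "yk \<longlonglongrightarrow> ybar" unfolding yk_def by (rule tendsto_scaleR_add[OF t(2) V])
  \<comment> \<open>Adding a small multiple of the indicator of \<open>Ip\<close> makes the positive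
    indices of the multiplier at the curve points exactly \<open>Ip\<close>.\<close>
  define e :: "real^'l" where "e = (\<chi> i. if i \<in> Ip then 1 else 0)"
  define lamk where "lamk k = lam + t k *\<^sub>R e" for k
  have lamk_lim: "lamk \<longlonglongrightarrow> lam" unfolding lamk_def by (rule tendsto_scaleR_add[OF t(2) tendsto_const])
  have lam0: "lam $ i = 0" if "i \<notin> Ip" for i
    using lam that by (force simp: multiplier_cone_def order_less_le)
  have posk: "{i. lamk k $ i > 0} = Ip" for k
    using t(1)[of k] lam(1) lam0 by (auto simp: lamk_def e_def multiplier_cone_def add_nonneg_pos)
  have lamk: "lamk k \<in> multiplier_cone q (yk k)" for k
    using lam(1) lam0 t(1)[of k] I(1) act[of k]
    by (auto simp: multiplier_cone_iff lamk_def e_def yk_def multiplier_cone_def less_imp_le)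
  have w: "w \<in> index_cone_dir q ybar Ip I v"
    and n: "ws + lag_hessian q ybar lam *v w \<in> neg_polar (index_cone_dir q ybar Ip I v)"
    using Q by (auto simp: Q_set_def)
  obtain W where W: "W \<longlonglongrightarrow> w" "\<forall>\<^sub>F k in sequentially. W k \<in> index_cone q (yk k) Ip I"
    using index_cone_inner_limit[OF regI t V I(1) w] unfolding yk_def by blast
  have "\<exists>M. M \<longlonglongrightarrow> ws + lag_hessian q ybar lam *v w \<and> (\<forall>k. M k \<in> neg_polar (index_cone q (yk k) Ip I))"
  proof (rule neg_polar_limit[of "\<lambda>k. index_cone q (yk k) Ip I", OF closed_index_cone convex_cone_index_cone _ n])
    fix r :: "nat \<Rightarrow> nat" and u u0
    assume r: "strict_mono r" and u: "\<And>k. u k \<in> index_cone q (yk (r k)) Ip I" "u \<longlonglongrightarrow> u0"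
    show "u0 \<in> index_cone_dir q ybar Ip I v"
    proof (rule index_cone_outer_limit[OF _ _ _ u(2) I(1)])
      show "(\<lambda>k. t (r k)) \<longlonglongrightarrow> 0" "(\<lambda>k. V (r k)) \<longlonglongrightarrow> v"
        using LIMSEQ_subseq_LIMSEQ[OF t(2) r] LIMSEQ_subseq_LIMSEQ[OF V r] by (simp_all add: o_def)
    qed (use t u(1) in \<open>simp_all add: yk_def\<close>)
  qed blast
  then obtain M where M: "M \<longlonglongrightarrow> ws + lag_hessian q ybar lam *v w"
    "\<And>k. M k \<in> neg_polar (index_cone q (yk k) Ip I)" by blast
  define X where "X k = ((yk k, lag_grad q (yk k) (lamk k)), (M k - lag_hessian q (yk k) (lamk k) *v W k, W k))" for k
  have "X \<longlonglongrightarrow> ((ybar, lag_grad q ybar lam), (ws + lag_hessian q ybar lam *v w - lag_hessian q ybar lam *v w, w))"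
    unfolding X_def
    by (intro tendsto_Pair y_lim tendsto_lag_grad lamk_lim tendsto_diff M W lag_hessian_tendsto)
  then have X_lim: "X \<longlonglongrightarrow> ((ybar, lag_grad q ybar lam), (ws, w))" by simp
  obtain C where "\<forall>\<^sub>F k in sequentially. \<forall>r :: real^'l. \<exists>a.
     (\<forall>i\<in>I. dcomp q (ybar + t k *\<^sub>R V k) i a = r $ i) \<and> norm a \<le> C * norm r / t k"
    using two_regular_solvable[OF regI t V] by blast
  then have licq: "\<forall>\<^sub>F k in sequentially. licq q (yk k)"
    unfolding licq_def yk_def act by (rule eventually_mono) blast
  have V0: "\<forall>\<^sub>F k in sequentially. V k \<noteq> 0" using V v(1) by (rule tendsto_imp_eventually_ne)
  have "\<forall>\<^sub>F k in sequentially. yk k \<in> N" using y_lim N by (rule topological_tendstoD)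
  with licq V0 W(2) have "\<forall>\<^sub>F k in sequentially. X k \<in> punctured_normals q ybar"
  proof eventually_elim
    case (elim k)
    have ne: "yk k \<noteq> ybar" using elim t(1)[of k] by (simp add: yk_def)
    have "(M k - lag_hessian q (yk k) (lamk k) *v W k, W k)
        \<in> regular_normal_cone (normal_graph q) (yk k, lag_grad q (yk k) (lamk k))"
    proof (rule licq_normal_supset[of "yk k" "lamk k" "N - {ybar}"])
      show "yk k \<in> feasible q" using f by (simp add: yk_def)
      show "\<exists>lam\<in>multiplier_cone q y'. ys = lag_grad q y' lam"
        if "y' \<in> N - {ybar}" "ys \<in> regular_normal_cone (feasible q) y'" for y' ys
        using normal_multiplier[of y' ys] that by blast
      show "M k - lag_hessian q (yk k) (lamk k) *v W k + lag_hessian q (yk k) (lamk k) *v W k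
          \<in> neg_polar (index_cone q (yk k) {i. lamk k $ i > 0} (active q (yk k)))"
        using M(2)[of k] posk[of k] act[of k] by (simp add: yk_def)
      show "W k \<in> index_cone q (yk k) {i. lamk k $ i > 0} (active q (yk k))"
        using elim posk[of k] act[of k] by (simp add: yk_def)
      show "open (N - {ybar})" using N by blast
    qed (use elim ne lamk in auto)
    with ne show ?case by (simp add: punctured_normals_def X_def)
  qed
  then have "\<forall>\<^sub>F k in sequentially. X k \<in> closure (punctured_normals q ybar)"
    by (rule eventually_mono) (use closure_subset in blast)
  from Lim_in_closed_set[OF closed_closure this sequentially_bot X_lim] show ?thesis .
qed

text \<open>Multipliers at the approaching points are bounded by regularity. On a subsequence the
  active set and the support of the multiplier are constant; they become \<open>I\<close> and
  \<open>Ip\<close>, and \<open>J\<close> is the second-order active set of a limiting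
  \<open>z\<close>.\<close>

lemma closure_normal_cases:
  assumes cl: "((ybar, ystar), (ws, w)) \<in> closure (punctured_normals q ybar)"
    and reg: "\<And>u J. u \<in> critical_cone q ybar ystar \<Longrightarrow> u \<noteq> 0 \<Longrightarrow>
       maximal_in (index_family q ybar u) J \<Longrightarrow> two_regular q J ybar u"
  obtains v lam J Ip I where "v \<noteq> 0"
    "(v, lag_hessian q ybar lam *v v) \<in> contingent_cone (normal_graph q) (ybar, ystar)"
    "lam \<in> dir_multipliers q ybar ystar v" "J \<in> index_family q ybar v"
    "{i. lam $ i > 0} \<subseteq> Ip" "Ip \<subseteq> I" "I \<subseteq> J" "(ws, w) \<in> Q_set q ybar v lam Ip I"
proof -
  obtain X where X: "\<And>k. X k \<in> punctured_normals q ybar" "X \<longlonglongrightarrow> ((ybar, ystar), (ws, w))"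
    using cl unfolding closure_sequential by blast
  have "(\<lambda>k. fst (fst (X k))) \<longlonglongrightarrow> ybar" using tendsto_fst[OF tendsto_fst[OF X(2)]] by simp
  then have "\<forall>\<^sub>F k in sequentially. fst (fst (X k)) \<in> N" using N by (rule topological_tendstoD)
  then obtain K where K: "\<And>k. fst (fst (X (k + K))) \<in> N"
    unfolding eventually_sequentially by (metis le_add2)
  define y where "y k = fst (fst (X (k + K)))" for k
  define ys where "ys k = snd (fst (X (k + K)))" for k
  define s where "s k = fst (snd (X (k + K)))" for k
  define wk where "wk k = snd (snd (X (k + K)))" for k
  have XK: "(\<lambda>k. X (k + K)) \<longlonglongrightarrow> ((ybar, ystar), (ws, w))" by (rule LIMSEQ_ignore_initial_segment[OF X(2)])
  have lims: "y \<longlonglongrightarrow> ybar" "ys \<longlonglongrightarrow> ystar" "s \<longlonglongrightarrow> ws" "wk \<longlonglongrightarrow> w"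
    unfolding y_def ys_def s_def wk_def
    using tendsto_fst[OF tendsto_fst[OF XK]] tendsto_snd[OF tendsto_fst[OF XK]]
      tendsto_fst[OF tendsto_snd[OF XK]] tendsto_snd[OF tendsto_snd[OF XK]] by simp_all
  have yN: "y k \<in> N" for k using K by (simp add: y_def)
  have XX: "y k \<noteq> ybar \<and> (s k, wk k) \<in> regular_normal_cone (normal_graph q) (y k, ys k)" for k
    using X(1)[of "k + K"] unfolding punctured_normals_def y_def ys_def s_def wk_def
    by (cases "X (k + K)") auto
  have ynorm: "ys k \<in> regular_normal_cone (feasible q) (y k)" for k
    using XX[of k] unfolding regular_normal_cone_def[of "normal_graph q"] by (auto simp: gph_def split: if_splits)
  have yf: "y k \<in> feasible q" for k using ynorm[of k] by (auto simp: regular_normal_cone_def split: if_splits)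
  have "\<exists>l. l \<in> multiplier_cone q (y k) \<and> ys k = lag_grad q (y k) l \<and> norm l \<le> \<kappa> * norm (ys k)" for k
  proof -
    have "y k \<noteq> ybar" using XX[of k] by simp
    from normal_multiplier[OF yN this ynorm] obtain l where
      "l \<in> multiplier_cone q (y k)" "ys k = lag_grad q (y k) l" "norm l \<le> \<kappa> * norm (ys k)" .
    then show ?thesis by (intro exI conjI)
  qed
  then have "\<forall>k. \<exists>l. l \<in> multiplier_cone q (y k) \<and> ys k = lag_grad q (y k) l \<and> norm l \<le> \<kappa> * norm (ys k)" ..
  then have "\<exists>l. \<forall>k. l k \<in> multiplier_cone q (y k) \<and> ys k = lag_grad q (y k) (l k) \<and> norm (l k) \<le> \<kappa> * norm (ys k)"
    by (rule choice)
  then obtain l where l: "\<And>k. l k \<in> multiplier_cone q (y k)" "\<And>k. ys k = lag_grad q (y k) (l k)"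
    "\<And>k. norm (l k) \<le> \<kappa> * norm (ys k)" by blast
  define t where "t k = norm (y k - ybar)" for k
  define V where "V k = (y k - ybar) /\<^sub>R t k" for k
  have t: "t k > 0" for k using XX[of k] by (simp add: t_def)
  have "(\<lambda>k. norm (y k - ybar)) \<longlonglongrightarrow> norm (ybar - ybar)" by (intro tendsto_intros lims)
  then have t_lim: "t \<longlonglongrightarrow> 0" by (simp add: t_def[abs_def])
  have normV: "norm (V k) = 1" for k using t[of k] by (simp add: V_def t_def)
  have yV: "y k = ybar + t k *\<^sub>R V k" for k using t[of k] by (simp add: V_def)
  have "bounded (range (\<lambda>k. (V k, l k)))"
  proof -
    have "(\<lambda>k. \<kappa> * norm (ys k)) \<longlonglongrightarrow> \<kappa> * norm ystar" by (intro tendsto_intros lims)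
    then have "bounded (range (\<lambda>k. \<kappa> * norm (ys k)))" by (rule convergent_imp_bounded)
    then obtain B where B: "\<And>k. norm (\<kappa> * norm (ys k)) \<le> B" by (auto simp: bounded_iff)
    have "norm (V k, l k) \<le> 1 + B" for k
    proof -
      have "norm (V k, l k) \<le> norm (V k) + norm (l k)" by (rule norm_Pair_le)
      also have "\<dots> \<le> 1 + B" using normV[of k] l(3)[of k] B[of k] by simp
      finally show ?thesis .
    qed
    then show ?thesis unfolding bounded_iff by blast
  qed
  then obtain p r1 where r1: "strict_mono r1" "((\<lambda>k. (V k, l k)) \<circ> r1) \<longlonglongrightarrow> p"
    using bounded_imp_convergent_subsequence by blast
  obtain r2 :: "nat \<Rightarrow> nat" and S where r2: "strict_mono r2"
    "\<And>k. (active q (y (r1 (r2 k))), {i. l (r1 (r2 k)) $ i > 0}) = S"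
    using const_subseq[of "\<lambda>k. (active q (y (r1 k)), {i. l (r1 k) $ i > 0})"] by blast
  define I where "I = fst S"
  define Ip where "Ip = snd S"
  define v where "v = fst p"
  define lam where "lam = snd p"
  define r where "r = r1 \<circ> r2"
  have r: "strict_mono r" unfolding r_def using r1(1) r2(1) by (rule strict_mono_o)
  have act: "active q (y (r k)) = I" and pos: "{i. l (r k) $ i > 0} = Ip" for k
    using r2(2)[of k] by (auto simp: I_def Ip_def r_def)
  have "((\<lambda>k. (V k, l k)) \<circ> r) \<longlonglongrightarrow> p"
    unfolding r_def o_assoc by (rule LIMSEQ_subseq_LIMSEQ[OF r1(2) r2(1)])
  then have pl: "(\<lambda>k. (V (r k), l (r k))) \<longlonglongrightarrow> p" by (simp add: o_def)
  have V_lim: "(\<lambda>k. V (r k)) \<longlonglongrightarrow> v" and l_lim: "(\<lambda>k. l (r k)) \<longlonglongrightarrow> lam"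
    unfolding v_def lam_def using tendsto_fst[OF pl] tendsto_snd[OF pl] by simp_all
  have sub: "(\<lambda>k. y (r k)) \<longlonglongrightarrow> ybar" "(\<lambda>k. ys (r k)) \<longlonglongrightarrow> ystar" "(\<lambda>k. s (r k)) \<longlonglongrightarrow> ws"
    "(\<lambda>k. wk (r k)) \<longlonglongrightarrow> w" "(\<lambda>k. t (r k)) \<longlonglongrightarrow> 0"
    using LIMSEQ_subseq_LIMSEQ[OF lims(1) r] LIMSEQ_subseq_LIMSEQ[OF lims(2) r] LIMSEQ_subseq_LIMSEQ[OF lims(3) r]
      LIMSEQ_subseq_LIMSEQ[OF lims(4) r] LIMSEQ_subseq_LIMSEQ[OF t_lim r] by (simp_all add: o_def)
  have tr: "t (r k) > 0" for k by (rule t)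
  have IpI: "Ip \<subseteq> I" using pos[of 0] act[of 0] multiplier_cone_active[OF l(1)[of "r 0"]] by force
  have IA: "I \<subseteq> active q ybar"
  proof
    fix i assume "i \<in> I"
    then have "q (y (r k)) $ i = 0" for k using act[of k] by (auto simp: active_def)
    then show "i \<in> active q ybar"
      using tendsto_component[OF sub(1), of i] by (simp add: active_def LIMSEQ_const_iff)
  qed
  have lam_nonneg: "lam $ i \<ge> 0" for i
    by (rule LIMSEQ_le_const[OF tendsto_vec_nth[OF l_lim]]) (use l(1) in \<open>auto simp: multiplier_cone_def\<close>)
  have lamIp: "{i. lam $ i > 0} \<subseteq> Ip"
  proof
    fix i assume "i \<in> {i. lam $ i > 0}"
    then have "lam $ i > 0" by simp
    with tendsto_vec_nth[OF l_lim] have "\<forall>\<^sub>F k in sequentially. l (r k) $ i > 0" by (rule order_tendstoD)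
    from sequentially_witness[OF this] show "i \<in> Ip" using pos by blast
  qed
  have lam: "lam \<in> multiplier_cone q ybar"
    using lam_nonneg lamIp IpI IA by (auto simp: multiplier_cone_iff)
  have ystar: "lag_grad q ybar lam = ystar"
    using tendsto_lag_grad[OF l_lim sub(1)] sub(2) unfolding l(2)[symmetric] by (rule LIMSEQ_unique)
  have v0: "v \<noteq> 0"
  proof -
    have "(\<lambda>k. norm (V (r k))) \<longlonglongrightarrow> norm v" by (rule tendsto_norm[OF V_lim])
    then show ?thesis by (auto simp: normV LIMSEQ_const_iff)
  qed
  have yVr: "ybar + t (r k) *\<^sub>R V (r k) = y (r k)" for k using yV by simp
  have vT: "v \<in> contingent_cone (feasible q) ybar"
    by (rule contingent_coneI[OF tr sub(5) V_lim]) (simp add: yVr yf)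
  have vlin: "dcomp q ybar i v \<le> 0" if "i \<in> active q ybar" for i
    using contingent_cone_linearized[OF vT that] .
  have vI: "dcomp q ybar i v = 0" if "i \<in> I" for i
  proof -
    have "(\<lambda>k. (q (ybar + t (r k) *\<^sub>R V (r k)) $ i - q ybar $ i) /\<^sub>R t (r k)) \<longlonglongrightarrow> dcomp q ybar i v"
      by (rule difference_quotient[OF has_grad tr sub(5) V_lim])
    moreover have "(q (ybar + t (r k) *\<^sub>R V (r k)) $ i - q ybar $ i) /\<^sub>R t (r k) = 0" for k
      using act[of k] IA that unfolding yVr by (auto simp: active_def)
    ultimately have "(\<lambda>k. 0) \<longlonglongrightarrow> dcomp q ybar i v" by (simp only:)
    then show ?thesis by (simp add: LIMSEQ_const_iff)
  qed
  \<comment> \<open>Twice the scaled second-order remainder. The vector \<open>2 V / t\<close>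
    solves the system for \<open>c k\<close> but is unbounded; closedness of solvability gives
    \<open>z\<close> for the limit.\<close>
  define c where "c k = (\<chi> i. 2 * ((q (ybar + t (r k) *\<^sub>R V (r k)) $ i - q ybar $ i
      - t (r k) * dcomp q ybar i (V (r k))) / (t (r k))\<^sup>2))" for k
  have "c \<longlonglongrightarrow> (\<chi> i. d2comp q ybar i v v)"
  proof (rule vec_tendstoI)
    fix i
    have "(\<lambda>k. c k $ i) \<longlonglongrightarrow> 2 * (d2comp q ybar i v v / 2)"
      unfolding c_def vec_lambda_beta
      by (intro tendsto_mult tendsto_const second_order_quotient[OF has_grad has_hess tr sub(5) V_lim])
    then show "(\<lambda>k. c k $ i) \<longlonglongrightarrow> (\<chi> i. d2comp q ybar i v v) $ i" by simp
  qed
  moreover have "\<exists>z. (\<forall>i\<in>I. dcomp q ybar i z + c k $ i = 0) \<and> (\<forall>i\<in>active q ybar - I. dcomp q ybar i z + c k $ i \<le> 0)" for k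
  proof (intro exI conjI ballI)
    let ?z = "(2 / t (r k)) *\<^sub>R V (r k)"
    have *: "dcomp q ybar i ?z + c k $ i = 2 * q (y (r k)) $ i / (t (r k))\<^sup>2" if "i \<in> active q ybar" for i
      using that tr[of k] unfolding c_def yVr by (simp add: active_def field_simps power2_eq_square)
    show "dcomp q ybar i ?z + c k $ i = 0" if "i \<in> I" for i
      using *[of i] that IA act[of k] by (auto simp: active_def)
    show "dcomp q ybar i ?z + c k $ i \<le> 0" if "i \<in> active q ybar - I" for i
      using *[of i] that yf[of "r k"] by (auto simp: feasible_def divide_nonpos_nonneg)
  qed
  ultimately have "\<exists>z. (\<forall>i\<in>I. dcomp q ybar i z + (\<chi> i. d2comp q ybar i v v) $ i = 0) \<and>
      (\<forall>i\<in>active q ybar - I. dcomp q ybar i z + (\<chi> i. d2comp q ybar i v v) $ i \<le> 0)"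
    using closed_sequentially[OF closed_solvable[OF IA, of "\<lambda>i. grad q i ybar"], of c] by blast
  then obtain z where z: "\<And>i. i \<in> I \<Longrightarrow> dcomp q ybar i z + d2comp q ybar i v v = 0"
    "\<And>i. i \<in> active q ybar - I \<Longrightarrow> dcomp q ybar i z + d2comp q ybar i v v \<le> 0" by auto
  have zS: "z \<in> second_order_set q ybar v"
    unfolding second_order_set_def using z by (force intro: eq_refl)
  have Iz: "I \<subseteq> second_order_active q ybar v z"
    using z(1) vI IA by (auto simp: second_order_active_def active_dir_def)
  have zJ: "second_order_active q ybar v z \<in> index_family q ybar v" using zS by (simp add: index_family_def)
  have "ystar \<bullet> v = 0"
  proof -
    have "lam $ i * dcomp q ybar i v = 0" for i
      using vI[of i] lamIp IpI lam_nonneg[of i] by (cases "lam $ i = 0") (auto simp: order_less_le)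
    then show ?thesis unfolding ystar[symmetric] inner_sum_scaleR by (intro sum.neutral ballI)
  qed
  then have crit: "v \<in> critical_cone q ybar ystar" using vT by (simp add: critical_cone_def)
  obtain J where J: "maximal_in (index_family q ybar v) J" "second_order_active q ybar v z \<subseteq> J"
    using exists_maximal_in[OF _ zJ] by auto
  have regI: "two_regular q I ybar v"
    using two_regular_mono[OF reg[OF crit v0 J(1)]] Iz J(2) by blast
  have T: "(v, lag_hessian q ybar lam *v v) \<in> contingent_cone (normal_graph q) (ybar, ystar)"
    unfolding ystar[symmetric]
    by (rule graph_tangent[OF lam tr sub(5) V_lim]) (use yf act lamIp IpI in \<open>auto simp: yVr\<close>)
  have D: "lam \<in> dir_multipliers q ybar ystar v"
    by (rule dir_multipliersI[OF _ zS]) (use lam ystar z(1) lamIp IpI in \<open>auto simp: multipliers_iff\<close>)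
  \<comment> \<open>The necessary conditions at the approaching points pass to the limit: membership
    of \<open>w\<close> by the outer limit, polarity by testing with inner approximations of each
    \<open>u\<close>.\<close>
  have wkC: "wk (r k) \<in> index_cone q (y (r k)) Ip I" for k
    using normal_in_index_cone[OF yf l(1)] XX[of "r k"] unfolding l(2)[of "r k"] pos[of k, symmetric] act[of k, symmetric]
    by blast
  have wC: "w \<in> index_cone_dir q ybar Ip I v"
    by (rule index_cone_outer_limit[OF tr sub(5) V_lim sub(4) IpI]) (simp add: yVr wkC)
  obtain C where "\<forall>\<^sub>F k in sequentially. \<forall>a :: real^'l. \<exists>b.
     (\<forall>i\<in>I. dcomp q (ybar + t (r k) *\<^sub>R V (r k)) i b = a $ i) \<and> norm b \<le> C * norm a / t (r k)"
    using two_regular_solvable[OF regI tr sub(5) V_lim] by blast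
  then have licq: "\<forall>\<^sub>F k in sequentially. licq q (y (r k))"
    unfolding licq_def yVr act by (rule eventually_mono) blast
  have "(ws + lag_hessian q ybar lam *v w) \<bullet> u \<le> 0" if u: "u \<in> index_cone_dir q ybar Ip I v" for u
  proof -
    obtain W where W: "W \<longlonglongrightarrow> u" "\<forall>\<^sub>F k in sequentially. W k \<in> index_cone q (ybar + t (r k) *\<^sub>R V (r k)) Ip I"
      using index_cone_inner_limit[OF regI tr sub(5) V_lim IpI u] by blast
    have "(\<lambda>k. (s (r k) + lag_hessian q (y (r k)) (l (r k)) *v wk (r k)) \<bullet> W k)
        \<longlonglongrightarrow> (ws + lag_hessian q ybar lam *v w) \<bullet> u"
      by (intro tendsto_inner tendsto_add lag_hessian_tendsto sub l_lim W)
    moreover have "\<forall>\<^sub>F k in sequentially. (s (r k) + lag_hessian q (y (r k)) (l (r k)) *v wk (r k)) \<bullet> W k \<le> 0"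
      using licq W(2)
    proof eventually_elim
      case (elim k)
      have "(s (r k), wk (r k)) \<in> regular_normal_cone (normal_graph q) (y (r k), lag_grad q (y (r k)) (l (r k)))"
        using XX[of "r k"] unfolding l(2)[of "r k"] by blast
      from licq_normal_subset[OF yf l(1) elim(1) this] elim(2)
      show ?case unfolding pos act yVr by (simp add: neg_polar_def)
    qed
    ultimately show ?thesis using tendsto_upperbound[OF _ _ sequentially_bot] by blast
  qed
  then have "(ws, w) \<in> Q_set q ybar v lam Ip I"
    unfolding Q_set_def neg_polar_def using wC by blast
  with that[OF v0 T D zJ lamIp IpI Iz] show ?thesis .
qed

end

section \<open>Regular normals whose base point is the reference point\<close>

lemma index_cone_linearized:
  "w \<in> index_cone q y Ip I \<Longrightarrow> i \<in> I \<Longrightarrow> dcomp q y i w \<le> 0"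
  by (cases "i \<in> Ip") (auto simp: index_cone_def)

lemma lag_grad_inner_index_cone:
  assumes "\<And>i. i \<notin> I \<Longrightarrow> mu $ i = 0" "\<And>i. i \<in> I - Ip \<Longrightarrow> mu $ i \<ge> 0"
    and "u \<in> index_cone q y Ip I"
  shows "lag_grad q y mu \<bullet> u \<le> 0"
  unfolding inner_sum_scaleR using assms
  by (intro sum_nonpos_of_signs[of I mu Ip]) (auto simp: index_cone_def)

context regular_vicinity
begin

text \<open>The normal \<open>ys\<close> is not tied to the reference normal, because it may vary
  along a sequence with fixed base point; accordingly 2-regularity is requested for the directions
  critical for \<open>ys\<close>.\<close>

context
  fixes ys v ws w :: "real^'m"
  assumes sub: "metrically_subregular_at (constraint_mf q) ybar 0"
    and ys: "ys \<in> regular_normal_cone (feasible q) ybar"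
    and normal: "(ws, w) \<in> regular_normal_cone (normal_graph q) (ybar, ys)"
    and reg: "\<And>u J. (\<And>i. i \<in> active q ybar \<Longrightarrow> dcomp q ybar i u \<le> 0) \<Longrightarrow> ys \<bullet> u = 0 \<Longrightarrow> u \<noteq> 0 \<Longrightarrow>
       maximal_in (index_family q ybar u) J \<Longrightarrow> two_regular q J ybar u"
    and v: "v \<in> null_active q ybar" "v \<noteq> 0"
begin

text \<open>The vector on which \<open>Q_set\<close> imposes its polarity condition.\<close>

abbreviation \<rho> where "\<rho> lam \<equiv> ws + lag_hessian q ybar lam *v w"

lemma null_zero: "i \<in> active q ybar \<Longrightarrow> dcomp q ybar i v = 0"
  using v(1) by (simp add: null_active_def)

lemma multiplier_null_inner: "lam \<in> multipliers q ybar ys \<Longrightarrow> ys \<bullet> v = 0"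
proof -
  assume lam: "lam \<in> multipliers q ybar ys"
  have "lam $ i * dcomp q ybar i v = 0" for i
    using null_zero[of i] multiplier_cone_active[of lam q ybar i] lam
    by (cases "lam $ i = 0") (auto simp: multipliers_iff)
  moreover have "ys = lag_grad q ybar lam" using lam by (simp add: multipliers_iff)
  ultimately show ?thesis unfolding inner_sum_scaleR by (simp only: inner_sum_scaleR sum.neutral_const)
qed

lemma multiplier_support_active_dir:
  assumes lam: "lam \<in> multipliers q ybar ys" and u: "\<And>i. i \<in> active q ybar \<Longrightarrow> dcomp q ybar i u \<le> 0"
    and 0: "ys \<bullet> u = 0" and i: "lam $ i > 0"
  shows "i \<in> active_dir q ybar u"
  using lag_grad_inner_eq_0D[of lam q ybar u i] multiplier_cone_active[of lam q ybar i] assms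
  by (auto simp: multipliers_iff active_dir_def)

text \<open>A multiplier of \<open>ys\<close> and a point from
  \<open>subregular_second_order\<close> are feasible for the two dual programs belonging to
  \<open>u\<close>; \<open>lp_complementary\<close> replaces them by an optimal pair.\<close>

lemma complementary_multiplier:
  assumes u: "\<And>i. i \<in> active q ybar \<Longrightarrow> dcomp q ybar i u \<le> 0"
  obtains lam z where "lam \<in> multipliers q ybar ys" "z \<in> second_order_set q ybar u"
    "\<And>i. lam $ i > 0 \<Longrightarrow> dcomp q ybar i z + d2comp q ybar i u u = 0"
proof -
  obtain lam0 where lam0: "lam0 \<in> multiplier_cone q ybar" "ys = lag_grad q ybar lam0"
    using subregular_normal_multiplier[OF sub ys] .
  obtain z0 where z0: "z0 \<in> second_order_set q ybar u"
    using subregular_second_order[OF sub feasible_base, of u] u by blast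
  obtain mu :: "real^'l" and z where mu:
    "\<And>i. i \<in> active q ybar - {} \<Longrightarrow> dcomp q ybar i z + (\<chi> i. d2comp q ybar i u u) $ i \<le> 0"
    "\<And>i. mu $ i \<noteq> 0 \<Longrightarrow> i \<in> active q ybar \<and> dcomp q ybar i z + (\<chi> i. d2comp q ybar i u u) $ i = 0"
    "\<And>i. i \<in> active q ybar - {} \<Longrightarrow> mu $ i \<ge> 0" "ys = lag_grad q ybar mu"
    by (rule lp_complementary[of "{}" "active q ybar" "\<lambda>i. grad q i ybar" z0 "\<chi> i. d2comp q ybar i u u" lam0 ys])
      (use z0 lam0 in \<open>auto simp: second_order_set_def multiplier_cone_def\<close>)
  have "mu $ i \<ge> 0" for i using mu(2)[of i] mu(3)[of i] by force
  then have "mu \<in> multipliers q ybar ys"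
    using mu(2,4) by (auto simp: multipliers_iff multiplier_cone_iff)
  moreover have "z \<in> second_order_set q ybar u" using mu(1) by (simp add: second_order_set_def)
  moreover have "dcomp q ybar i z + d2comp q ybar i u u = 0" if "mu $ i > 0" for i
    using mu(2)[of i] that by simp
  ultimately show ?thesis by (rule that)
qed

text \<open>Complementarity puts the support of \<open>lam\<close> into the second-order active set
  of \<open>z\<close>, so \<open>u\<close> lifts to a graph tangent; symmetry of the Hessian
  rewrites its product with the normal.\<close>

lemma normal_pairing:
  assumes u: "\<And>i. i \<in> active q ybar \<Longrightarrow> dcomp q ybar i u \<le> 0" "ys \<bullet> u = 0" "u \<noteq> 0"
    and lam: "lam \<in> multipliers q ybar ys" and z: "z \<in> second_order_set q ybar u"
    and comp: "\<And>i. lam $ i > 0 \<Longrightarrow> dcomp q ybar i z + d2comp q ybar i u u = 0"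
  shows "\<rho> lam \<bullet> u \<le> 0"
proof -
  have lam': "lam \<in> multiplier_cone q ybar" "ys = lag_grad q ybar lam" using lam by (auto simp: multipliers_iff)
  have "(u, lag_hessian q ybar lam *v u) \<in> contingent_cone (normal_graph q) (ybar, lag_grad q ybar lam)"
  proof (rule graph_tangent_direction[OF feasible_base u(1) _ lam'(1) z])
    show "two_regular q J ybar u" if "maximal_in (index_family q ybar u) J" for J
      using reg[of u J] u that by blast
    show "{i. lam $ i > 0} \<subseteq> second_order_active q ybar u z"
      using comp multiplier_support_active_dir[OF lam u(1,2)] by (auto simp: second_order_active_def)
  qed
  then have "(ws, w) \<bullet> (u, lag_hessian q ybar lam *v u) \<le> 0"
    using normal unfolding lam'(2) by (force simp: regular_normal_cone_def neg_polar_def split: if_splits)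
  then show ?thesis
    using lag_hessian_commute[where a = w and b = u]
    by (simp add: inner_add_left inner_add_right inner_commute)
qed

text \<open>Both \<open>v\<close> and \<open>-v\<close> are critical directions with the same second-order data.\<close>

lemma normal_pairing_null:
  assumes lam: "lam \<in> multipliers q ybar ys" and z: "z \<in> second_order_set q ybar v"
    and comp: "\<And>i. lam $ i > 0 \<Longrightarrow> dcomp q ybar i z + d2comp q ybar i v v = 0"
  shows "\<rho> lam \<bullet> v = 0"
proof -
  have minus: "hess q i ybar *v (- v) = - (hess q i ybar *v v)" for i
    by (simp add: linear_neg[OF matrix_vector_mul_linear])
  have yv: "ys \<bullet> v = 0" by (rule multiplier_null_inner[OF lam])
  have "\<rho> lam \<bullet> v \<le> 0"
    by (rule normal_pairing[OF _ yv v(2) lam z comp]) (simp_all add: null_zero)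
  moreover have "\<rho> lam \<bullet> (- v) \<le> 0"
    by (rule normal_pairing[of "- v" lam z, OF _ _ _ lam])
      (use z comp yv v(2) in \<open>simp_all add: null_zero second_order_set_def minus\<close>)
  ultimately show ?thesis by simp
qed

text \<open>Perturb \<open>v\<close> to \<open>v + t u\<close> and take complementary multipliers
  there. A support that recurs along a subsequence passes to \<open>v\<close> by closedness of
  solvability, so one multiplier is complementary for both directions. Its pairing with
  \<open>v\<close> is 0, which leaves the sign of the pairing with \<open>u\<close>.\<close>

lemma normal_pairing_critical:
  assumes u: "\<And>i. i \<in> active q ybar \<Longrightarrow> dcomp q ybar i u \<le> 0" "ys \<bullet> u = 0"
  shows "\<exists>lam \<in> dir_multipliers q ybar ys v. \<rho> lam \<bullet> u \<le> 0"
proof -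
  obtain t where t: "\<And>k. t k > 0" "t \<longlonglongrightarrow> (0::real)" using null_sequence by blast
  define uk where "uk k = v + t k *\<^sub>R u" for k
  have uk_lim: "uk \<longlonglongrightarrow> v" unfolding uk_def by (rule tendsto_scaleR_add[OF t(2) tendsto_const])
  have ukl: "dcomp q ybar i (uk k) \<le> 0" if "i \<in> active q ybar" for i k
    using u(1)[OF that] null_zero[OF that] t(1)[of k] by (simp add: uk_def inner_add_right mult_nonneg_nonpos)
  have "\<exists>p. fst p \<in> multipliers q ybar ys \<and> snd p \<in> second_order_set q ybar (uk k) \<and>
     (\<forall>i. fst p $ i > 0 \<longrightarrow> dcomp q ybar i (snd p) + d2comp q ybar i (uk k) (uk k) = 0)" for k
  proof -
    obtain lam z where "lam \<in> multipliers q ybar ys" "z \<in> second_order_set q ybar (uk k)"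
      "\<And>i. lam $ i > 0 \<Longrightarrow> dcomp q ybar i z + d2comp q ybar i (uk k) (uk k) = 0"
      using complementary_multiplier[of "uk k"] ukl[of _ k] by blast
    then show ?thesis by (intro exI[of _ "(lam, z)"]) simp
  qed
  then have "\<forall>k. \<exists>p. fst p \<in> multipliers q ybar ys \<and> snd p \<in> second_order_set q ybar (uk k) \<and>
     (\<forall>i. fst p $ i > 0 \<longrightarrow> dcomp q ybar i (snd p) + d2comp q ybar i (uk k) (uk k) = 0)" ..
  then have "\<exists>p. \<forall>k. fst (p k) \<in> multipliers q ybar ys \<and> snd (p k) \<in> second_order_set q ybar (uk k) \<and>
     (\<forall>i. fst (p k) $ i > 0 \<longrightarrow> dcomp q ybar i (snd (p k)) + d2comp q ybar i (uk k) (uk k) = 0)"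
    by (rule choice)
  then obtain p where p: "\<And>k. fst (p k) \<in> multipliers q ybar ys"
    "\<And>k. snd (p k) \<in> second_order_set q ybar (uk k)"
    "\<And>k i. fst (p k) $ i > 0 \<Longrightarrow> dcomp q ybar i (snd (p k)) + d2comp q ybar i (uk k) (uk k) = 0" by blast
  obtain r :: "nat \<Rightarrow> nat" and S where r: "strict_mono r" "\<And>k. {i. fst (p (r k)) $ i > 0} = S"
    using const_subseq[of "\<lambda>k. {i. fst (p k) $ i > 0}"] by blast
  have SA: "S \<subseteq> active q ybar"
    using r(2)[of 0] p(1)[of "r 0"] by (auto simp: multipliers_iff multiplier_cone_iff)
  have ukr: "(\<lambda>k. uk (r k)) \<longlonglongrightarrow> v" using LIMSEQ_subseq_LIMSEQ[OF uk_lim r(1)] by (simp add: o_def)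
  define c where "c k = (\<chi> i. d2comp q ybar i (uk (r k)) (uk (r k)))" for k
  have "c \<longlonglongrightarrow> (\<chi> i. d2comp q ybar i v v)"
  proof (rule vec_tendstoI)
    fix i
    have "(\<lambda>k. d2comp q ybar i (uk (r k)) (uk (r k))) \<longlonglongrightarrow> d2comp q ybar i v v"
      by (intro tendsto_inner ukr bounded_linear.tendsto[OF matrix_vector_mul_bounded_linear])
    then show "(\<lambda>k. c k $ i) \<longlonglongrightarrow> (\<chi> i. d2comp q ybar i v v) $ i" by (simp add: c_def)
  qed
  moreover have "\<exists>z. (\<forall>i\<in>S. dcomp q ybar i z + c k $ i = 0) \<and> (\<forall>i\<in>active q ybar - S. dcomp q ybar i z + c k $ i \<le> 0)" for k
    using p(2)[of "r k"] p(3)[of "r k"] r(2)[of k]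
    by (intro exI[of _ "snd (p (r k))"]) (auto simp: c_def second_order_set_def)
  ultimately have "\<exists>z. (\<forall>i\<in>S. dcomp q ybar i z + (\<chi> i. d2comp q ybar i v v) $ i = 0) \<and>
      (\<forall>i\<in>active q ybar - S. dcomp q ybar i z + (\<chi> i. d2comp q ybar i v v) $ i \<le> 0)"
    using closed_sequentially[OF closed_solvable[OF SA, of "\<lambda>i. grad q i ybar"], of c] by blast
  then obtain z where z: "\<And>i. i \<in> S \<Longrightarrow> dcomp q ybar i z + d2comp q ybar i v v = 0"
    "\<And>i. i \<in> active q ybar - S \<Longrightarrow> dcomp q ybar i z + d2comp q ybar i v v \<le> 0" by auto
  have zS: "z \<in> second_order_set q ybar v"
    unfolding second_order_set_def using z by (force intro: eq_refl)
  have "\<forall>\<^sub>F k in sequentially. uk (r k) \<noteq> 0" using ukr v(2) by (rule tendsto_imp_eventually_ne)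
  from sequentially_witness[OF this] obtain k where k: "uk (r k) \<noteq> 0" ..
  \<comment> \<open>A single \<open>k\<close> suffices: the limit concerned the support pattern, not
    the multipliers themselves.\<close>
  define lam where "lam = fst (p (r k))"
  have lam: "lam \<in> multipliers q ybar ys" using p(1) by (simp add: lam_def)
  have comp: "dcomp q ybar i z + d2comp q ybar i v v = 0" if "lam $ i > 0" for i
    using z(1)[of i] r(2)[of k] that by (auto simp: lam_def)
  have "ys \<bullet> uk (r k) = 0" using multiplier_null_inner[OF lam] u(2) by (simp add: uk_def inner_add_right)
  then have "\<rho> lam \<bullet> uk (r k) \<le> 0"
    by (intro normal_pairing[OF ukl _ k lam p(2)]) (use p(3) in \<open>auto simp: lam_def\<close>)
  moreover have "\<rho> lam \<bullet> v = 0"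
    by (rule normal_pairing_null[OF lam zS comp])
  ultimately have "t (r k) * (\<rho> lam \<bullet> u) \<le> 0"
    by (simp add: uk_def inner_add_right)
  then have "\<rho> lam \<bullet> u \<le> 0"
    using t(1)[of "r k"] by (simp add: mult_le_0_iff)
  moreover have "lam \<in> dir_multipliers q ybar ys v" by (rule dir_multipliersI[OF lam zS comp])
  ultimately show ?thesis by blast
qed

text \<open>The multiplier in \<open>normal_pairing_critical\<close> depends on \<open>u\<close>; a Farkas argument makes it uniform.\<close>

lemma uniform_multiplier:
  obtains lam z where "lam \<in> multipliers q ybar ys" "z \<in> second_order_set q ybar v"
    "\<And>i. lam $ i > 0 \<Longrightarrow> dcomp q ybar i z + d2comp q ybar i v v = 0"
    "\<rho> lam \<in> neg_polar (index_cone q ybar {i. lam $ i > 0} (active q ybar))"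
proof -
  obtain lam0 z where lam0: "lam0 \<in> multipliers q ybar ys" and z: "z \<in> second_order_set q ybar v"
    and comp: "\<And>i. lam0 $ i > 0 \<Longrightarrow> dcomp q ybar i z + d2comp q ybar i v v = 0"
    using complementary_multiplier[of v] null_zero order_eq_refl by blast
  define S where "S = {i \<in> active q ybar. dcomp q ybar i z + d2comp q ybar i v v = 0}"
  define P where "P = {i. lam0 $ i > 0}"
  have PA: "P \<subseteq> active q ybar"
    using lam0 by (auto simp: P_def multipliers_iff multiplier_cone_iff)
  \<comment> \<open>Coefficients on the left copy form \<open>lam\<close>, representing
    \<open>ys\<close> and the Hessian part of \<open>ws\<close>; those on the right copy form
    \<open>mu\<close>, representing the rest of \<open>ws\<close>. Farkas' lemma in the product
    space finds both at once.\<close>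
  define G :: "'l + 'l \<Rightarrow> (real^'m) \<times> (real^'m)" where
    "G = case_sum (\<lambda>i. (grad q i ybar, - (hess q i ybar *v w))) (\<lambda>i. (0, grad q i ybar))"
  \<comment> \<open>For \<open>p = (a, b)\<close> the vector \<open>b\<close> is critical for
    \<open>ys\<close>. The multiplier selected by \<open>b\<close> is supported in \<open>S\<close>
    by complementarity, so the inequalities for \<open>a\<close> can be weighted with it.\<close>
  have "(ys, ws) \<bullet> p \<le> 0"
    if p: "\<And>i. i \<in> Inr ` P \<Longrightarrow> G i \<bullet> p = 0" "\<And>i. i \<in> (Inl ` S \<union> Inr ` active q ybar) - Inr ` P \<Longrightarrow> G i \<bullet> p \<le> 0" for p
  proof -
    obtain a b where ab: "p = (a, b)" by (cases p)
    have b0: "dcomp q ybar i b = 0" if "i \<in> P" for i using p(1)[of "Inr i"] that by (simp add: G_def ab)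
    have bA: "dcomp q ybar i b \<le> 0" if "i \<in> active q ybar" for i
      using p(2)[of "Inr i"] b0[of i] that by (cases "i \<in> P") (auto simp: G_def ab image_iff)
    have aS: "grad q i ybar \<bullet> a - d2comp q ybar i b w \<le> 0" if "i \<in> S" for i
    proof -
      have "G (Inl i) \<bullet> p \<le> 0" using that by (intro p(2)) auto
      then show ?thesis by (simp add: G_def ab inner_commute)
    qed
    have yb: "ys \<bullet> b = 0"
    proof -
      have "lam0 $ i * dcomp q ybar i b = 0" for i
        using b0[of i] lam0 by (cases "lam0 $ i = 0") (auto simp: P_def multipliers_iff multiplier_cone_def order_less_le)
      moreover have "ys = lag_grad q ybar lam0" using lam0 by (simp add: multipliers_iff)
      ultimately show ?thesis by (simp only: inner_sum_scaleR sum.neutral_const)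
    qed
    obtain lam where lam: "lam \<in> dir_multipliers q ybar ys v" "\<rho> lam \<bullet> b \<le> 0"
      using normal_pairing_critical[OF bA yb] by blast
    have lm: "lam \<in> multipliers q ybar ys" using lam(1) by (simp add: dir_multipliers_def)
    have "(\<Sum>i\<in>UNIV. lam $ i * (grad q i ybar \<bullet> a - d2comp q ybar i b w)) \<le> 0"
    proof (rule sum_nonpos)
      fix i
      show "lam $ i * (grad q i ybar \<bullet> a - d2comp q ybar i b w) \<le> 0"
      proof (cases "lam $ i > 0")
        case True
        then have "i \<in> S"
          using dir_multipliers_complementary[OF lam(1) z lam0 comp] lm multiplier_cone_active[of lam q ybar i]
          by (auto simp: S_def multipliers_iff)
        with True aS show ?thesis by (simp add: mult_nonneg_nonpos)
      next
        case False
        then have "lam $ i = 0" using lm by (auto simp: multipliers_iff multiplier_cone_def order_less_le)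
        then show ?thesis by simp
      qed
    qed
    then have "lag_grad q ybar lam \<bullet> a - b \<bullet> (lag_hessian q ybar lam *v w) \<le> 0"
      by (simp add: lag_hessian_inner inner_sum_scaleR right_diff_distrib sum_subtractf)
    moreover have "lag_grad q ybar lam = ys" using lm by (simp add: multipliers_iff)
    ultimately show ?thesis
      using lam(2) by (simp add: ab inner_add_left inner_add_right inner_commute)
  qed
  then have "\<exists>\<zeta> :: real^('l + 'l). (\<forall>i. i \<notin> Inl ` S \<union> Inr ` active q ybar \<longrightarrow> \<zeta> $ i = 0) \<and>
      (\<forall>i\<in>(Inl ` S \<union> Inr ` active q ybar) - Inr ` P. \<zeta> $ i \<ge> 0) \<and> (ys, ws) = (\<Sum>i\<in>UNIV. \<zeta> $ i *\<^sub>R G i)"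
    using PA by (intro farkas) auto
  then obtain \<zeta> :: "real^('l + 'l)" where \<zeta>: "\<And>i. i \<notin> Inl ` S \<union> Inr ` active q ybar \<Longrightarrow> \<zeta> $ i = 0"
      "\<And>i. i \<in> (Inl ` S \<union> Inr ` active q ybar) - Inr ` P \<Longrightarrow> \<zeta> $ i \<ge> 0" "(ys, ws) = (\<Sum>i\<in>UNIV. \<zeta> $ i *\<^sub>R G i)"
    by blast
  define lam where "lam = (\<chi> i. \<zeta> $ Inl i)"
  define mu where "mu = (\<chi> i. \<zeta> $ Inr i)"
  have "(\<Sum>i\<in>UNIV. \<zeta> $ i *\<^sub>R G i) = (\<Sum>i\<in>UNIV. \<zeta> $ Inl i *\<^sub>R G (Inl i)) + (\<Sum>i\<in>UNIV. \<zeta> $ Inr i *\<^sub>R G (Inr i))"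
    unfolding UNIV_Plus_UNIV[symmetric] by (subst sum.Plus) simp_all
  also have "\<dots> = (lag_grad q ybar lam, lag_grad q ybar mu - lag_hessian q ybar lam *v w)"
    by (simp add: G_def lam_def mu_def lag_hessian_mult sum_prod sum_negf)
  finally have eqs: "ys = lag_grad q ybar lam" "ws = lag_grad q ybar mu - lag_hessian q ybar lam *v w"
    using \<zeta>(3) by simp_all
  have lam_nonneg: "lam $ i \<ge> 0" and lamS: "lam $ i > 0 \<Longrightarrow> i \<in> S" for i
    using \<zeta>(1)[of "Inl i"] \<zeta>(2)[of "Inl i"] by (cases "i \<in> S"; force simp: lam_def)+
  have lam: "lam \<in> multipliers q ybar ys"
    using lam_nonneg lamS eqs(1) by (auto simp: multipliers_iff multiplier_cone_iff S_def)
  have mu0: "mu $ i = 0" if "i \<notin> active q ybar" for i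
    using \<zeta>(1)[of "Inr i"] that by (auto simp: mu_def)
  have mu1: "mu $ i \<ge> 0" if "i \<in> active q ybar - P" for i
    using \<zeta>(2)[of "Inr i"] that by (auto simp: mu_def)
  have "\<rho> lam \<in> neg_polar (index_cone q ybar {i. lam $ i > 0} (active q ybar))"
    unfolding neg_polar_def mem_Collect_eq
  proof
    fix u assume u: "u \<in> index_cone q ybar {i. lam $ i > 0} (active q ybar)"
    have ul: "dcomp q ybar i u \<le> 0" if "i \<in> active q ybar" for i
      using index_cone_linearized[OF u that] .
    have "lam $ i * dcomp q ybar i u = 0" for i
      using u lam_nonneg[of i] by (cases "lam $ i = 0") (auto simp: index_cone_def order_less_le)
    then have "ys \<bullet> u = 0" unfolding eqs(1) by (simp only: inner_sum_scaleR sum.neutral_const)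
    \<comment> \<open>Being orthogonal to \<open>ys\<close>, the direction \<open>u\<close> also
      annihilates the gradients in the support of \<open>lam0\<close>; the sign conditions on
      \<open>mu\<close> are stated relative to that set.\<close>
    then have "dcomp q ybar i u = 0" if "i \<in> P" for i
      using multiplier_support_active_dir[OF lam0 ul, of i] that by (simp add: P_def active_dir_def)
    then have "u \<in> index_cone q ybar P (active q ybar)" using ul by (simp add: index_cone_def)
    with mu0 mu1 have "lag_grad q ybar mu \<bullet> u \<le> 0" by (rule lag_grad_inner_index_cone)
    then show "\<rho> lam \<bullet> u \<le> 0" by (simp add: eqs(2))
  qed
  with lam z lamS that show ?thesis by (auto simp: S_def)
qed

text \<open>Farkas' lemma writes \<open>\<rho> lam\<close> as a combination of gradients, and
  duality aligns this combination with a second-order point \<open>z\<close>; \<open>I\<close>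
  consists of the constraints tight at \<open>z\<close>. The remaining solvability condition on
  \<open>w\<close> follows from the vanishing pairings with \<open>v\<close>, and then
  \<open>Q_set_subset_closure\<close> applies.\<close>

lemma base_normal_closure: "((ybar, ys), (ws, w)) \<in> closure (punctured_normals q ybar)"
proof -
  obtain lam z0 where lam: "lam \<in> multipliers q ybar ys" and z0: "z0 \<in> second_order_set q ybar v"
    and comp0: "\<And>i. lam $ i > 0 \<Longrightarrow> dcomp q ybar i z0 + d2comp q ybar i v v = 0"
    and n: "\<rho> lam \<in> neg_polar (index_cone q ybar {i. lam $ i > 0} (active q ybar))"
    using uniform_multiplier by blast
  define P where "P = {i. lam $ i > 0}"
  have lam': "lam \<in> multiplier_cone q ybar" "lag_grad q ybar lam = ys" using lam by (auto simp: multipliers_iff)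
  have PA: "P \<subseteq> active q ybar" using lam' by (auto simp: P_def multiplier_cone_iff)
  have "\<rho> lam \<bullet> a \<le> 0"
    if "\<And>i. i \<in> P \<Longrightarrow> grad q i ybar \<bullet> a = 0" "\<And>i. i \<in> active q ybar - P \<Longrightarrow> grad q i ybar \<bullet> a \<le> 0" for a
    using n that by (auto simp: neg_polar_def index_cone_def P_def)
  then have "\<exists>mu :: real^'l. (\<forall>i. i \<notin> active q ybar \<longrightarrow> mu $ i = 0) \<and> (\<forall>i\<in>active q ybar - P. mu $ i \<ge> 0) \<and>
    \<rho> lam = lag_grad q ybar mu"
    by (rule farkas[OF PA])
  then obtain mu0 :: "real^'l" where mu0: "\<And>i. i \<notin> active q ybar \<Longrightarrow> mu0 $ i = 0"
    "\<And>i. i \<in> active q ybar - P \<Longrightarrow> mu0 $ i \<ge> 0" "\<rho> lam = lag_grad q ybar mu0" by blast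
  \<comment> \<open>Complementary slackness confines the support of the combination to the
    constraints tight at \<open>z\<close>, with the rows in \<open>P\<close> kept as
    equations.\<close>
  obtain mu :: "real^'l" and z where mu:
    "\<And>i. i \<in> P \<Longrightarrow> dcomp q ybar i z + (\<chi> i. d2comp q ybar i v v) $ i = 0"
    "\<And>i. i \<in> active q ybar - P \<Longrightarrow> dcomp q ybar i z + (\<chi> i. d2comp q ybar i v v) $ i \<le> 0"
    "\<And>i. mu $ i \<noteq> 0 \<Longrightarrow> i \<in> active q ybar \<and> dcomp q ybar i z + (\<chi> i. d2comp q ybar i v v) $ i = 0"
    "\<And>i. i \<in> active q ybar - P \<Longrightarrow> mu $ i \<ge> 0" "\<rho> lam = lag_grad q ybar mu"
    by (rule lp_complementary[of P "active q ybar" "\<lambda>i. grad q i ybar" z0 "\<chi> i. d2comp q ybar i v v" mu0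
        "\<rho> lam"])
      (use z0 comp0 mu0 PA in \<open>auto simp: second_order_set_def P_def\<close>)
  have z: "z \<in> second_order_set q ybar v"
    unfolding second_order_set_def using mu(1,2) by (force intro: eq_refl)
  define I where "I = second_order_active q ybar v z"
  have I: "I = {i \<in> active q ybar. dcomp q ybar i z + d2comp q ybar i v v = 0}"
    using null_zero by (auto simp: I_def second_order_active_def active_dir_def)
  have PI: "P \<subseteq> I" using mu(1) PA unfolding I by auto
  have "w \<in> index_cone q ybar P (active q ybar)"
    using normal_in_index_cone[OF feasible_base lam'(1)] normal unfolding lam'(2) P_def by blast
  then have wI: "w \<in> index_cone q ybar P I" unfolding I by (auto simp: index_cone_def)
  have "\<exists>a. (\<forall>i\<in>P. grad q i ybar \<bullet> a + (\<chi> i. d2comp q ybar i v w) $ i = 0) \<and>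
     (\<forall>i\<in>I - P. grad q i ybar \<bullet> a + (\<chi> i. d2comp q ybar i v w) $ i \<le> 0)"
  proof (rule gale[OF PI])
    fix \<eta> :: "real^'l"
    assume \<eta>: "\<And>i. i \<notin> I \<Longrightarrow> \<eta> $ i = 0" "\<And>i. i \<in> I - P \<Longrightarrow> \<eta> $ i \<ge> 0" "lag_grad q ybar \<eta> = 0"
    obtain t where t: "\<And>k. t k > 0" "t \<longlonglongrightarrow> (0::real)" using null_sequence by blast
    have \<eta>0: "\<eta> $ i \<ge> 0" if "lam $ i = 0" for i
      using \<eta>(1,2)[of i] that by (cases "i \<in> I") (auto simp: P_def)
    have "\<forall>\<^sub>F k in sequentially. \<forall>i. lam $ i + t k * \<eta> $ i \<ge> 0"
      by (rule nonneg_perturbation[OF t(2,1) _ \<eta>0]) (use lam' in \<open>auto simp: multiplier_cone_def\<close>)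
    from sequentially_witness[OF this] obtain k where k: "\<And>i. lam $ i + t k * \<eta> $ i \<ge> 0" by blast
    \<comment> \<open>A certificate \<eta> is a direction in which the multiplier can move while
      staying complementary to \<open>z\<close>. Both ends have zero pairing with \<open>v\<close>,
      so the Hessian terms weighted by \<eta> sum to 0.\<close>
    define lam2 where "lam2 = lam + t k *\<^sub>R \<eta>"
    have supp: "i \<in> I" if "lam2 $ i > 0" for i
      using that \<eta>(1)[of i] PI by (cases "i \<in> I") (auto simp: lam2_def P_def)
    have "lag_grad q ybar lam2 = lag_grad q ybar lam + t k *\<^sub>R lag_grad q ybar \<eta>"
      by (simp add: lam2_def scaleR_sum_right sum.distrib scaleR_left_distrib)
    then have "lag_grad q ybar lam2 = ys" using \<eta>(3) lam'(2) by simp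
    moreover have "lam2 \<in> multiplier_cone q ybar"
      using supp k unfolding multiplier_cone_iff I by (auto simp: lam2_def)
    ultimately have lam2: "lam2 \<in> multipliers q ybar ys" by (simp add: multipliers_iff)
    have 1: "\<rho> lam2 \<bullet> v = 0"
      by (rule normal_pairing_null[OF lam2 z]) (use supp in \<open>auto simp: I\<close>)
    have 2: "\<rho> lam \<bullet> v = 0"
      by (rule normal_pairing_null[OF lam z]) (use PI in \<open>auto simp: I P_def\<close>)
    have "v \<bullet> (lag_hessian q ybar lam2 *v w) = v \<bullet> (lag_hessian q ybar lam *v w) + t k * (\<Sum>i\<in>UNIV. \<eta> $ i * d2comp q ybar i v w)"
      unfolding lag_hessian_inner by (simp add: lam2_def distrib_right sum.distrib sum_distrib_left mult.assoc)
    then have "t k * (\<Sum>i\<in>UNIV. \<eta> $ i * d2comp q ybar i v w) = 0"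
      using 1 2 unfolding inner_commute[of _ v] inner_add_right by linarith
    then have "(\<Sum>i\<in>UNIV. \<eta> $ i * d2comp q ybar i v w) = 0" using t(1)[of k] by simp
    then show "\<eta> \<bullet> (\<chi> i. d2comp q ybar i v w) \<le> 0" by (simp add: inner_vec_def)
  qed
  then have wD: "w \<in> index_cone_dir q ybar P I v" using wI by (auto simp: index_cone_dir_def)
  have "lag_grad q ybar mu \<bullet> u \<le> 0" if "u \<in> index_cone_dir q ybar P I v" for u
  proof (rule lag_grad_inner_index_cone)
    show "mu $ i = 0" if "i \<notin> I" for i using mu(3)[of i] that unfolding I by auto
    show "mu $ i \<ge> 0" if "i \<in> I - P" for i using mu(4)[of i] that unfolding I by auto
    show "u \<in> index_cone q ybar P I" using that by (simp add: index_cone_dir_def)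
  qed
  then have "lag_grad q ybar mu \<in> neg_polar (index_cone_dir q ybar P I v)"
    unfolding neg_polar_def by (intro CollectI ballI)
  then have Q: "(ws, w) \<in> Q_set q ybar v lam P I"
    unfolding Q_set_def mu(5)[symmetric] using wD by (intro CollectI case_prodI conjI)
  have "((ybar, lag_grad q ybar lam), (ws, w)) \<in> closure (punctured_normals q ybar)"
  proof (rule Q_set_subset_closure[OF v(2) _ _ z PI _ lam'(1) _ Q])
    show "two_regular q J ybar v" if "maximal_in (index_family q ybar v) J" for J
      using reg[of v J] that v(2) null_zero multiplier_null_inner[OF lam] by simp
  qed (simp_all add: null_zero I_def P_def)
  then show ?thesis by (simp only: lam'(2))
qed

end

end

theorem theorem4:
  fixes q :: "real^'m \<Rightarrow> real^'l" and ybar ystar :: "real^'m"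
  assumes "twice_cont_diff q"
    and "ybar \<in> feasible q"
    and "ystar \<in> regular_normal_cone (feasible q) ybar"
    and "metrically_subregular_at (constraint_mf q) ybar 0"
    and "regular_in_vicinity q ybar"
    and "\<And>u J. u \<in> critical_cone q ybar ystar \<Longrightarrow> u \<noteq> 0 \<Longrightarrow>
           maximal_in (index_family q ybar u) J \<Longrightarrow> two_regular q J ybar u"
    and "null_active q ybar \<noteq> {0}"
  shows "limiting_normal_cone (gph (regular_normal_cone (feasible q))) (ybar, ystar) =
    regular_normal_cone (gph (regular_normal_cone (feasible q))) (ybar, ystar) \<union>
    (\<Union>(v, vstar) \<in> {(v, vstar).
         (v, vstar) \<in> contingent_cone (gph (regular_normal_cone (feasible q))) (ybar, ystar) \<and>
         v \<noteq> 0}.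
     \<Union>(lam, mu) \<in> multiplier_pairs q ybar ystar v vstar.
     \<Union>J \<in> index_family q ybar v.
     \<Union>(Ip, I) \<in> {(Ip, I). pos_index lam mu \<subseteq> Ip \<and> Ip \<subseteq> I \<and> I \<subseteq> J}.
       Q_set q ybar v lam Ip I)" (is "?L = ?R \<union> ?U")
proof -
  obtain N \<kappa> where N: "open N" "ybar \<in> N" "\<And>y. y \<in> feasible q \<inter> N \<Longrightarrow> y \<noteq> ybar \<Longrightarrow>
      metrically_regular_near (constraint_mf q) \<kappa> y 0"
    using assms(5) unfolding regular_in_vicinity_def by blast
  interpret regular_vicinity q ybar N \<kappa>
    by unfold_locales (use assms(1,2) N in auto)
  have "0 \<in> null_active q ybar" by (simp add: null_active_def)
  then obtain v0 where v0: "v0 \<in> null_active q ybar" "v0 \<noteq> 0" using assms(7) by blast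
  have in_U: "n \<in> ?U" if n: "((ybar, ystar), n) \<in> closure (punctured_normals q ybar)" for n
  proof -
    obtain ws w where nw: "n = (ws, w)" by (cases n)
    obtain v lam J Ip I where *: "v \<noteq> 0"
      "(v, lag_hessian q ybar lam *v v) \<in> contingent_cone (normal_graph q) (ybar, ystar)"
      "lam \<in> dir_multipliers q ybar ystar v" "J \<in> index_family q ybar v"
      "{i. lam $ i > 0} \<subseteq> Ip" "Ip \<subseteq> I" "I \<subseteq> J" "(ws, w) \<in> Q_set q ybar v lam Ip I"
      using closure_normal_cases[OF _ assms(6)] n unfolding nw by blast
    have "lam \<in> multiplier_cone q ybar" using *(3) by (simp add: dir_multipliers_def multipliers_iff)
    then have "0 \<in> contingent_cone (multiplier_cone q ybar) lam"
      using LIMSEQ_inverse_real_of_nat by (intro contingent_coneI[of "\<lambda>k. inverse (real (Suc k))" "\<lambda>k. 0"]) auto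
    then have "(lam, 0) \<in> multiplier_pairs q ybar ystar v (lag_hessian q ybar lam *v v)"
      using *(3) by (simp add: multiplier_pairs_def)
    moreover have "pos_index lam 0 = {i. lam $ i > 0}" by (auto simp: pos_index_def)
    ultimately show ?thesis using * unfolding nw by blast
  qed
  show ?thesis
  proof (intro equalityI subsetI)
    fix n assume "n \<in> ?L"
    then obtain Z Z' where Z: "Z \<longlonglongrightarrow> (ybar, ystar)" "\<And>k. Z k \<in> normal_graph q" "Z' \<longlonglongrightarrow> n"
      "\<And>k. Z' k \<in> regular_normal_cone (normal_graph q) (Z k)"
      unfolding limiting_normal_cone_def by blast
    have lim: "(\<lambda>k. (Z k, Z' k)) \<longlonglongrightarrow> ((ybar, ystar), n)" using Z(1,3) by (rule tendsto_Pair)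
    have "((ybar, ystar), n) \<in> closure (punctured_normals q ybar)"
    proof (cases "\<forall>\<^sub>F k in sequentially. fst (Z k) \<noteq> ybar")
      case True
      then have "\<forall>\<^sub>F k in sequentially. (Z k, Z' k) \<in> closure (punctured_normals q ybar)"
      proof (rule eventually_mono)
        fix k assume "fst (Z k) \<noteq> ybar"
        then have "(Z k, Z' k) \<in> punctured_normals q ybar"
          using Z(4)[of k] by (cases "Z k") (simp add: punctured_normals_def)
        then show "(Z k, Z' k) \<in> closure (punctured_normals q ybar)" using closure_subset by blast
      qed
      from Lim_in_closed_set[OF closed_closure this sequentially_bot lim] show ?thesis .
    next
      case False
      then obtain r1 :: "nat \<Rightarrow> nat" where r1: "strict_mono r1" "\<And>k. \<not> fst (Z (r1 k)) \<noteq> ybar"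
        using infinite_subseq[of "\<lambda>k. fst (Z k) \<noteq> ybar"] by blast
      \<comment> \<open>The base point is constant along this subsequence, but the graph points
        still move through their second component.\<close>
      define ys where "ys k = snd (Z (r1 k))" for k
      have Zr: "Z (r1 k) = (ybar, ys k)" for k using r1(2)[of k] by (simp add: ys_def prod_eq_iff)
      have ysn: "ys k \<in> regular_normal_cone (feasible q) ybar" for k
        using Z(2)[of "r1 k"] unfolding Zr by (simp add: gph_def)
      have "\<exists>l. l \<in> multipliers q ybar (ys k)" for k
      proof -
        from subregular_normal_multiplier[OF assms(4) ysn[of k]] obtain l
          where "l \<in> multiplier_cone q ybar" "ys k = lag_grad q ybar l" .
        then have "l \<in> multipliers q ybar (ys k)" by (simp only: multipliers_iff)
        then show ?thesis ..
      qed
      then obtain l where l: "\<And>k. l k \<in> multipliers q ybar (ys k)" by metis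
      obtain r2 :: "nat \<Rightarrow> nat" and S where r2: "strict_mono r2" "\<And>k. {i. l (r2 k) $ i > 0} = S"
        using const_subseq[of "\<lambda>k. {i. l k $ i > 0}"] by blast
      have ys_lim: "(\<lambda>k. ys (r2 k)) \<longlonglongrightarrow> ystar"
        using tendsto_snd[OF LIMSEQ_subseq_LIMSEQ[OF Z(1) strict_mono_o[OF r1(1) r2(1)]]]
        by (simp add: ys_def o_def)
      \<comment> \<open>2-regularity is given only for directions critical for \<open>ystar\<close>.
        As the multipliers of all \<open>ys (r2 j)\<close> share the support \<open>S\<close>, a
        direction orthogonal to one of these normals is orthogonal to all of them and to their
        limit.\<close>
      have crit: "u \<in> critical_cone q ybar ystar"
        if u: "\<And>i. i \<in> active q ybar \<Longrightarrow> dcomp q ybar i u \<le> 0" "ys (r2 k) \<bullet> u = 0" for u k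
      proof -
        have lk: "l (r2 k) \<in> multiplier_cone q ybar" "lag_grad q ybar (l (r2 k)) = ys (r2 k)" for k
          using l[of "r2 k"] by (simp_all add: multipliers_iff)
        have S: "dcomp q ybar i u = 0" if "i \<in> S" for i
          using lag_grad_inner_eq_0D[OF lk(1)[of k] u(1)] u(2) lk(2)[of k] r2(2)[of k] that by auto
        have "ys (r2 j) \<bullet> u = 0" for j
        proof -
          have "l (r2 j) $ i * dcomp q ybar i u = 0" for i
            using S[of i] r2(2)[of j] lk(1)[of j]
            by (cases "l (r2 j) $ i = 0") (auto simp: multiplier_cone_def order_less_le)
          then show ?thesis unfolding lk(2)[symmetric] by (simp only: inner_sum_scaleR sum.neutral_const)
        qed
        moreover have "(\<lambda>j. ys (r2 j) \<bullet> u) \<longlonglongrightarrow> ystar \<bullet> u" by (intro tendsto_intros ys_lim)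
        ultimately have "ystar \<bullet> u = 0" by (simp add: LIMSEQ_const_iff)
        with subregular_contingent[OF assms(4,2), of u] u(1) show ?thesis by (simp add: critical_cone_def)
      qed
      have "(Z (r1 (r2 k)), Z' (r1 (r2 k))) \<in> closure (punctured_normals q ybar)" for k
      proof -
        have "(fst (Z' (r1 (r2 k))), snd (Z' (r1 (r2 k)))) \<in> regular_normal_cone (normal_graph q) (ybar, ys (r2 k))"
          using Z(4)[of "r1 (r2 k)"] unfolding Zr by simp
        then have "((ybar, ys (r2 k)), (fst (Z' (r1 (r2 k))), snd (Z' (r1 (r2 k))))) \<in> closure (punctured_normals q ybar)"
          by (rule base_normal_closure[OF assms(4) ysn _ _ v0]) (use assms(6) crit in blast)
        then show ?thesis by (simp add: Zr)
      qed
      moreover have "(\<lambda>k. (Z (r1 (r2 k)), Z' (r1 (r2 k)))) \<longlonglongrightarrow> ((ybar, ystar), n)"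
        using LIMSEQ_subseq_LIMSEQ[OF lim strict_mono_o[OF r1(1) r2(1)]] by (simp add: o_def)
      ultimately show ?thesis by (rule closed_sequentially[OF closed_closure])
    qed
    then show "n \<in> ?R \<union> ?U" using in_U by blast
  next
    fix n assume "n \<in> ?R \<union> ?U"
    then show "n \<in> ?L"
    proof
      assume n: "n \<in> ?R"
      then have "(ybar, ystar) \<in> normal_graph q"
        by (auto simp: regular_normal_cone_def[of "normal_graph q"] split: if_splits)
      then show ?thesis
        unfolding limiting_normal_cone_def using n
        by (intro CollectI exI[of _ "\<lambda>_. (ybar, ystar)"] exI[of _ "\<lambda>_. n"]) simp
    next
      assume "n \<in> ?U"
      then obtain v vstar lam mu J Ip I where v: "v \<noteq> 0"
        and T: "(v, vstar) \<in> contingent_cone (normal_graph q) (ybar, ystar)"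
        and lm: "(lam, mu) \<in> multiplier_pairs q ybar ystar v vstar" and J: "J \<in> index_family q ybar v"
        and I: "pos_index lam mu \<subseteq> Ip" "Ip \<subseteq> I" "I \<subseteq> J" and Q: "n \<in> Q_set q ybar v lam Ip I"
        by blast
      obtain t X where t: "\<And>k. t k > 0" "t \<longlonglongrightarrow> (0::real)" and X: "X \<longlonglongrightarrow> (v, vstar)"
        "\<And>k. (ybar, ystar) + t k *\<^sub>R X k \<in> normal_graph q"
        using T unfolding contingent_cone_def by blast
      have "ybar + t k *\<^sub>R fst (X k) \<in> feasible q" for k
        using X(2)[of k] by (cases "X k") (auto simp: gph_def regular_normal_cone_def split: if_splits)
      then have vT: "v \<in> contingent_cone (feasible q) ybar"
        using contingent_coneI[OF t tendsto_fst[OF X(1)]] by simp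
      have lam: "lam \<in> multiplier_cone q ybar" "lag_grad q ybar lam = ystar"
        using lm by (auto simp: multiplier_pairs_def dir_multipliers_def multipliers_iff)
      obtain z where z: "z \<in> second_order_set q ybar v" "J = second_order_active q ybar v z"
        using J by (auto simp: index_family_def)
      have lamIp: "{i. lam $ i > 0} \<subseteq> Ip" using I(1) by (auto simp: pos_index_def)
      \<comment> \<open>The support of \<open>lam\<close> lies in \<open>J\<close>, whose gradients
        annihilate \<open>v\<close>; this makes \<open>v\<close> critical, so that the 2-regularity
        hypothesis covers it.\<close>
      have "lam $ i * dcomp q ybar i v = 0" for i
        using lamIp I(2,3) lam(1) unfolding z(2)
        by (cases "lam $ i = 0") (auto simp: multiplier_cone_def order_less_le second_order_active_def active_dir_def)
      then have "ystar \<bullet> v = 0" unfolding lam(2)[symmetric] by (simp only: inner_sum_scaleR sum.neutral_const)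
      then have crit: "v \<in> critical_cone q ybar ystar" using vT by (simp add: critical_cone_def)
      obtain ws w where nw: "n = (ws, w)" by (cases n)
      have "((ybar, lag_grad q ybar lam), (ws, w)) \<in> closure (punctured_normals q ybar)"
        by (rule Q_set_subset_closure[OF v _ _ z(1) I(2) _ lam(1) lamIp])
           (use contingent_cone_linearized[OF vT] assms(6)[OF crit v] I(3) z(2) Q nw in auto)
      then have "((ybar, ystar), n) \<in> closure (punctured_normals q ybar)" by (simp only: nw lam(2))
      then obtain Y where Y: "\<And>k. Y k \<in> punctured_normals q ybar" "Y \<longlonglongrightarrow> ((ybar, ystar), n)"
        unfolding closure_sequential by blast
      have "snd (Y k) \<in> regular_normal_cone (normal_graph q) (fst (Y k))" for k
        using Y(1)[of k] by (cases "Y k") (auto simp: punctured_normals_def)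
      moreover from this have "fst (Y k) \<in> normal_graph q" for k
        by (metis empty_iff regular_normal_cone_def)
      ultimately show ?thesis
        unfolding limiting_normal_cone_def
        using tendsto_fst[OF Y(2)] tendsto_snd[OF Y(2)]
        by (intro CollectI exI[of _ "\<lambda>k. fst (Y k)"] exI[of _ "\<lambda>k. snd (Y k)"]) simp
    qed
  qed
qed

end
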